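(* Let $Z_1,\dots,Z_n$ be i.i.d. with distribution $Q$ on a measurable space $\mathcal Z$, $Z\sim Q$, let $\psi:\mathcal Z\to\mathbb R^r$ be measurable with $\int\|\psi\|^2dQ<\infty$ and $\theta=\int\psi\,dQ$. Let $m\ge1$ be fixed and $u:\mathcal Z\to\mathbb R^m$ measurable with $\int\|u\|^2dQ<\infty$, $\int u\,dQ=0$ and $W=\int uu^\top dQ$ nonsingular. Let $\hat u$ be an estimator of $u$ (a random function $\mathcal Z\to\mathbb R^m$ which may depend on $Z_1,\dots,Z_n$), and set $\hat W=\frac1n\sum_{j=1}^n\hat u(Z_j)\hat u(Z_j)^\top$. Assume: (i) $\max_{1\le j\le n}\|\hat u(Z_j)\|=o_p(n^{1/2})$; (ii) $|\hat W-W|_o=o_p(1)$; (iii) $\frac1n\sum_{j=1}^n\big(\psi(Z_j)\hat u(Z_j)^\top-E[\psi(Z_j)\hat u(Z_j)^\top]\big)=o_p(1)$; and that there is a measurable $v:\mathcal Z\to\mathbb R^m$ with $\int\|v\|^2dQ<\infty$, $\int v\,dQ=0$, $\int vv^\top dQ$ nonsingular, such that (iv) $\frac1n\sum_{j=1}^nE\big(\|\hat u(Z_j)-v(Z_j)\|^2\big)=o(1)$; (v) $\frac1n\sum_{j=1}^n\hat u(Z_j)=\frac1n\sum_{j=1}^n v(Z_j)+o_p(n^{-1/2})$. Then, with probability tending to one, there is a unique $\hat\zeta\in\mathbb R^m$ with $1+\hat u(Z_j)^\top\hat\zeta>0$ for all $j$ and $\frac1n\sum_{j=1}^n\hat u(Z_j)/(1+\hat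 u(Z_j)^\top\hat\zeta)=0$, and the estimator $$\hat\theta=\frac1n\sum_{j=1}^n\frac{\psi(Z_j)}{1+\hat u(Z_j)^\top\hat\zeta}$$ satisfies $\hat\theta=\bar\psi-\bar\phi+o_p(n^{-1/2})$, where $\bar\psi=\frac1n\sum_j\psi(Z_j)$, $\phi=E(\psi(Z)v(Z)^\top)\big(E(v(Z)v(Z)^\top)\big)^{-1}v$ is the componentwise $L_2(Q)$-projection of $\psi$ onto the linear span of the components of $v$, and $\bar\phi=\frac1n\sum_j\phi(Z_j)$. Consequently, if $\Sigma=\mathrm{Var}(\psi(Z))-\mathrm{Var}(\phi(Z))$ is nonsingular, then $\sqrt n(\hat\theta-\theta)\Rightarrow N(0,\Sigma)$.
   Context: $|A|_o$ denotes the spectral (operator) norm of a matrix $A$, i.e. its largest eigenvalue for a symmetric positive semidefinite matrix. Expectations involving $\hat u$ are taken with respect to the joint distribution of the sample. $o_p$, $O_p$ are the usual stochastic order symbols; $\Rightarrow$ denotes convergence in distribution. *)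

theory Defs
  imports "HOL-Probability.Probability"
begin

definition outer :: "real^'m \<Rightarrow> real^'n \<Rightarrow> real^'n^'m" where
  "outer x y = (\<chi> i j. x $ i * y $ j)"

definition covmat :: "'z measure \<Rightarrow> ('z \<Rightarrow> real^'r) \<Rightarrow> real^'r^'r" where
  "covmat Q f = integral\<^sup>L Q (\<lambda>z. outer (f z - integral\<^sup>L Q f) (f z - integral\<^sup>L Q f))"

text \<open>Stochastic order: X n = o_p(a n).  The exceptional event is only required to be
  contained in a measurable set of small probability (outer probability), so the
  notion makes sense also for possibly non-measurable X n; for measurable X n it is
  the usual definition.\<close>
definition op_small ::
  "'w measure \<Rightarrow> (nat \<Rightarrow> 'w \<Rightarrow> 'a::real_normed_vector) \<Rightarrow> (nat \<Rightarrow> real) \<Rightarrow> bool" where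
  "op_small P X a \<longleftrightarrow>
     (\<forall>\<epsilon>>0. \<forall>\<delta>>0. eventually (\<lambda>n. \<exists>A\<in>sets P.
         {\<omega>\<in>space P. norm (X n \<omega>) > \<epsilon> * a n} \<subseteq> A \<and> measure P A < \<delta>) sequentially)"

definition wptto :: "'w measure \<Rightarrow> (nat \<Rightarrow> 'w \<Rightarrow> bool) \<Rightarrow> bool" where
  "wptto P E \<longleftrightarrow>
     (\<forall>\<delta>>0. eventually (\<lambda>n. \<exists>A\<in>sets P. A \<subseteq> {\<omega>\<in>space P. E n \<omega>} \<and> measure P A > 1 - \<delta>)
        sequentially)"

definition mvnormal :: "real^'r^'r \<Rightarrow> (real^'r) measure" where
  "mvnormal S = density lborel (\<lambda>x. ennreal
     (exp (- (x \<bullet> (matrix_inv S *v x)) / 2) / sqrt ((2 * pi) ^ CARD('r) * det S)))"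

definition conv_distr :: "'w measure \<Rightarrow> (nat \<Rightarrow> 'w \<Rightarrow> real^'r) \<Rightarrow> (real^'r) measure \<Rightarrow> bool" where
  "conv_distr P X \<mu> \<longleftrightarrow>
     (\<forall>f :: real^'r \<Rightarrow> real. continuous_on UNIV f \<and> bounded (range f) \<longrightarrow>
        (\<lambda>n. \<integral>\<omega>. f (X n \<omega>) \<partial>P) \<longlonglongrightarrow> (\<integral>x. f x \<partial>\<mu>))"

end

theory Submission
  imports Defs
begin

text \<open>The multiplier equation has exactly one admissible root as soon as \<open>max |u\<^sub>j|\<close> times the norm of the mean of
  the \<open>u\<^sub>j\<close> is small against the least eigenvalue of the second moment matrix: Brouwer's theorem gives a zero of the
  field on a small ball, on whose boundary it points inwards, and strict monotonicity of the field gives uniqueness. The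
  root is therefore \<open>O\<^sub>p(n\<^sup>-\<^sup>1\<^sup>/\<^sup>2)\<close>, and expanding \<open>1 / (1 + s) = 1 - s + s\<^sup>2 / (1 + s)\<close> in the equation and in the
  estimator gives the linearization. Conditions (ii) and (iv) and the weak law of large numbers force \<open>\<integral> u u\<^sup>T = \<integral> v v\<^sup>T\<close>.

  For the limit distribution, the one-dimensional central limit theorem gives convergence of the characteristic
  functions of all projections. Tightness and uniform approximation by trigonometric polynomials, which are dense on
  compact sets by the Stone-Weierstrass theorem, turn this into weak convergence.\<close>

section \<open>Change of variables for linear maps\<close>

text \<open>The values \<open>uhat n \<omega> (Z j \<omega>)\<close> are in general neither
  independent nor identically distributed, since the estimator may use the whole sample. The law of
  large numbers and the central limit theorem are therefore applied only to fixed functions of a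
  single \<open>Z j\<close>, and every statement about \<open>uhat\<close> comes from (i)-(v) by
  comparison with \<open>v\<close>. In particular, (iv) allows the centring in (iii) to be replaced
  by E(psi v^T).

  Existence, uniqueness and size of the multiplier are decided by two random quantities: the
  operator distance of the empirical second moments from their limit, and the largest norm times the
  norm of the mean. Once both are small, the question concerns finitely many vectors and no
  probability. The powers of n cancel in the product, because (i) makes the maximum o_p(n^(1/2)) and
  (v) makes the mean O_p(n^(-1/2)).

  The normal law is given by a density with a determinant and an inverse matrix. The change of
  variables below identifies it with a linear image of the standard Gaussian measure, which yields
  its total mass and its characteristic function.\<close>

lemma nn_integral_lborel_shear:
  fixes f :: "real^'n \<Rightarrow> ennreal"
  assumes [measurable]: "f \<in> borel_measurable borel" and mn: "m \<noteq> n"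
  shows "(\<integral>\<^sup>+x. f (x + (x $ n) *\<^sub>R axis m 1) \<partial>lborel) = (\<integral>\<^sup>+x. f x \<partial>lborel)"
proof -
  interpret product_sigma_finite "\<lambda>_::real^'n. lborel :: real measure"
    by standard
  \<comment> \<open>The variable integrated first is coordinate \<open>m\<close>. With the others
    fixed, the shear translates it by the constant \<open>x $ n\<close>, as
    \<open>m \<noteq> n\<close>, and Lebesgue measure on the line is translation invariant.\<close>
  define em en where "em = (axis m 1 :: real^'n)" and "en = (axis n 1 :: real^'n)"
  define B where "B = Basis - {em}"
  have em: "em \<in> Basis" and en: "en \<in> Basis" "en \<noteq> em" and B: "finite B" "em \<notin> B" "Basis = insert em B" "en \<in> B"
    using mn by (auto simp: em_def en_def B_def axis_eq_axis)
  define T where "T x = (\<Sum>b\<in>Basis. x b *\<^sub>R b)" for x :: "real^'n \<Rightarrow> real"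
  have [measurable]: "T \<in> borel_measurable (Pi\<^sub>M Basis (\<lambda>_. lborel))" unfolding T_def by measurable
  have Tn: "T x $ n = x en" for x
  proof -
    have "T x $ n = T x \<bullet> en" by (simp add: en_def inner_axis)
    also have "\<dots> = x en" using en unfolding T_def by (simp add: inner_sum_left inner_Basis if_distrib cong: if_cong)
    finally show ?thesis .
  qed
  have Tupd: "T (x(em := y)) + c *\<^sub>R em = T (x(em := c + y))" for x y c
    unfolding T_def B(3) using B(1,2) by (simp add: scaleR_add_left add_ac cong: sum.cong) (auto intro!: sum.cong)
  have eq: "(\<integral>\<^sup>+x. g x \<partial>lborel) = (\<integral>\<^sup>+x. \<integral>\<^sup>+y. g (T (x(em := y))) \<partial>lborel \<partial>Pi\<^sub>M B (\<lambda>_. lborel))"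
    if [measurable]: "g \<in> borel_measurable borel" for g :: "real^'n \<Rightarrow> ennreal"
  proof -
    have "(\<integral>\<^sup>+x. g x \<partial>lborel) = (\<integral>\<^sup>+x. g (T x) \<partial>Pi\<^sub>M Basis (\<lambda>_. lborel))"
      by (subst lborel_eq, subst nn_integral_distr) (auto simp: T_def)
    also have "\<dots> = (\<integral>\<^sup>+x. \<integral>\<^sup>+y. g (T (x(em := y))) \<partial>lborel \<partial>Pi\<^sub>M B (\<lambda>_. lborel))"
      unfolding B(3) by (rule product_nn_integral_insert) (use B in \<open>auto simp flip: B(3)\<close>)
    finally show ?thesis .
  qed
  have "(\<integral>\<^sup>+x. f (x + (x $ n) *\<^sub>R axis m 1) \<partial>lborel)
      = (\<integral>\<^sup>+x. \<integral>\<^sup>+y. f (T (x(em := x en + y))) \<partial>lborel \<partial>Pi\<^sub>M B (\<lambda>_. lborel))"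
    by (subst eq) (use en in \<open>simp_all add: em_def[symmetric] Tn Tupd\<close>)
  also have "\<dots> = (\<integral>\<^sup>+x. \<integral>\<^sup>+y. f (T (x(em := y))) \<partial>lborel \<partial>Pi\<^sub>M B (\<lambda>_. lborel))"
  proof (rule nn_integral_cong)
    fix x :: "real^'n \<Rightarrow> real" assume x: "x \<in> space (Pi\<^sub>M B (\<lambda>_. lborel))"
    have [measurable]: "(\<lambda>y. f (T (x(em := y)))) \<in> borel_measurable borel"
      unfolding T_def B(3) by (subst sum.insert) (use B in \<open>auto\<close>)
    show "(\<integral>\<^sup>+y. f (T (x(em := x en + y))) \<partial>lborel) = (\<integral>\<^sup>+y. f (T (x(em := y))) \<partial>lborel)"
      by (subst (2) lborel_distr_plus[of "x en", symmetric], subst nn_integral_distr) auto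
  qed
  also have "\<dots> = (\<integral>\<^sup>+x. f x \<partial>lborel)" by (rule eq[symmetric]) measurable
  finally show ?thesis .
qed

text \<open>Permuting coordinates carries boxes to boxes with the same side lengths, and the measure
  of boxes determines \<open>lborel\<close>.\<close>

lemma nn_integral_lborel_swap:
  fixes f :: "real^'n \<Rightarrow> ennreal"
  assumes [measurable]: "f \<in> borel_measurable borel"
  shows "(\<integral>\<^sup>+x. f (\<chi> i. x $ Transposition.transpose m n i) \<partial>lborel) = (\<integral>\<^sup>+x. f x \<partial>lborel)"
proof -
  let ?h = "\<lambda>v::real^'n. \<chi> i. v $ Transposition.transpose m n i"
  have "linear ?h" by (rule linearI) (simp_all add: vec_eq_iff)
  then have [measurable]: "?h \<in> borel_measurable borel"
    by (intro borel_measurable_continuous_onI linear_continuous_on linear_conv_bounded_linear[THEN iffD1])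
  have eq: "lborel = distr lborel borel ?h"
  proof (rule lborel_eqI)
    fix l u :: "real^'n" assume le: "\<And>b. b \<in> Basis \<Longrightarrow> l \<bullet> b \<le> u \<bullet> b"
    have le': "l $ i \<le> u $ i" for i using le[of "axis i 1"] by (simp add: inner_axis axis_in_Basis_iff)
    have pre: "?h -` box l u = box (?h l) (?h u)"
      by (auto simp: mem_box_cart) (metis transpose_involutory)+
    have P: "(\<Prod>b\<in>Basis. (u' - l') \<bullet> b) = (\<Prod>i\<in>UNIV. u' $ i - l' $ i)" for u' l' :: "real^'n"
      unfolding Basis_vec_def by (simp add: UNION_singleton_eq_range prod.reindex inj_on_def axis_eq_axis inner_axis)
    have "emeasure (distr lborel borel ?h) (box l u) = emeasure lborel (box (?h l) (?h u))"
      by (simp add: emeasure_distr pre)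
    also have "\<dots> = ennreal (\<Prod>i\<in>UNIV. ?h u $ i - ?h l $ i)"
      by (subst emeasure_lborel_box) (auto simp only: P, auto simp: Basis_vec_def inner_axis le')
    also have "(\<Prod>i\<in>UNIV. ?h u $ i - ?h l $ i) = (\<Prod>i\<in>UNIV. u $ i - l $ i)"
      using prod.permute[OF permutes_swap_id, where S=UNIV and g="\<lambda>i. u $ i - l $ i", of m n] by (simp add: o_def)
    finally show "emeasure (distr lborel borel ?h) (box l u) = (\<Prod>b\<in>Basis. (u - l) \<bullet> b)"
      by (simp only: P)
  qed simp
  have "(\<integral>\<^sup>+x. f x \<partial>lborel) = (\<integral>\<^sup>+x. f x \<partial>distr lborel borel ?h)"
    by (rule arg_cong[OF eq, of "\<lambda>M. \<integral>\<^sup>+x. f x \<partial>M"])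
  also have "\<dots> = (\<integral>\<^sup>+x. f (?h x) \<partial>lborel)" by (intro nn_integral_distr) simp_all
  finally show ?thesis by (rule sym)
qed

lemma nn_integral_lborel_stretch:
  fixes f :: "real^'n \<Rightarrow> ennreal"
  assumes [measurable]: "f \<in> borel_measurable borel" and c: "\<And>i. c i \<noteq> 0"
  shows "(\<integral>\<^sup>+x. f x \<partial>lborel) = ennreal \<bar>\<Prod>i\<in>UNIV. c i\<bar> * (\<integral>\<^sup>+x. f (\<chi> i. c i * x $ i) \<partial>lborel)"
proof -
  \<comment> \<open>\<open>lborel_affine_euclidean\<close> indexes the factors by basis vectors; the
    sum is \<open>c i\<close> at the vector \<open>axis i 1\<close>.\<close>
  let ?c = "\<lambda>b::real^'n. \<Sum>i\<in>UNIV. if b = axis i 1 then c i else 0"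
  have ca: "?c (axis i 1) = c i" for i by (simp add: axis_eq_axis)
  define T where "T x = 0 + (\<Sum>j\<in>Basis. (?c j * (x \<bullet> j)) *\<^sub>R j)" for x :: "real^'n"
  have T: "T x = (\<chi> i. c i * x $ i)" for x
  proof -
    have "T x = (\<Sum>i\<in>UNIV. (c i * x $ i) *\<^sub>R axis i 1)"
      unfolding T_def Basis_vec_def
      by (simp add: UNION_singleton_eq_range sum.reindex inj_on_def axis_eq_axis inner_axis ca cong: sum.cong)
    then show ?thesis by (simp add: vec_eq_iff axis_def if_distrib cong: if_cong)
  qed
  have p: "(\<Prod>j\<in>Basis. \<bar>?c j\<bar>) = \<bar>\<Prod>i\<in>UNIV. c i\<bar>"
    unfolding Basis_vec_def by (simp add: UNION_singleton_eq_range prod.reindex inj_on_def axis_eq_axis ca abs_prod)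
  have [measurable]: "T \<in> borel_measurable borel" unfolding T_def by measurable
  have "lborel = density (distr lborel borel T) (\<lambda>_. (\<Prod>j\<in>Basis. \<bar>?c j\<bar>))"
    unfolding T_def by (rule lborel_affine_euclidean) (use c ca in \<open>auto simp: Basis_vec_def axis_eq_axis\<close>)
  then have "(\<integral>\<^sup>+x. f x \<partial>lborel) = (\<integral>\<^sup>+x. f x \<partial>density (distr lborel borel T) (\<lambda>_. \<bar>\<Prod>i\<in>UNIV. c i\<bar>))"
    unfolding p by simp
  also have "\<dots> = ennreal \<bar>\<Prod>i\<in>UNIV. c i\<bar> * (\<integral>\<^sup>+x. f (T x) \<partial>lborel)"
    by (simp add: nn_integral_density nn_integral_distr nn_integral_cmult)
  finally show ?thesis unfolding T .
qed

text \<open>Linear maps are compositions of elementary ones and determinants multiply, so only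
  stretches, swaps and shears need a computation.\<close>

lemma nn_integral_lborel_linear:
  fixes g :: "real^'n \<Rightarrow> real^'n" and f :: "real^'n \<Rightarrow> ennreal"
  assumes "linear g" "f \<in> borel_measurable borel" "det (matrix g) \<noteq> 0"
  shows "(\<integral>\<^sup>+x. f x \<partial>lborel) = ennreal \<bar>det (matrix g)\<bar> * (\<integral>\<^sup>+x. f (g x) \<partial>lborel)"
proof -
  \<comment> \<open>The integrand is quantified inside \<open>R\<close>, since a composition needs
    the formula for \<open>h\<close> and for \<open>h\<close> composed with the outer map. The
    condition on the determinant is part of \<open>R\<close>, which makes \<open>R\<close> vacuous
    for singular maps.\<close>
  define R where "R g \<longleftrightarrow> (\<forall>f\<in>borel_measurable borel. det (matrix g) \<noteq> 0 \<longrightarrow>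
    (\<integral>\<^sup>+x. f x \<partial>lborel) = ennreal \<bar>det (matrix g)\<bar> * (\<integral>\<^sup>+x. f (g x) \<partial>lborel))" for g :: "real^'n \<Rightarrow> real^'n"
  have "R g"
  proof (rule induct_linear_elementary[OF \<open>linear g\<close>])
    fix f g :: "real^'n \<Rightarrow> real^'n" assume *: "linear f" "linear g" "R f" "R g"
    have [measurable]: "f \<in> borel_measurable borel"
      using *(1) by (intro borel_measurable_continuous_onI linear_continuous_on linear_conv_bounded_linear[THEN iffD1])
    show "R (f \<circ> g)" unfolding R_def
    proof (intro ballI impI)
      fix h :: "real^'n \<Rightarrow> ennreal" assume [measurable]: "h \<in> borel_measurable borel"
      assume "det (matrix (f \<circ> g)) \<noteq> 0"
      moreover have d: "det (matrix (f \<circ> g)) = det (matrix f) * det (matrix g)"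
        using * by (simp add: matrix_compose det_mul)
      ultimately have n: "det (matrix f) \<noteq> 0" "det (matrix g) \<noteq> 0" by auto
      have "(\<integral>\<^sup>+x. h x \<partial>lborel) = ennreal \<bar>det (matrix f)\<bar> * (\<integral>\<^sup>+x. h (f x) \<partial>lborel)"
        using *(3)[unfolded R_def, rule_format, of h] n \<open>h \<in> borel_measurable borel\<close> by blast
      also have "(\<integral>\<^sup>+x. h (f x) \<partial>lborel) = ennreal \<bar>det (matrix g)\<bar> * (\<integral>\<^sup>+x. h (f (g x)) \<partial>lborel)"
        using *(4)[unfolded R_def, rule_format, of "\<lambda>x. h (f x)"] n by measurable
      finally show "(\<integral>\<^sup>+x. h x \<partial>lborel) = ennreal \<bar>det (matrix (f \<circ> g))\<bar> * (\<integral>\<^sup>+x. h ((f \<circ> g) x) \<partial>lborel)"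
        by (simp add: d abs_mult ennreal_mult mult.assoc)
    qed
  next
    fix f :: "real^'n \<Rightarrow> real^'n" and i assume "linear f" and 0: "\<And>x. f x $ i = 0"
    then have "\<not> inj f"
      by (metis (full_types) linear_injective_imp_surjective one_neq_zero surjE vec_component)
    then show "R f" using det_nz_iff_inj[OF \<open>linear f\<close>] by (simp add: R_def)
  next
    fix c :: "'n \<Rightarrow> real"
    have d: "det (matrix (\<lambda>a. \<chi> i. c i * a $ i)) = (\<Prod>i\<in>UNIV. c i)"
      by (simp add: axis_def matrix_def det_diagonal)
    show "R (\<lambda>x. \<chi> i. c i * x $ i)"
      unfolding R_def d
    proof (intro ballI impI)
      fix f :: "real^'n \<Rightarrow> ennreal" assume "f \<in> borel_measurable borel" "prod c UNIV \<noteq> 0"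
      then show "(\<integral>\<^sup>+x. f x \<partial>lborel) = ennreal \<bar>prod c UNIV\<bar> * (\<integral>\<^sup>+x. f (\<chi> i. c i * x $ i) \<partial>lborel)"
        by (intro nn_integral_lborel_stretch) auto
    qed
  next
    fix m n :: 'n assume "m \<noteq> n"
    let ?h = "\<lambda>v::real^'n. \<chi> i. v $ Transposition.transpose m n i"
    have "(\<chi> i j. if Transposition.transpose m n i = j then 1 else 0) = (\<chi> i j. if j = Transposition.transpose m n i then 1 else (0::real))"
      by (auto intro!: Cart_lambda_cong)
    \<comment> \<open>Up to transposition this is the identity with permuted columns, so its
      determinant is the sign of a permutation.\<close>
    then have "matrix ?h = transpose (\<chi> i j. mat 1 $ i $ Transposition.transpose m n j)"
      by (auto simp: matrix_eq transpose_def axis_def mat_def matrix_def)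
    then have 1: "\<bar>det (matrix ?h)\<bar> = 1"
      by (simp add: det_permute_columns permutes_swap_id sign_swap_id abs_mult)
    show "R ?h" unfolding R_def 1 ennreal_1 mult_1
      by (intro ballI impI nn_integral_lborel_swap[symmetric])
  next
    fix m n :: 'n assume mn: "m \<noteq> n"
    let ?h = "\<lambda>v::real^'n. \<chi> i. if i = m then v $ m + v $ n else v $ i"
    have h: "?h = (\<lambda>v. v + (v $ n) *\<^sub>R axis m 1)"
      by (auto simp: vec_eq_iff axis_def)
    \<comment> \<open>The shear adds row \<open>n\<close> of the identity to row \<open>m\<close>,
      which leaves the determinant unchanged.\<close>
    have "matrix ?h = (\<chi> k. if k = m then row m (mat 1) + 1 *s row n (mat 1) else row k (mat 1))"
      using mn by (auto simp: matrix_def axis_def vec_eq_iff mat_def row_def)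
    then have "det (matrix ?h) = 1" using det_row_operation[OF mn, of "mat 1 :: real^'n^'n" 1] by simp
    then show "R ?h" unfolding R_def h
      by (simp only: abs_one ennreal_1 mult_1) (intro ballI impI nn_integral_lborel_shear[OF _ mn, symmetric])
  qed
  then show ?thesis using assms unfolding R_def by blast
qed

section \<open>Gaussian measures\<close>

definition std_gauss :: "('a::euclidean_space) measure" where
  "std_gauss = density lborel (\<lambda>x. ennreal (exp (- (norm x)\<^sup>2 / 2) / sqrt ((2 * pi) ^ DIM('a))))"

lemma gauss_exp_prod:
  fixes x :: "'a::euclidean_space"
  shows "exp (- (norm x)\<^sup>2 / 2) = (\<Prod>b\<in>Basis. exp (- (x \<bullet> b)\<^sup>2 / 2))"
proof -
  have "- (norm x)\<^sup>2 / 2 = (\<Sum>b\<in>Basis. - (x \<bullet> b)\<^sup>2 / 2)"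
    unfolding power2_norm_eq_inner
    by (subst euclidean_inner) (simp add: power2_eq_square sum_negf sum_divide_distrib)
  then show ?thesis by (simp only: exp_sum finite_Basis)
qed

lemma std_gauss_density_prod:
  fixes x :: "'a::euclidean_space"
  shows "exp (- (norm x)\<^sup>2 / 2) / sqrt ((2 * pi) ^ DIM('a)) = (\<Prod>b\<in>Basis. std_normal_density (x \<bullet> b))"
  unfolding gauss_exp_prod
  by (simp add: normal_density_def prod_dividef real_sqrt_mult real_sqrt_power power_mult_distrib prod.distrib power_one_over)

lemma sets_std_gauss [simp, measurable_cong]: "sets std_gauss = sets borel"
  by (simp add: std_gauss_def)

lemma space_std_gauss [simp]: "space std_gauss = UNIV"
  by (simp add: std_gauss_def)

lemma prob_space_std_gauss: "prob_space (std_gauss :: 'a::euclidean_space measure)"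
proof
  have "emeasure (std_gauss :: 'a measure) (space std_gauss)
      = (\<integral>\<^sup>+x. (\<Prod>b\<in>Basis. ennreal (std_normal_density ((x::'a) \<bullet> b))) \<partial>lborel)"
    unfolding std_gauss_def std_gauss_density_prod by (simp add: emeasure_density prod_ennreal)
  also have "\<dots> = (\<Prod>b\<in>(Basis::'a set). (\<integral>\<^sup>+x. ennreal (std_normal_density x) \<partial>lborel))"
    by (rule nn_integral_lborel_prod) auto
  also have "\<dots> = 1"
  proof -
    have "(\<integral>\<^sup>+x. ennreal (std_normal_density x) \<partial>lborel) = 1"
      using prob_space.emeasure_space_1[OF prob_space_normal_density[of 1 0]] by (simp add: emeasure_density)
    then show ?thesis by simp
  qed
  finally show "emeasure (std_gauss :: 'a measure) (space std_gauss) = 1" .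
qed

text \<open>Density and exponential both factor over the basis, so Fubini reduces the integral to
  the characteristic function of the one-dimensional standard normal law.\<close>

lemma char_std_gauss:
  fixes t :: "'a::euclidean_space"
  shows "(LINT x|std_gauss. cis (t \<bullet> x)) = complex_of_real (exp (- (norm t)\<^sup>2 / 2))"
proof -
  interpret product_sigma_finite "\<lambda>_::'a. lborel :: real measure"
    by standard
  let ?g = "\<lambda>b y. complex_of_real (std_normal_density y) * cis ((t \<bullet> b) * y)"
  have int1: "integrable lborel (?g b)" for b
    by (rule Bochner_Integration.integrable_bound[OF integrable_normal_density[of 1 0]])
       (auto simp: norm_mult cis_conv_exp)
  have val: "(LINT y|lborel. ?g b y) = exp (- (t \<bullet> b)\<^sup>2 / 2)" for b
  proof -
    have "char std_normal_distribution (t \<bullet> b)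
        = (LINT y|lborel. std_normal_density y *\<^sub>R exp (\<i> * complex_of_real ((t \<bullet> b) * y)))"
      unfolding char_def by (rule integral_density) simp_all
    then show ?thesis by (simp only: char_std_normal_distribution cis_conv_exp scaleR_conv_of_real)
  qed
  have "(LINT x|std_gauss. cis (t \<bullet> x))
      = (LINT x|lborel. complex_of_real (\<Prod>b\<in>Basis. std_normal_density (x \<bullet> b)) * cis (t \<bullet> x))"
    unfolding std_gauss_def std_gauss_density_prod
    by (subst integral_density) (auto simp: scaleR_conv_of_real prod_nonneg cis_conv_exp)
  also have "\<dots> = (LINT x|lborel. (\<Prod>b\<in>Basis. ?g b (x \<bullet> b)))"
  proof (rule Bochner_Integration.integral_cong[OF refl])
    fix x :: 'a
    have "cis (t \<bullet> x) = (\<Prod>b\<in>Basis. cis ((t \<bullet> b) * (x \<bullet> b)))"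
    proof -
      have "t \<bullet> x = (\<Sum>b\<in>Basis. (t \<bullet> b) * (x \<bullet> b))" by (rule euclidean_inner)
      then show ?thesis unfolding cis_conv_exp by (simp only: of_real_sum sum_distrib_left exp_sum finite_Basis)
    qed
    then show "complex_of_real (\<Prod>b\<in>Basis. std_normal_density (x \<bullet> b)) * cis (t \<bullet> x) = (\<Prod>b\<in>Basis. ?g b (x \<bullet> b))"
      by (simp add: prod.distrib)
  qed
  also have "\<dots> = (LINT x|Pi\<^sub>M Basis (\<lambda>_. lborel). (\<Prod>b\<in>Basis. ?g b (x b)))"
    by (subst lborel_eq, subst integral_distr)
       (auto simp: cis_conv_exp inner_sum_left inner_Basis if_distrib cong: if_cong intro!: Bochner_Integration.integral_cong prod.cong)
  also have "\<dots> = (\<Prod>b\<in>Basis. (LINT y|lborel. ?g b y))"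
    by (rule product_integral_prod[OF finite_Basis int1])
  also have "\<dots> = (\<Prod>b\<in>Basis. complex_of_real (exp (- (t \<bullet> b)\<^sup>2 / 2)))" by (simp only: val)
  also have "\<dots> = complex_of_real (exp (- (norm t)\<^sup>2 / 2))"
    by (simp only: gauss_exp_prod of_real_prod)
  finally show ?thesis .
qed

section \<open>Factorization of positive definite matrices\<close>

lemma inner_matrix_mult_right: "x \<bullet> (A *v y) = (transpose A *v x) \<bullet> y" for A :: "real^'n^'m"
  by (metis dot_lmul_matrix transpose_matrix_vector)

lemma matrix_inv_inverse:
  assumes "invertible A"
  shows matrix_inv_right: "A ** matrix_inv A = mat 1" and matrix_inv_left: "matrix_inv A ** A = mat 1"
proof -
  have "A ** matrix_inv A = mat 1 \<and> matrix_inv A ** A = mat 1"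
    using assms unfolding matrix_inv_def invertible_def by (rule someI_ex)
  then show "A ** matrix_inv A = mat 1" "matrix_inv A ** A = mat 1" by auto
qed

text \<open>Gram-Schmidt for the inner product \<open>x \<bullet> (S *v y)\<close>, with the vectors
  indexed by the coordinates so that they can become the columns of a matrix.\<close>

lemma posdef_orthonormal_family:
  fixes S :: "real^'n^'n"
  assumes sym: "transpose S = S" and pd: "\<And>x. x \<noteq> 0 \<Longrightarrow> x \<bullet> (S *v x) > 0"
  shows "finite I \<Longrightarrow> \<exists>a. \<forall>i\<in>I. \<forall>j\<in>I. a i \<bullet> (S *v a j) = (if i = (j::'n) then 1 else 0)"
proof (induction I rule: finite_induct)
  case (insert k I)
  then obtain a where a: "\<forall>i\<in>I. \<forall>j\<in>I. a i \<bullet> (S *v a j) = (if i = j then 1 else 0)" by blast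
  have "I \<noteq> UNIV" using insert.hyps by blast
  then have "card I < CARD('n)" by (simp add: psubset_card_mono psubsetI)
  moreover have "dim ((\<lambda>i. S *v a i) ` I) \<le> card I"
    by (meson card_image_le dim_le_card' finite_imageI insert.hyps(1) order_trans)
  ultimately have "dim ((\<lambda>i. S *v a i) ` I) < DIM(real^'n)" by simp
  \<comment> \<open>Fewer than \<open>CARD('n)\<close> vectors \<open>S *v a i\<close> leave a
    nonzero orthogonal direction, and orthogonality to \<open>S *v a i\<close> is orthogonality to
    \<open>a i\<close> for the form of \<open>S\<close>.\<close>
  then obtain x where x: "x \<noteq> 0" "\<And>y. y \<in> span ((\<lambda>i. S *v a i) ` I) \<Longrightarrow> orthogonal x y"
    using orthogonal_to_subspace_exists by metis
  have x0: "x \<bullet> (S *v a i) = 0" "a i \<bullet> (S *v x) = 0" if "i \<in> I" for i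
  proof -
    show "x \<bullet> (S *v a i) = 0" using x(2)[of "S *v a i"] that by (auto simp: orthogonal_def intro: span_base)
    then show "a i \<bullet> (S *v x) = 0" by (metis inner_matrix_mult_right sym inner_commute)
  qed
  define e where "e = (1 / sqrt (x \<bullet> (S *v x))) *\<^sub>R x"
  have e1: "e \<bullet> (S *v e) = 1"
    using pd[OF x(1)] by (simp add: e_def matrix_vector_mult_scaleR)
  have e0: "e \<bullet> (S *v a i) = 0" "a i \<bullet> (S *v e) = 0" if "i \<in> I" for i
    using x0[OF that] by (simp_all add: e_def matrix_vector_mult_scaleR)
  show ?case
    by (rule exI[of _ "a(k := e)"]) (use a e0 e1 insert.hyps in auto)
qed simp

text \<open>With a family orthonormal for \<open>S\<close> as the columns of \<open>A\<close>, the
  product \<open>transpose A ** (S ** A)\<close> is the identity. The inverse \<open>C\<close> of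
  \<open>A\<close> then gives \<open>S = transpose C ** C\<close>, so \<open>B\<close> is
  \<open>transpose C\<close>. No eigenvalues are involved.\<close>

lemma posdef_factorization:
  fixes S :: "real^'n^'n"
  assumes sym: "transpose S = S" and pd: "\<And>x. x \<noteq> 0 \<Longrightarrow> x \<bullet> (S *v x) > 0"
  obtains B where "S = B ** transpose B" "det B \<noteq> 0"
proof -
  obtain a where a: "\<And>i j. a i \<bullet> (S *v a j) = (if i = (j::'n) then 1 else 0)"
    using posdef_orthonormal_family[OF assms, of UNIV] by auto
  define A :: "real^'n^'n" where "A = (\<chi> i j. a j $ i)"
  have Aax: "A *v axis j 1 = a j" for j
    by (simp add: A_def matrix_vector_mult_def axis_def vec_eq_iff if_distrib cong: if_cong)
  have ent: "M $ i $ j = axis i 1 \<bullet> (M *v axis j 1)" for M :: "real^'n^'n" and i j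
    by (simp add: matrix_vector_mult_basis column_def inner_axis')
  have ASA: "transpose A ** (S ** A) = mat 1"
  proof (simp only: vec_eq_iff, intro allI)
    fix i j
    have "(transpose A ** (S ** A)) $ i $ j = a i \<bullet> (S *v a j)"
      by (simp only: ent inner_matrix_mult_right[of _ "transpose A"] Aax transpose_transpose flip: matrix_vector_mul_assoc)
    then show "(transpose A ** (S ** A)) $ i $ j = mat 1 $ i $ j" by (simp add: a mat_def)
  qed
  then have "det A * det S * det A = 1" by (metis det_I det_mul det_transpose mult.assoc)
  then have dA: "det A \<noteq> 0" by auto
  define C where "C = matrix_inv A"
  have C: "A ** C = mat 1" "C ** A = mat 1"
    using dA by (simp_all add: C_def invertible_det_nz matrix_inv_right matrix_inv_left)
  have tC: "transpose C ** transpose A = mat 1" using C(1) by (metis matrix_transpose_mul transpose_mat)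
  have "S = (transpose C ** transpose A) ** S ** (A ** C)" by (simp add: C tC)
  also have "\<dots> = transpose C ** (transpose A ** (S ** A)) ** C" by (simp add: matrix_mul_assoc)
  finally have "S = transpose C ** transpose (transpose C)" by (simp add: ASA)
  moreover have "det (transpose C) \<noteq> 0" using C(1) by (metis det_I det_mul det_transpose mult_zero_right zero_neq_one)
  ultimately show ?thesis using that by blast
qed

text \<open>Substituting \<open>B *v y\<close> turns the quadratic form of the inverse matrix into
  the squared norm of \<open>y\<close>, and the Jacobian \<open>\<bar>det B\<bar>\<close> cancels
  against \<open>sqrt (det S)\<close>, as \<open>det S = (det B)\<^sup>2\<close>.\<close>

lemma mvnormal_eq_distr:
  fixes B :: "real^'n^'n"
  assumes "det B \<noteq> 0"
  shows "mvnormal (B ** transpose B) = distr std_gauss borel ((*v) B)"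
proof (rule measure_eqI)
  fix X assume "X \<in> sets (mvnormal (B ** transpose B))"
  then have X[measurable]: "X \<in> sets borel" by (simp add: mvnormal_def)
  have [measurable]: "(*v) B \<in> borel_measurable borel"
    by (intro borel_measurable_continuous_onI linear_continuous_on matrix_vector_mul_bounded_linear)
  define S where "S = B ** transpose B"
  have [measurable]: "(\<lambda>x. matrix_inv S *v x) \<in> borel_measurable borel"
    by (intro borel_measurable_continuous_onI linear_continuous_on matrix_vector_mul_bounded_linear)
  define d where "d x = exp (- (x \<bullet> (matrix_inv S *v x)) / 2) / sqrt ((2 * pi) ^ CARD('n) * det S)" for x
  have [measurable]: "d \<in> borel_measurable borel" unfolding d_def by measurable
  have detS: "det S = (det B)\<^sup>2" by (simp add: S_def det_mul power2_eq_square)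
  then have "invertible S" using assms by (simp add: invertible_det_nz)
  have quad: "(B *v y) \<bullet> (matrix_inv S *v (B *v y)) = (norm y)\<^sup>2" for y
  proof -
    have "invertible (transpose B)" using assms by (simp add: invertible_det_nz)
    \<comment> \<open>With \<open>y = transpose B *v w\<close> the vector \<open>B *v y\<close> is
      \<open>S *v w\<close>, which \<open>matrix_inv S\<close> takes back to
      \<open>w\<close>.\<close>
    then obtain w where w: "y = transpose B *v w"
      by (metis matrix_inv_right matrix_vector_mul_assoc matrix_vector_mul_lid)
    have "matrix_inv S *v (B *v y) = w"
      unfolding w using matrix_inv_left[OF \<open>invertible S\<close>]
      by (metis S_def matrix_vector_mul_assoc matrix_vector_mul_lid)
    moreover have "(B *v y) \<bullet> w = y \<bullet> y"
      unfolding w by (metis inner_commute inner_matrix_mult_right)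
    ultimately show ?thesis by (simp add: power2_norm_eq_inner)
  qed
  have dB: "\<bar>det B\<bar> * d (B *v y) = exp (- (norm y)\<^sup>2 / 2) / sqrt ((2 * pi) ^ CARD('n))" for y
    using assms by (simp add: d_def quad detS real_sqrt_mult)
  have "emeasure (mvnormal S) X = (\<integral>\<^sup>+x. ennreal (d x) * indicator X x \<partial>lborel)"
    unfolding mvnormal_def d_def[symmetric] by (simp add: emeasure_density)
  also have "\<dots> = ennreal \<bar>det B\<bar> * (\<integral>\<^sup>+y. ennreal (d (B *v y)) * indicator X (B *v y) \<partial>lborel)"
    using nn_integral_lborel_linear[OF matrix_vector_mul_linear, of "\<lambda>x. ennreal (d x) * indicator X x" B] assms
    by simp
  also have "\<dots> = (\<integral>\<^sup>+y. ennreal \<bar>det B\<bar> * (ennreal (d (B *v y)) * indicator X (B *v y)) \<partial>lborel)"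
    by (rule nn_integral_cmult[symmetric]) measurable
  also have "\<dots> = (\<integral>\<^sup>+y. ennreal (exp (- (norm y)\<^sup>2 / 2) / sqrt ((2 * pi) ^ CARD('n))) * indicator ((*v) B -` X) y \<partial>lborel)"
    by (simp only: ennreal_mult'[OF abs_ge_zero] dB[symmetric] mult.assoc indicator_vimage)
  also have "\<dots> = emeasure (distr std_gauss borel ((*v) B)) X"
    using measurable_sets[OF \<open>(*v) B \<in> borel_measurable borel\<close> X]
    by (simp add: emeasure_distr std_gauss_def emeasure_density)
  finally show "emeasure (mvnormal (B ** transpose B)) X = emeasure (distr std_gauss borel ((*v) B)) X"
    by (simp add: S_def)
qed (simp add: mvnormal_def)

text \<open>For \<open>S = B ** transpose B\<close> the law is the image of the standard Gaussian
  under \<open>B\<close>. At \<open>t\<close> its characteristic function is the standard one at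
  \<open>transpose B *v t\<close>, whose squared norm is
  \<open>t \<bullet> (S *v t)\<close>.\<close>

lemma
  fixes S :: "real^'n^'n"
  assumes sym: "transpose S = S" and pd: "\<And>x. x \<noteq> 0 \<Longrightarrow> x \<bullet> (S *v x) > 0"
  shows prob_space_mvnormal: "prob_space (mvnormal S)"
    and char_mvnormal: "(LINT x|mvnormal S. cis (t \<bullet> x)) = complex_of_real (exp (- (t \<bullet> (S *v t)) / 2))"
proof -
  obtain B where B: "S = B ** transpose B" "det B \<noteq> 0" using posdef_factorization[OF assms] .
  have [measurable]: "(*v) B \<in> borel_measurable borel"
    by (intro borel_measurable_continuous_onI linear_continuous_on matrix_vector_mul_bounded_linear)
  interpret prob_space "std_gauss :: (real^'n) measure" by (rule prob_space_std_gauss)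
  show "prob_space (mvnormal S)" unfolding B(1) mvnormal_eq_distr[OF B(2)] by (rule prob_space_distr) measurable
  have "(LINT x|mvnormal S. cis (t \<bullet> x)) = (LINT y|std_gauss. cis ((transpose B *v t) \<bullet> y))"
    unfolding B(1) mvnormal_eq_distr[OF B(2)]
    by (subst integral_distr) (auto simp: cis_conv_exp inner_matrix_mult_right)
  also have "\<dots> = complex_of_real (exp (- (norm (transpose B *v t))\<^sup>2 / 2))" by (rule char_std_gauss)
  also have "(norm (transpose B *v t))\<^sup>2 = t \<bullet> (S *v t)"
    unfolding B(1) power2_norm_eq_inner by (metis inner_matrix_mult_right matrix_vector_mul_assoc)
  finally show "(LINT x|mvnormal S. cis (t \<bullet> x)) = complex_of_real (exp (- (t \<bullet> (S *v t)) / 2))" .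
qed

section \<open>Convergence in distribution from characteristic functions\<close>

text \<open>The phase \<open>c\<close> makes sines and constants special cases and lets the product
  of two generators be a sum of two generators, so that this set is an algebra.\<close>

inductive_set trig_poly :: "('a::euclidean_space \<Rightarrow> real) set" where
  cos: "(\<lambda>x. k * cos (t \<bullet> x + c)) \<in> trig_poly"
| add: "f \<in> trig_poly \<Longrightarrow> g \<in> trig_poly \<Longrightarrow> (\<lambda>x. f x + g x) \<in> trig_poly"

lemma trig_poly_const: "(\<lambda>_. c) \<in> trig_poly"
  using trig_poly.cos[of c 0 0] by simp

lemma trig_poly_mult:
  assumes "f \<in> trig_poly" "g \<in> trig_poly"
  shows "(\<lambda>x. f x * g x) \<in> trig_poly"
  using assms
proof (induction arbitrary: g)
  case (cos k t c)
  from cos show ?case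
  proof (induction g)
    case (cos l s d)
    have "k * cos (t \<bullet> x + c) * (l * cos (s \<bullet> x + d))
        = k * l / 2 * cos ((t - s) \<bullet> x + (c - d)) + k * l / 2 * cos ((t + s) \<bullet> x + (c + d))" for x
    proof -
      have "(t \<bullet> x + c) - (s \<bullet> x + d) = (t - s) \<bullet> x + (c - d)" "(t \<bullet> x + c) + (s \<bullet> x + d) = (t + s) \<bullet> x + (c + d)"
        by (simp_all add: inner_diff_left inner_add_left)
      then have "cos (t \<bullet> x + c) * cos (s \<bullet> x + d) = (cos ((t - s) \<bullet> x + (c - d)) + cos ((t + s) \<bullet> x + (c + d))) / 2"
        by (simp only: cos_times_cos)
      moreover have "k * A * (l * B) = k * l / 2 * U + k * l / 2 * V" if "A * B = (U + V) / 2" for A B U V :: real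
      proof -
        have "k * A * (l * B) = k * l * (A * B)" by simp
        then show ?thesis by (simp add: that algebra_simps)
      qed
      ultimately show ?thesis by blast
    qed
    then show ?case by (simp only:) (intro trig_poly.intros)
  next
    case (add f g)
    then show ?case using trig_poly.add[OF add.IH] by (simp add: distrib_left)
  qed
next
  case (add f h)
  then show ?case using trig_poly.add[OF add.IH(1)[OF add.prems] add.IH(2)[OF add.prems]]
    by (simp add: distrib_right)
qed

lemma trig_poly_continuous: "f \<in> trig_poly \<Longrightarrow> continuous_on S f"
  by (induction rule: trig_poly.induct) (auto intro!: continuous_intros)

lemma trig_poly_bounded: "f \<in> trig_poly \<Longrightarrow> \<exists>K. \<forall>x. \<bar>f x\<bar> \<le> K"
proof (induction rule: trig_poly.induct)
  case (cos k t c)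
  show ?case by (rule exI[of _ "\<bar>k\<bar>"]) (simp add: abs_mult mult_left_le)
next
  case (add f g)
  then obtain K L where "\<forall>x. \<bar>f x\<bar> \<le> K" "\<forall>x. \<bar>g x\<bar> \<le> L" by blast
  then show ?case by (intro exI[of _ "K + L"] allI) (meson abs_triangle_ineq add_mono order_trans)
qed

lemma trig_poly_compose_polynomial:
  "real_polynomial_function p \<Longrightarrow> g \<in> trig_poly \<Longrightarrow> (\<lambda>x. p (g x)) \<in> trig_poly"
proof (induction p rule: real_polynomial_function.induct)
  case (linear p)
  have "p y = y * p 1" for y :: real using linear(1) by (metis bounded_linear_def linear_scale mult.right_neutral real_scaleR_def)
  then have "(\<lambda>x. p (g x)) = (\<lambda>x. g x * p 1)" by blast
  then show ?case using trig_poly_mult[OF linear(2) trig_poly_const] by simp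
qed (auto intro: trig_poly_const trig_poly.add trig_poly_mult)

text \<open>Composing with a polynomial that approximates truncation at \<open>\<plusminus>M\<close> turns the approximation on \<open>K\<close>
  from the Stone-Weierstrass theorem into one with a global bound.\<close>

lemma trig_poly_approx:
  fixes f :: "'a::euclidean_space \<Rightarrow> real"
  assumes K: "compact K" and f: "continuous_on K f" and M: "\<And>x. x \<in> K \<Longrightarrow> \<bar>f x\<bar> \<le> M" "0 \<le> M" and e: "e > 0"
  obtains g where "g \<in> trig_poly" "\<And>x. x \<in> K \<Longrightarrow> \<bar>f x - g x\<bar> < e" "\<And>x. \<bar>g x\<bar> \<le> M + e"
proof -
  interpret function_ring_on trig_poly K
  proof
    fix x y :: 'a assume "x \<noteq> y"
    \<comment> \<open>With phase \<open>- (t \<bullet> y)\<close> the cosine is \<open>1\<close> at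
      \<open>y\<close>, and this \<open>t\<close> makes the argument \<open>pi / 2\<close> at
      \<open>x\<close>, where the cosine vanishes.\<close>
    define t where "t = (pi / 2 / (norm (x - y))\<^sup>2) *\<^sub>R (x - y)"
    have "t \<bullet> (x - y) = pi / 2" using \<open>x \<noteq> y\<close> by (simp add: t_def power2_norm_eq_inner)
    then have "t \<bullet> x + - (t \<bullet> y) = pi / 2" by (simp add: inner_diff_right)
    then have "cos (t \<bullet> x + - (t \<bullet> y)) = 0" by (simp only: cos_pi_half)
    then have "1 * cos (t \<bullet> x + - (t \<bullet> y)) \<noteq> 1 * cos (t \<bullet> y + - (t \<bullet> y))" by simp
    then show "\<exists>f\<in>trig_poly. f x \<noteq> f y" by (intro bexI[OF _ trig_poly.cos])
  qed (auto intro: K trig_poly_continuous trig_poly.add trig_poly_mult trig_poly_const)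
  obtain g0 where g0: "g0 \<in> trig_poly" "\<And>x. x \<in> K \<Longrightarrow> \<bar>f x - g0 x\<bar> < e / 2"
    using Stone_Weierstrass_basic[OF f, of "e / 2"] e by auto
  obtain L where L: "\<And>x. \<bar>g0 x\<bar> \<le> L" using trig_poly_bounded[OF g0(1)] by blast
  \<comment> \<open>As \<open>\<bar>f x\<bar> \<le> M\<close> on \<open>K\<close>, clamping
    \<open>g0\<close> between \<open>- M\<close> and \<open>M\<close> does not increase its distance
    from \<open>f\<close> there. The polynomial \<open>p\<close> follows the clamp only on
    \<open>{-L..L}\<close>, which contains all values of \<open>g0\<close>.\<close>
  define h where "h y = max (- M) (min M y)" for y :: real
  have "continuous_on {-L..L} h" unfolding h_def by (intro continuous_intros)
  then obtain p where p: "real_polynomial_function p" "\<And>y. y \<in> {-L..L} \<Longrightarrow> \<bar>h y - p y\<bar> < e / 2"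
    using Stone_Weierstrass_real_polynomial_function[of "{-L..L}" h "e / 2"] e by auto
  have hp: "\<bar>h (g0 x) - p (g0 x)\<bar> < e / 2" for x using p(2)[of "g0 x"] L[of x] by (simp add: abs_le_iff minus_le_iff)
  show thesis
  proof (rule that[of "\<lambda>x. p (g0 x)"])
    show "(\<lambda>x. p (g0 x)) \<in> trig_poly" by (rule trig_poly_compose_polynomial[OF p(1) g0(1)])
    show "\<bar>f x - p (g0 x)\<bar> < e" if "x \<in> K" for x
      using hp[of x] g0(2)[OF that] M(1)[OF that] by (auto simp: h_def max_def min_def abs_if split: if_splits)
    show "\<bar>p (g0 x)\<bar> \<le> M + e" for x
      using hp[of x] M(2) e by (auto simp: h_def max_def min_def abs_if split: if_splits)
  qed
qed

lemma trig_poly_integral_tendsto: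
  fixes X :: "nat \<Rightarrow> 'w \<Rightarrow> 'a::euclidean_space"
  assumes P: "prob_space P" and X[measurable]: "\<And>n. X n \<in> borel_measurable P"
    and \<mu>: "prob_space \<mu>" and [measurable_cong]: "sets \<mu> = sets borel"
    and cf: "\<And>t. (\<lambda>n. LINT \<omega>|P. cis (t \<bullet> X n \<omega>)) \<longlonglongrightarrow> (LINT x|\<mu>. cis (t \<bullet> x))"
    and g: "g \<in> trig_poly"
  shows "(\<lambda>n. LINT \<omega>|P. g (X n \<omega>)) \<longlonglongrightarrow> (LINT x|\<mu>. g x)"
  using g
proof induction
  case (cos k t c)
  \<comment> \<open>A cosine with phase is the real part of \<open>cis c\<close> times a character.
    The claim covers every probability space, so that it applies to \<open>X n\<close> under
    \<open>P\<close> and to the identity under \<open>\<mu>\<close>.\<close>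
  have *: "(LINT \<omega>|N. k * cos (t \<bullet> Y \<omega> + c)) = k * Re (cis c * (LINT \<omega>|N. cis (t \<bullet> Y \<omega>)))"
    if N: "prob_space N" and Y[measurable]: "Y \<in> borel_measurable N" for N :: "'b measure" and Y :: "'b \<Rightarrow> 'a"
  proof -
    interpret N: prob_space N by fact
    have int: "integrable N (\<lambda>\<omega>. cis (t \<bullet> Y \<omega>))"
      by (rule N.integrable_const_bound[of _ 1]) (auto simp: cis_conv_exp)
    have "(LINT \<omega>|N. k * cos (t \<bullet> Y \<omega> + c)) = (LINT \<omega>|N. k * Re (cis c * cis (t \<bullet> Y \<omega>)))"
      by (simp add: cis_mult add.commute)
    also have "\<dots> = k * Re (LINT \<omega>|N. cis c * cis (t \<bullet> Y \<omega>))"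
      using int by (simp only: integral_mult_right_zero integral_Re integrable_mult_right)
    also have "(LINT \<omega>|N. cis c * cis (t \<bullet> Y \<omega>)) = cis c * (LINT \<omega>|N. cis (t \<bullet> Y \<omega>))"
      by (rule integral_mult_right_zero)
    finally show ?thesis .
  qed
  have 1: "(\<lambda>n. LINT \<omega>|P. k * cos (t \<bullet> X n \<omega> + c)) = (\<lambda>n. k * Re (cis c * (LINT \<omega>|P. cis (t \<bullet> X n \<omega>))))"
    by (rule ext, rule *[OF P X])
  have 2: "(LINT x|\<mu>. k * cos (t \<bullet> x + c)) = k * Re (cis c * (LINT x|\<mu>. cis (t \<bullet> x)))"
    by (rule *[OF \<mu>]) measurable
  show ?case unfolding 1 2 by (intro tendsto_intros cf)
next
  case (add f g)
  have int: "integrable N (\<lambda>\<omega>. f (Y \<omega>))"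
    if N: "prob_space N" and Y[measurable]: "Y \<in> borel_measurable N" and f: "f \<in> trig_poly" for N :: "'b measure" and Y :: "'b \<Rightarrow> 'a" and f
  proof -
    interpret N: prob_space N by fact
    obtain K where "\<And>x. \<bar>f x\<bar> \<le> K" using trig_poly_bounded[OF f] by blast
    moreover have [measurable]: "f \<in> borel_measurable borel"
      by (intro borel_measurable_continuous_onI trig_poly_continuous f)
    ultimately show ?thesis by (intro N.integrable_const_bound[of _ K]) auto
  qed
  have [measurable]: "(\<lambda>x. x) \<in> borel_measurable \<mu>" by measurable
  show ?case
    using tendsto_add[OF add.IH] int[OF P X add.hyps(1)] int[OF P X add.hyps(2)]
      int[OF \<mu> _ add.hyps(1), of "\<lambda>x. x"] int[OF \<mu> _ add.hyps(2), of "\<lambda>x. x"] by simp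
qed

section \<open>Tightness and weak convergence\<close>

lemma (in prob_space) tight:
  fixes Y :: "'a \<Rightarrow> 'b::real_normed_vector"
  assumes [measurable]: "(\<lambda>\<omega>. norm (Y \<omega>)) \<in> borel_measurable M" and "e > 0"
  shows "\<exists>R. prob {\<omega>\<in>space M. norm (Y \<omega>) > R} < e"
proof -
  have "(\<lambda>n::nat. prob {\<omega>\<in>space M. norm (Y \<omega>) > real n}) \<longlonglongrightarrow> prob (\<Inter>n. {\<omega>\<in>space M. norm (Y \<omega>) > real n})"
    by (intro finite_Lim_measure_decseq) (auto simp: decseq_def)
  also have "(\<Inter>n. {\<omega>\<in>space M. norm (Y \<omega>) > real n}) = {}"
  proof -
    have "\<exists>n. \<not> norm (Y \<omega>) > real n" for \<omega> using real_arch_simple[of "norm (Y \<omega>)"] by (auto simp: not_less)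
    then show ?thesis by blast
  qed
  finally have "(\<lambda>n::nat. prob {\<omega>\<in>space M. norm (Y \<omega>) > real n}) \<longlonglongrightarrow> 0" by simp
  then have "eventually (\<lambda>n::nat. prob {\<omega>\<in>space M. norm (Y \<omega>) > real n} < e) sequentially"
    using \<open>e > 0\<close> by (rule order_tendstoD)
  then show ?thesis by (auto simp: eventually_sequentially)
qed

text \<open>Inside the ball of radius \<open>R\<close> the integrands differ by at most
  \<open>e\<close>, outside it by at most \<open>C + D\<close>.\<close>

lemma (in prob_space) expectation_diff_bound:
  fixes Y :: "'a \<Rightarrow> 'b::euclidean_space" and f g :: "'b \<Rightarrow> real"
  assumes [measurable]: "Y \<in> borel_measurable M" "f \<in> borel_measurable borel" "g \<in> borel_measurable borel"
    and bf: "\<And>x. \<bar>f x\<bar> \<le> C" and bg: "\<And>x. \<bar>g x\<bar> \<le> D"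
    and close: "\<And>x. norm x \<le> R \<Longrightarrow> \<bar>f x - g x\<bar> \<le> e" and e: "e \<ge> 0"
  shows "\<bar>expectation (\<lambda>\<omega>. f (Y \<omega>)) - expectation (\<lambda>\<omega>. g (Y \<omega>))\<bar>
    \<le> e + (C + D) * prob {\<omega>\<in>space M. norm (Y \<omega>) > R}"
proof -
  let ?A = "{\<omega>\<in>space M. norm (Y \<omega>) > R}"
  have intf: "integrable M (\<lambda>\<omega>. f (Y \<omega>))" using bf by (intro integrable_const_bound[of _ C]) auto
  have intg: "integrable M (\<lambda>\<omega>. g (Y \<omega>))" using bg by (intro integrable_const_bound[of _ D]) auto
  have CD: "0 \<le> C + D" using bf[of 0] bg[of 0] by linarith
  have "integrable M (indicator ?A :: 'a \<Rightarrow> real)"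
    by (rule integrable_const_bound[of _ 1]) (auto simp: indicator_def)
  then have ind: "integrable M (\<lambda>\<omega>. (C + D) * indicator ?A \<omega>)" by (rule integrable_mult_right)
  have inti: "integrable M (\<lambda>\<omega>. e + (C + D) * indicator ?A \<omega>)"
    by (rule Bochner_Integration.integrable_add[OF integrable_const ind])
  have "\<bar>expectation (\<lambda>\<omega>. f (Y \<omega>)) - expectation (\<lambda>\<omega>. g (Y \<omega>))\<bar>
      = norm (expectation (\<lambda>\<omega>. f (Y \<omega>) - g (Y \<omega>)))" using intf intg by simp
  also have "\<dots> \<le> expectation (\<lambda>\<omega>. e + (C + D) * indicator ?A \<omega>)"
  proof (rule order_trans[OF integral_norm_bound integral_mono])
    fix \<omega> assume "\<omega> \<in> space M"
    then show "norm (f (Y \<omega>) - g (Y \<omega>)) \<le> e + (C + D) * indicator ?A \<omega>"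
      using close[of "Y \<omega>"] bf[of "Y \<omega>"] bg[of "Y \<omega>"] e CD by (auto simp: indicator_def not_less)
  qed (use intf intg inti in auto)
  also have "\<dots> = e + (C + D) * prob ?A"
    unfolding Bochner_Integration.integral_add[OF integrable_const ind]
    by (simp add: prob_space Int_def conj_commute)
  finally show ?thesis .
qed

lemma conv_distr_char:
  fixes X :: "nat \<Rightarrow> 'w \<Rightarrow> real^'r"
  assumes P: "prob_space P" and X[measurable]: "\<And>n. X n \<in> borel_measurable P"
    and \<mu>: "prob_space \<mu>" and sets[measurable_cong]: "sets \<mu> = sets borel"
    and cf: "\<And>t. (\<lambda>n. LINT \<omega>|P. cis (t \<bullet> X n \<omega>)) \<longlonglongrightarrow> (LINT x|\<mu>. cis (t \<bullet> x))"
    and tight: "\<And>e. e > 0 \<Longrightarrow> \<exists>R. \<forall>\<^sub>F n in sequentially. measure P {\<omega>\<in>space P. norm (X n \<omega>) > R} < e"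
  shows "conv_distr P X \<mu>"
  unfolding conv_distr_def
proof (intro allI impI)
  fix f :: "real^'r \<Rightarrow> real" assume "continuous_on UNIV f \<and> bounded (range f)"
  then have cont: "continuous_on UNIV f" and "bounded (range f)" by auto
  then obtain C where C: "C > 0" "\<And>x. \<bar>f x\<bar> \<le> C" by (auto simp: bounded_pos)
  interpret P: prob_space P by fact
  interpret \<mu>: prob_space \<mu> by fact
  have [measurable]: "f \<in> borel_measurable borel" using cont by (rule borel_measurable_continuous_onI)
  show "(\<lambda>n. LINT \<omega>|P. f (X n \<omega>)) \<longlonglongrightarrow> (LINT x|\<mu>. f x)"
  proof (rule LIMSEQ_I, goal_cases)
    case (1 r)
    \<comment> \<open>The total error is \<open>5 * e\<close>: at most \<open>2 * e\<close> for
      replacing \<open>f\<close> by \<open>g\<close> under \<open>P\<close>, the same under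
      \<open>\<mu>\<close>, and \<open>e\<close> for the convergence of the integrals of
      \<open>g\<close>. As \<open>f\<close> is bounded by \<open>C\<close> and \<open>g\<close> by
      \<open>C + e\<close>, a tail of mass at most \<open>d\<close> costs at most
      \<open>e\<close>.\<close>
    define e where "e = r / 5"
    define d where "d = e / (C + (C + e))"
    have e: "e > 0" and d: "d > 0" using 1 C(1) by (simp_all add: e_def d_def)
    obtain R1 where R1: "\<forall>\<^sub>F n in sequentially. measure P {\<omega>\<in>space P. norm (X n \<omega>) > R1} < d" using tight[OF d] by blast
    obtain R2 where R2: "measure \<mu> {x\<in>space \<mu>. norm x > R2} < d" using \<mu>.tight[of "\<lambda>x. x" d] d by auto
    define R where "R = max R1 R2"
    obtain g where g: "g \<in> trig_poly" "\<And>x. x \<in> cball 0 R \<Longrightarrow> \<bar>f x - g x\<bar> < e" "\<And>x. \<bar>g x\<bar> \<le> C + e"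
      using trig_poly_approx[of "cball 0 R" f C e] C e continuous_on_subset[OF cont] by auto
    have [measurable]: "g \<in> borel_measurable borel"
      by (intro borel_measurable_continuous_onI trig_poly_continuous g(1))
    have close: "\<bar>f x - g x\<bar> \<le> e" if "norm x \<le> R" for x using g(2)[of x] that by simp
    have small: "e + (C + (C + e)) * measure N {\<omega>\<in>space N. norm (Y \<omega>) > R} \<le> 2 * e"
      if N: "prob_space N" and R': "measure N {\<omega>\<in>space N. norm (Y \<omega>) > R'} < d" "R' \<le> R" and Y[measurable]: "Y \<in> borel_measurable N"
      for N :: "'x measure" and Y :: "'x \<Rightarrow> real^'r" and R'
    proof -
      interpret N: prob_space N by fact
      have "measure N {\<omega>\<in>space N. norm (Y \<omega>) > R} \<le> measure N {\<omega>\<in>space N. norm (Y \<omega>) > R'}"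
        using R'(2) by (intro N.finite_measure_mono) auto
      then have "measure N {\<omega>\<in>space N. norm (Y \<omega>) > R} \<le> d" using R'(1) by linarith
      then have "(C + (C + e)) * measure N {\<omega>\<in>space N. norm (Y \<omega>) > R} \<le> (C + (C + e)) * d"
        using C e by (intro mult_left_mono) auto
      also have "\<dots> = e" using C e by (simp add: d_def)
      finally show ?thesis by simp
    qed
    have b\<mu>: "\<bar>(LINT x|\<mu>. f x) - (LINT x|\<mu>. g x)\<bar> \<le> 2 * e"
      using \<mu>.expectation_diff_bound[of "\<lambda>x. x" f g C "C + e" R e] C g(3) close e
        small[OF \<mu> R2] by (simp add: R_def)
    have "\<forall>\<^sub>F n in sequentially. dist (LINT \<omega>|P. g (X n \<omega>)) (LINT x|\<mu>. g x) < e"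
      using trig_poly_integral_tendsto[OF P X \<mu> sets cf g(1)] e by (rule tendstoD)
    with R1 have "\<forall>\<^sub>F n in sequentially. norm ((LINT \<omega>|P. f (X n \<omega>)) - (LINT x|\<mu>. f x)) < r"
    proof eventually_elim
      case (elim n)
      have "\<bar>(LINT \<omega>|P. f (X n \<omega>)) - (LINT \<omega>|P. g (X n \<omega>))\<bar> \<le> 2 * e"
        using P.expectation_diff_bound[of "X n" f g C "C + e" R e] C g(3) close e
          small[OF P elim(1)] by (simp add: R_def)
      then show ?case using b\<mu> elim(2) unfolding dist_real_def real_norm_def e_def by linarith
    qed
    then show ?case by (simp add: eventually_sequentially)
  qed
qed

section \<open>Stochastic order calculus\<close>

text \<open>\<open>wptto\<close> is this for every \<open>\<delta> > 0\<close>. The level is a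
  parameter because for boundedness in probability the constant is chosen after it. Events need not
  be measurable, hence the measurable set inside.\<close>

definition with_prob :: "'w measure \<Rightarrow> real \<Rightarrow> (nat \<Rightarrow> 'w \<Rightarrow> bool) \<Rightarrow> bool" where
  "with_prob P \<delta> E \<longleftrightarrow> (\<forall>\<^sub>F n in sequentially. \<exists>A\<in>sets P. A \<subseteq> {\<omega>\<in>space P. E n \<omega>} \<and> measure P A > 1 - \<delta>)"

definition bdd_in_prob :: "'w measure \<Rightarrow> (nat \<Rightarrow> 'w \<Rightarrow> real) \<Rightarrow> bool" where
  "bdd_in_prob P X \<longleftrightarrow> (\<forall>\<delta>>0. \<exists>K. with_prob P \<delta> (\<lambda>n \<omega>. \<bar>X n \<omega>\<bar> \<le> K))"

abbreviation (input) null_in_prob :: "'w measure \<Rightarrow> (nat \<Rightarrow> 'w \<Rightarrow> 'a::real_normed_vector) \<Rightarrow> bool" where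
  "null_in_prob P X \<equiv> op_small P X (\<lambda>_. 1)"

lemma wptto_iff: "wptto P E \<longleftrightarrow> (\<forall>\<delta>>0. with_prob P \<delta> E)"
  by (simp add: wptto_def with_prob_def)

lemma with_prob_mono:
  assumes "with_prob P \<delta> E" "\<forall>\<^sub>F n in sequentially. \<forall>\<omega>\<in>space P. E n \<omega> \<longrightarrow> F n \<omega>"
  shows "with_prob P \<delta> F"
  using assms(1) unfolding with_prob_def
  by (rule eventually_elim2[OF _ assms(2)]) (blast intro: order_trans)

text \<open>Since \<open>measure M (A \<inter> B) \<ge> measure M A + measure M B - 1\<close>, the
  allowed failure probabilities add up.\<close>

lemma (in prob_space) with_prob_conj:
  assumes "with_prob M a E" "with_prob M b F"
  shows "with_prob M (a + b) (\<lambda>n \<omega>. E n \<omega> \<and> F n \<omega>)"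
  using assms unfolding with_prob_def
proof eventually_elim
  case (elim n)
  then obtain A B where A: "A \<in> sets M" "A \<subseteq> {\<omega>\<in>space M. E n \<omega>}" "measure M A > 1 - a"
    and B: "B \<in> sets M" "B \<subseteq> {\<omega>\<in>space M. F n \<omega>}" "measure M B > 1 - b" by blast
  have "measure M (A \<union> B) \<le> 1" by simp
  then have "measure M A + measure M B - measure M (A \<inter> B) \<le> 1"
    using measure_Un3[of A M B] A(1) B(1) by (simp add: fmeasurable_eq_sets)
  then show ?case using A B by (intro bexI[of _ "A \<inter> B"]) auto
qed

lemma (in prob_space) with_probI:
  assumes "\<forall>\<^sub>F n in sequentially. {\<omega>\<in>space M. \<not> E n \<omega>} \<in> sets M \<and> prob {\<omega>\<in>space M. \<not> E n \<omega>} < \<delta>"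
  shows "with_prob M \<delta> E"
  using assms unfolding with_prob_def
proof eventually_elim
  case (elim n)
  then have "space M - {\<omega>\<in>space M. \<not> E n \<omega>} \<in> sets M" "prob (space M - {\<omega>\<in>space M. \<not> E n \<omega>}) > 1 - \<delta>"
    by (auto simp: prob_compl)
  then show ?case by (intro bexI[of _ "space M - {\<omega>\<in>space M. \<not> E n \<omega>}"]) auto
qed

text \<open>Complements exchange a measurable set that covers the bad event with one contained in
  the good event. This brings \<open>op_small\<close> into the calculus of
  \<open>with_prob\<close>.\<close>

lemma (in prob_space) op_small_iff:
  "op_small M X a \<longleftrightarrow> (\<forall>e>0. \<forall>\<delta>>0. with_prob M \<delta> (\<lambda>n \<omega>. norm (X n \<omega>) \<le> e * a n))"
proof -
  have "(\<exists>A\<in>sets M. {\<omega>\<in>space M. norm (X n \<omega>) > e * a n} \<subseteq> A \<and> prob A < \<delta>)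
      \<longleftrightarrow> (\<exists>A\<in>sets M. A \<subseteq> {\<omega>\<in>space M. norm (X n \<omega>) \<le> e * a n} \<and> prob A > 1 - \<delta>)" for n e \<delta>
  proof safe
    fix A assume "A \<in> sets M" "{\<omega>\<in>space M. norm (X n \<omega>) > e * a n} \<subseteq> A" "prob A < \<delta>"
    then show "\<exists>A\<in>sets M. A \<subseteq> {\<omega>\<in>space M. norm (X n \<omega>) \<le> e * a n} \<and> prob A > 1 - \<delta>"
      by (intro bexI[of _ "space M - A"]) (auto simp: prob_compl not_le[symmetric])
  next
    fix A assume "A \<in> sets M" "A \<subseteq> {\<omega>\<in>space M. norm (X n \<omega>) \<le> e * a n}" "prob A > 1 - \<delta>"
    then show "\<exists>A\<in>sets M. {\<omega>\<in>space M. norm (X n \<omega>) > e * a n} \<subseteq> A \<and> prob A < \<delta>"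
      by (intro bexI[of _ "space M - A"]) (auto simp: prob_compl not_le[symmetric])
  qed
  then show ?thesis unfolding op_small_def with_prob_def by simp
qed

lemma (in prob_space) null_in_probD: "null_in_prob M X \<Longrightarrow> e > 0 \<Longrightarrow> wptto M (\<lambda>n \<omega>. norm (X n \<omega>) \<le> e)"
  by (simp add: op_small_iff wptto_iff)

lemma (in prob_space) wptto_conj:
  assumes "wptto M E" "wptto M F"
  shows "wptto M (\<lambda>n \<omega>. E n \<omega> \<and> F n \<omega>)"
  unfolding wptto_iff
proof (intro allI impI)
  fix \<delta> :: real assume "\<delta> > 0"
  then show "with_prob M \<delta> (\<lambda>n \<omega>. E n \<omega> \<and> F n \<omega>)"
    using with_prob_conj[of "\<delta> / 2" E "\<delta> / 2" F] assms by (simp add: wptto_iff)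
qed

lemma wptto_mono:
  assumes "wptto P E" "\<forall>\<^sub>F n in sequentially. \<forall>\<omega>\<in>space P. E n \<omega> \<longrightarrow> F n \<omega>"
  shows "wptto P F"
  using assms with_prob_mono unfolding wptto_iff by blast

text \<open>Brings every rate to o_p(1). Positivity is asked from \<open>n = 1\<close> on, because
  both \<open>sqrt (real n)\<close> and \<open>1 / sqrt (real n)\<close> are \<open>0\<close> at
  \<open>n = 0\<close>.\<close>

lemma (in prob_space) op_small_scale:
  assumes "\<And>n. n \<ge> 1 \<Longrightarrow> a n > 0"
  shows "op_small M X a \<longleftrightarrow> null_in_prob M (\<lambda>n \<omega>. norm (X n \<omega>) / a n)"
proof -
  have eq: "(norm (norm (X n \<omega>) / a n) \<le> e * 1) = (norm (X n \<omega>) \<le> e * a n)" if "n \<ge> 1" for n \<omega> e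
    using assms[OF that] by (simp add: divide_le_eq)
  show ?thesis unfolding op_small_iff
    by (intro all_cong1 imp_cong refl iffI; erule with_prob_mono; intro eventually_sequentiallyI[of 1] ballI impI; simp only: eq)
qed

text \<open>For bounds that hold only on an event of probability tending to one, as does the bound
  on the error of the estimator: off such an event a multiplier may not exist.\<close>

lemma (in prob_space) null_in_prob_dominated:
  assumes E: "wptto M E" and Y: "null_in_prob M Y"
    and le: "\<forall>\<^sub>F n in sequentially. \<forall>\<omega>\<in>space M. E n \<omega> \<longrightarrow> norm (X n \<omega>) \<le> norm (Y n \<omega>)"
  shows "null_in_prob M X"
  unfolding op_small_iff
proof (intro allI impI)
  fix e \<delta> :: real assume "e > 0" "\<delta> > 0"
  then have "with_prob M (\<delta> / 2 + \<delta> / 2) (\<lambda>n \<omega>. E n \<omega> \<and> norm (Y n \<omega>) \<le> e * 1)"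
    using E Y by (intro with_prob_conj) (simp_all add: op_small_iff wptto_iff)
  then have "with_prob M (\<delta> / 2 + \<delta> / 2) (\<lambda>n \<omega>. norm (X n \<omega>) \<le> e * 1)"
  proof (rule with_prob_mono)
    show "\<forall>\<^sub>F n in sequentially. \<forall>\<omega>\<in>space M. E n \<omega> \<and> norm (Y n \<omega>) \<le> e * 1 \<longrightarrow> norm (X n \<omega>) \<le> e * 1"
      using le by (rule eventually_mono) force
  qed
  then show "with_prob M \<delta> (\<lambda>n \<omega>. norm (X n \<omega>) \<le> e * 1)" by simp
qed

lemma (in prob_space) null_in_prob_le:
  assumes Y: "null_in_prob M Y"
    and le: "\<And>n \<omega>. n \<ge> 1 \<Longrightarrow> \<omega> \<in> space M \<Longrightarrow> norm (X n \<omega>) \<le> norm (Y n \<omega>)"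
  shows "null_in_prob M X"
  unfolding op_small_iff
proof (intro allI impI)
  fix e \<delta> :: real assume "e > 0" "\<delta> > 0"
  then have "with_prob M \<delta> (\<lambda>n \<omega>. norm (Y n \<omega>) \<le> e * 1)" using Y by (simp add: op_small_iff)
  then show "with_prob M \<delta> (\<lambda>n \<omega>. norm (X n \<omega>) \<le> e * 1)"
    by (rule with_prob_mono) (auto intro!: eventually_sequentiallyI[of 1] intro: order_trans le)
qed

lemma (in prob_space) null_in_prob_add:
  assumes "null_in_prob M X" "null_in_prob M Y"
  shows "null_in_prob M (\<lambda>n \<omega>. X n \<omega> + Y n \<omega>)"
  unfolding op_small_iff
proof (intro allI impI)
  fix e \<delta> :: real assume "e > 0" "\<delta> > 0"
  then have "with_prob M (\<delta> / 2) (\<lambda>n \<omega>. norm (X n \<omega>) \<le> e / 2 * 1)" "with_prob M (\<delta> / 2) (\<lambda>n \<omega>. norm (Y n \<omega>) \<le> e / 2 * 1)"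
    using assms[unfolded op_small_iff, rule_format, of "e / 2" "\<delta> / 2"] by simp_all
  then have "with_prob M (\<delta> / 2 + \<delta> / 2) (\<lambda>n \<omega>. norm (X n \<omega>) \<le> e / 2 * 1 \<and> norm (Y n \<omega>) \<le> e / 2 * 1)"
    by (rule with_prob_conj)
  then have "with_prob M (\<delta> / 2 + \<delta> / 2) (\<lambda>n \<omega>. norm (X n \<omega> + Y n \<omega>) \<le> e * 1)"
    by (rule with_prob_mono) (auto intro!: always_eventually norm_triangle_le)
  then show "with_prob M \<delta> (\<lambda>n \<omega>. norm (X n \<omega> + Y n \<omega>) \<le> e * 1)" by simp
qed

lemma (in prob_space) null_in_prob_mult:
  assumes X: "null_in_prob M X" and Y: "bdd_in_prob M Y"
  shows "null_in_prob M (\<lambda>n \<omega>. X n \<omega> * Y n \<omega> :: real)"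
  unfolding op_small_iff
proof (intro allI impI)
  fix e \<delta> :: real assume "e > 0" "\<delta> > 0"
  obtain K where K: "with_prob M (\<delta> / 2) (\<lambda>n \<omega>. \<bar>Y n \<omega>\<bar> \<le> K)"
    using Y \<open>\<delta> > 0\<close> unfolding bdd_in_prob_def by (meson half_gt_zero)
  \<comment> \<open>\<open>1 + \<bar>K\<bar>\<close> in place of \<open>K\<close> keeps the
    denominator positive.\<close>
  have "with_prob M (\<delta> / 2) (\<lambda>n \<omega>. norm (X n \<omega>) \<le> e / (1 + \<bar>K\<bar>) * 1)"
    using X \<open>e > 0\<close> \<open>\<delta> > 0\<close> by (simp add: op_small_iff add_pos_nonneg)
  from with_prob_conj[OF this K]
  have "with_prob M (\<delta> / 2 + \<delta> / 2) (\<lambda>n \<omega>. norm (X n \<omega> * Y n \<omega>) \<le> e * 1)"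
  proof (rule with_prob_mono, intro always_eventually allI ballI impI)
    fix n \<omega> assume *: "norm (X n \<omega>) \<le> e / (1 + \<bar>K\<bar>) * 1 \<and> \<bar>Y n \<omega>\<bar> \<le> K"
    then have "norm (X n \<omega> * Y n \<omega>) \<le> e / (1 + \<bar>K\<bar>) * (1 + \<bar>K\<bar>)"
      unfolding norm_mult using \<open>e > 0\<close> by (intro mult_mono) auto
    also have "\<dots> = e" by (simp add: add_nonneg_eq_0_iff)
    finally show "norm (X n \<omega> * Y n \<omega>) \<le> e * 1" by simp
  qed
  then show "with_prob M \<delta> (\<lambda>n \<omega>. norm (X n \<omega> * Y n \<omega>) \<le> e * 1)" by simp
qed

lemma (in prob_space) bdd_in_prob_const: "bdd_in_prob M (\<lambda>_ _. c)"
  unfolding bdd_in_prob_def with_prob_def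
  by (intro allI impI exI[of _ "\<bar>c\<bar>"] always_eventually bexI[of _ "space M"]) (auto simp: prob_space)

lemma (in prob_space) null_imp_bdd_in_prob:
  assumes "null_in_prob M X" shows "bdd_in_prob M X"
  unfolding bdd_in_prob_def
proof (intro allI impI exI)
  fix \<delta> :: real assume "\<delta> > 0"
  then show "with_prob M \<delta> (\<lambda>n \<omega>. \<bar>X n \<omega>\<bar> \<le> 1)"
    using assms[unfolded op_small_iff, rule_format, of 1 \<delta>] by simp
qed

text \<open>Common source of the rules for sums and products: an operation bounded on every
  rectangle preserves boundedness in probability.\<close>

lemma (in prob_space) bdd_in_prob_combine:
  assumes "bdd_in_prob M X" "bdd_in_prob M Y"
    and f: "\<And>K L. \<exists>B. \<forall>x y. \<bar>x\<bar> \<le> K \<longrightarrow> \<bar>y\<bar> \<le> L \<longrightarrow> \<bar>f x y\<bar> \<le> B"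
  shows "bdd_in_prob M (\<lambda>n \<omega>. f (X n \<omega>) (Y n \<omega>))"
  unfolding bdd_in_prob_def
proof (intro allI impI)
  fix \<delta> :: real assume "\<delta> > 0"
  then obtain K L where "with_prob M (\<delta> / 2) (\<lambda>n \<omega>. \<bar>X n \<omega>\<bar> \<le> K)" "with_prob M (\<delta> / 2) (\<lambda>n \<omega>. \<bar>Y n \<omega>\<bar> \<le> L)"
    using assms unfolding bdd_in_prob_def by (meson half_gt_zero)
  then have *: "with_prob M (\<delta> / 2 + \<delta> / 2) (\<lambda>n \<omega>. \<bar>X n \<omega>\<bar> \<le> K \<and> \<bar>Y n \<omega>\<bar> \<le> L)" by (rule with_prob_conj)
  obtain B where "\<forall>x y. \<bar>x\<bar> \<le> K \<longrightarrow> \<bar>y\<bar> \<le> L \<longrightarrow> \<bar>f x y\<bar> \<le> B" using f by blast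
  then have "with_prob M (\<delta> / 2 + \<delta> / 2) (\<lambda>n \<omega>. \<bar>f (X n \<omega>) (Y n \<omega>)\<bar> \<le> B)"
    by (intro with_prob_mono[OF *]) auto
  then show "\<exists>B. with_prob M \<delta> (\<lambda>n \<omega>. \<bar>f (X n \<omega>) (Y n \<omega>)\<bar> \<le> B)" by auto
qed

lemma (in prob_space) bdd_in_prob_add:
  "bdd_in_prob M X \<Longrightarrow> bdd_in_prob M Y \<Longrightarrow> bdd_in_prob M (\<lambda>n \<omega>. X n \<omega> + Y n \<omega>)"
proof (erule (1) bdd_in_prob_combine)
  fix K L :: real
  show "\<exists>B. \<forall>x y. \<bar>x\<bar> \<le> K \<longrightarrow> \<bar>y\<bar> \<le> L \<longrightarrow> \<bar>x + y\<bar> \<le> B"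
    by (rule exI[of _ "K + L"]) (auto simp: abs_le_iff)
qed

lemma (in prob_space) bdd_in_prob_mult:
  "bdd_in_prob M X \<Longrightarrow> bdd_in_prob M Y \<Longrightarrow> bdd_in_prob M (\<lambda>n \<omega>. X n \<omega> * Y n \<omega>)"
proof (erule (1) bdd_in_prob_combine)
  fix K L :: real
  show "\<exists>B. \<forall>x y. \<bar>x\<bar> \<le> K \<longrightarrow> \<bar>y\<bar> \<le> L \<longrightarrow> \<bar>x * y\<bar> \<le> B"
    unfolding abs_mult by (rule exI[of _ "K * L"], intro allI impI mult_mono) auto
qed

lemma (in prob_space) bdd_in_prob_le:
  assumes "bdd_in_prob M Y"
    and le: "\<And>n \<omega>. n \<ge> 1 \<Longrightarrow> \<omega> \<in> space M \<Longrightarrow> \<bar>X n \<omega>\<bar> \<le> \<bar>Y n \<omega>\<bar>"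
  shows "bdd_in_prob M X"
  unfolding bdd_in_prob_def
proof (intro allI impI)
  fix \<delta> :: real assume "\<delta> > 0"
  then obtain K where "with_prob M \<delta> (\<lambda>n \<omega>. \<bar>Y n \<omega>\<bar> \<le> K)" using assms unfolding bdd_in_prob_def by blast
  then have "with_prob M \<delta> (\<lambda>n \<omega>. \<bar>X n \<omega>\<bar> \<le> K)"
    by (rule with_prob_mono) (auto intro!: eventually_sequentiallyI[of 1] intro: order_trans le)
  then show "\<exists>K. with_prob M \<delta> (\<lambda>n \<omega>. \<bar>X n \<omega>\<bar> \<le> K)" ..
qed

section \<open>From moment bounds to stochastic orders\<close>

lemma (in prob_space) prob_gt_le_nn_integral:
  assumes [measurable]: "X \<in> borel_measurable M" and "c > 0" "B \<ge> 0"
    and le: "(\<integral>\<^sup>+\<omega>. ennreal \<bar>X \<omega>\<bar> \<partial>M) \<le> ennreal B"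
  shows "prob {\<omega>\<in>space M. \<bar>X \<omega>\<bar> > c} \<le> B / c"
proof -
  have int: "integrable M (\<lambda>\<omega>. \<bar>X \<omega>\<bar>)"
    using le by (intro integrableI_nonneg) (auto intro: le_less_trans)
  have "prob {\<omega>\<in>space M. \<bar>X \<omega>\<bar> > c} \<le> prob {\<omega>\<in>space M. \<bar>X \<omega>\<bar> \<ge> c}"
    by (intro finite_measure_mono) auto
  also have "\<dots> \<le> expectation (\<lambda>\<omega>. \<bar>X \<omega>\<bar>) / c"
    by (rule integral_Markov_inequality_measure[where A="{}"]) (use int \<open>c > 0\<close> in auto)
  also have "expectation (\<lambda>\<omega>. \<bar>X \<omega>\<bar>) \<le> B"
    using le \<open>B \<ge> 0\<close> int by (simp add: nn_integral_eq_integral)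
  finally show ?thesis using \<open>c > 0\<close> by (simp add: divide_right_mono)
qed

lemma (in prob_space) bdd_in_prob_L1:
  assumes [measurable]: "\<And>n. X n \<in> borel_measurable M" and B: "B \<ge> 0"
    and le: "\<forall>\<^sub>F n in sequentially. (\<integral>\<^sup>+\<omega>. ennreal \<bar>X n \<omega>\<bar> \<partial>M) \<le> ennreal B"
  shows "bdd_in_prob M X"
  unfolding bdd_in_prob_def
proof (intro allI impI exI)
  fix \<delta> :: real assume d: "\<delta> > 0"
  \<comment> \<open>Markov's inequality bounds the failure probability by
    \<open>\<delta> * B / (B + 1)\<close>, strictly below \<open>\<delta>\<close>; the added
    \<open>1\<close> keeps the threshold positive for \<open>B = 0\<close>.\<close>
  show "with_prob M \<delta> (\<lambda>n \<omega>. \<bar>X n \<omega>\<bar> \<le> (B + 1) / \<delta>)"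
  proof (rule with_probI, rule eventually_mono[OF le])
    fix n assume "(\<integral>\<^sup>+\<omega>. ennreal \<bar>X n \<omega>\<bar> \<partial>M) \<le> ennreal B"
    then have "prob {\<omega>\<in>space M. \<bar>X n \<omega>\<bar> > (B + 1) / \<delta>} \<le> B / ((B + 1) / \<delta>)"
      using B d by (intro prob_gt_le_nn_integral) auto
    also have "\<dots> < \<delta>" using B d by (simp add: field_simps)
    finally show "{\<omega>\<in>space M. \<not> \<bar>X n \<omega>\<bar> \<le> (B + 1) / \<delta>} \<in> sets M \<and> prob {\<omega>\<in>space M. \<not> \<bar>X n \<omega>\<bar> \<le> (B + 1) / \<delta>} < \<delta>"
      by (simp add: not_le)
  qed
qed

lemma (in prob_space) null_in_prob_L1:
  assumes [measurable]: "\<And>n. (X n :: 'a \<Rightarrow> real) \<in> borel_measurable M"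
    and lim: "(\<lambda>n. \<integral>\<^sup>+\<omega>. ennreal \<bar>X n \<omega>\<bar> \<partial>M) \<longlonglongrightarrow> 0"
  shows "null_in_prob M X"
  unfolding op_small_iff
proof (intro allI impI)
  fix e \<delta> :: real assume d: "e > 0" "\<delta> > 0"
  have "\<forall>\<^sub>F n in sequentially. (\<integral>\<^sup>+\<omega>. ennreal \<bar>X n \<omega>\<bar> \<partial>M) < ennreal (e * \<delta> / 2)"
    using lim d by (intro order_tendstoD) auto
  then show "with_prob M \<delta> (\<lambda>n \<omega>. norm (X n \<omega>) \<le> e * 1)"
  proof (intro with_probI, elim eventually_mono)
    fix n assume "(\<integral>\<^sup>+\<omega>. ennreal \<bar>X n \<omega>\<bar> \<partial>M) < ennreal (e * \<delta> / 2)"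
    then have "prob {\<omega>\<in>space M. \<bar>X n \<omega>\<bar> > e} \<le> (e * \<delta> / 2) / e"
      using d by (intro prob_gt_le_nn_integral) auto
    also have "\<dots> < \<delta>" using d by (simp add: field_simps)
    finally show "{\<omega>\<in>space M. \<not> norm (X n \<omega>) \<le> e * 1} \<in> sets M \<and> prob {\<omega>\<in>space M. \<not> norm (X n \<omega>) \<le> e * 1} < \<delta>"
      by (simp add: not_le)
  qed
qed

text \<open>For \<open>c \<noteq> 0\<close> the event \<open>norm c \<le> norm c / 2\<close> is
  empty and cannot contain a set of measure above \<open>1 / 2\<close>. This turns two limits in
  probability of one sequence into an equality.\<close>

lemma (in prob_space) null_in_prob_const:
  assumes "null_in_prob M (\<lambda>_ _. c)" shows "c = 0"
proof (rule ccontr)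
  assume "c \<noteq> 0"
  then have "with_prob M (1/2) (\<lambda>_ _. norm c \<le> norm c / 2)"
    using null_in_probD[OF assms, of "norm c / 2"] by (simp add: wptto_iff)
  with \<open>c \<noteq> 0\<close> show False by (auto simp: with_prob_def eventually_sequentially)
qed

text \<open>Slutsky's lemma for characteristic functions: the integrands differ by at most
  \<open>2\<close>, and by at most
  \<open>norm t * norm (X n \<omega> - Y n \<omega>)\<close>.\<close>

lemma (in prob_space) char_diff_tendsto:
  fixes X Y :: "nat \<Rightarrow> 'a \<Rightarrow> 'b::euclidean_space"
  assumes [measurable]: "\<And>n. X n \<in> borel_measurable M" "\<And>n. Y n \<in> borel_measurable M"
    and null: "null_in_prob M (\<lambda>n \<omega>. X n \<omega> - Y n \<omega>)"
    and lim: "(\<lambda>n. LINT \<omega>|M. cis (t \<bullet> Y n \<omega>)) \<longlonglongrightarrow> L"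
  shows "(\<lambda>n. LINT \<omega>|M. cis (t \<bullet> X n \<omega>)) \<longlonglongrightarrow> L"
proof -
  have cis_meas [measurable]: "(\<lambda>\<omega>. cis (t \<bullet> W \<omega>)) \<in> borel_measurable M" if [measurable]: "W \<in> borel_measurable M" for W
    by (simp add: cis_conv_exp)
  have int: "integrable M (\<lambda>\<omega>. cis (t \<bullet> W \<omega>))" if [measurable]: "W \<in> borel_measurable M" for W
    by (rule integrable_const_bound[of _ 1]) auto
  have "(\<lambda>n. (LINT \<omega>|M. cis (t \<bullet> X n \<omega>)) - (LINT \<omega>|M. cis (t \<bullet> Y n \<omega>))) \<longlonglongrightarrow> 0"
  proof (rule LIMSEQ_I)
    fix r :: real assume r: "r > 0"
    \<comment> \<open>Half of \<open>r\<close> covers the points where the difference is at most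
      \<open>e\<close>, and \<open>2 * prob A < r / 2\<close> covers the rest. The summand
      \<open>1\<close> allows \<open>t = 0\<close>.\<close>
    define e where "e = r / (2 * (1 + norm t))"
    have e: "e > 0" using r by (simp add: e_def add_pos_nonneg)
    have "\<forall>\<^sub>F n in sequentially. \<exists>A\<in>sets M. {\<omega>\<in>space M. norm (X n \<omega> - Y n \<omega>) > e * 1} \<subseteq> A \<and> prob A < r / 4"
      using null[unfolded op_small_def] e r by (meson divide_pos_pos zero_less_numeral)
    then have "\<forall>\<^sub>F n in sequentially. norm ((LINT \<omega>|M. cis (t \<bullet> X n \<omega>)) - (LINT \<omega>|M. cis (t \<bullet> Y n \<omega>)) - 0) < r"
    proof eventually_elim
      case (elim n)
      then obtain A where A[measurable]: "A \<in> sets M" "{\<omega>\<in>space M. norm (X n \<omega> - Y n \<omega>) > e} \<subseteq> A" "prob A < r / 4" by auto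
      have ind: "integrable M (\<lambda>\<omega>. 2 * indicator A \<omega> :: real)"
        by (rule integrable_const_bound[of _ 2]) (auto simp: indicator_def)
      have "norm ((LINT \<omega>|M. cis (t \<bullet> X n \<omega>)) - (LINT \<omega>|M. cis (t \<bullet> Y n \<omega>)))
          = norm (LINT \<omega>|M. cis (t \<bullet> X n \<omega>) - cis (t \<bullet> Y n \<omega>))" by (simp add: int)
      also have "\<dots> \<le> (LINT \<omega>|M. r / 2 + 2 * indicator A \<omega>)"
      proof (rule order_trans[OF integral_norm_bound integral_mono])
        fix \<omega> assume w: "\<omega> \<in> space M"
        show "norm (cis (t \<bullet> X n \<omega>) - cis (t \<bullet> Y n \<omega>)) \<le> r / 2 + 2 * indicator A \<omega>"
        proof (cases "\<omega> \<in> A")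
          case True
          have "norm (cis (t \<bullet> X n \<omega>) - cis (t \<bullet> Y n \<omega>)) \<le> 1 + 1"
            by (rule norm_triangle_le_diff) simp
          then show ?thesis using True r by simp
        next
          case False
          then have "norm (X n \<omega> - Y n \<omega>) \<le> e" using A(2) w by force
          have "cis (t \<bullet> X n \<omega>) - cis (t \<bullet> Y n \<omega>) = cis (t \<bullet> Y n \<omega>) * (cis (t \<bullet> (X n \<omega> - Y n \<omega>)) - 1)"
            by (simp add: inner_diff_right right_diff_distrib cis_mult)
          then have "norm (cis (t \<bullet> X n \<omega>) - cis (t \<bullet> Y n \<omega>)) = norm (cis (t \<bullet> (X n \<omega> - Y n \<omega>)) - 1)"
            by (simp add: norm_mult)
          also have "\<dots> \<le> \<bar>t \<bullet> (X n \<omega> - Y n \<omega>)\<bar>"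
            using iexp_approx1[of "t \<bullet> (X n \<omega> - Y n \<omega>)" 0] by (simp add: cis_conv_exp)
          also have "\<dots> \<le> norm t * norm (X n \<omega> - Y n \<omega>)" by (rule Cauchy_Schwarz_ineq2)
          also have "\<dots> \<le> (1 + norm t) * e" using \<open>norm (X n \<omega> - Y n \<omega>) \<le> e\<close> by (intro mult_mono) auto
          also have "\<dots> = r / 2"
          proof -
            have "1 + norm t \<noteq> 0" using norm_ge_zero[of t] by linarith
            then have "(1 + norm t) * (r / (2 * (1 + norm t))) = r / 2" by (metis mult.commute nonzero_mult_divide_mult_cancel_left times_divide_eq_right)
            then show ?thesis by (simp only: e_def)
          qed
          finally show ?thesis using False by simp
        qed
      qed (use ind int in auto)
      also have "\<dots> = r / 2 + 2 * prob A"
        unfolding Bochner_Integration.integral_add[OF integrable_const ind] by (simp add: prob_space)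
      finally show ?case using A(3) by simp
    qed
    then show "\<exists>no. \<forall>n\<ge>no. norm ((LINT \<omega>|M. cis (t \<bullet> X n \<omega>)) - (LINT \<omega>|M. cis (t \<bullet> Y n \<omega>)) - 0) < r"
      by (simp add: eventually_sequentially)
  qed
  from tendsto_add[OF this lim] show ?thesis by simp
qed

lemma (in prob_space) tight_of_bdd_in_prob:
  assumes [measurable]: "\<And>n. (X n :: 'a \<Rightarrow> 'b::euclidean_space) \<in> borel_measurable M"
    and bdd: "bdd_in_prob M (\<lambda>n \<omega>. norm (X n \<omega>))" and "e > 0"
  shows "\<exists>R. \<forall>\<^sub>F n in sequentially. prob {\<omega>\<in>space M. norm (X n \<omega>) > R} < e"
proof -
  obtain R where "with_prob M e (\<lambda>n \<omega>. \<bar>norm (X n \<omega>)\<bar> \<le> R)" using bdd \<open>e > 0\<close> unfolding bdd_in_prob_def by blast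
  then have "\<forall>\<^sub>F n in sequentially. prob {\<omega>\<in>space M. norm (X n \<omega>) > R} < e"
    unfolding with_prob_def
  proof eventually_elim
    case (elim n)
    then obtain A where A: "A \<in> sets M" "A \<subseteq> {\<omega>\<in>space M. norm (X n \<omega>) \<le> R}" "prob A > 1 - e" by auto
    have "prob {\<omega>\<in>space M. norm (X n \<omega>) > R} \<le> prob (space M - A)"
      using A by (intro finite_measure_mono) auto
    then show ?case using A by (simp add: prob_compl)
  qed
  then show ?thesis ..
qed

section \<open>Averages of independent identically distributed variables\<close>

abbreviation (input) avg :: "nat \<Rightarrow> (nat \<Rightarrow> 'a) \<Rightarrow> 'a::real_vector" where
  "avg n x \<equiv> (1 / real n) *\<^sub>R (\<Sum>j\<in>{1..n}. x j)"

locale iid_sample = P: prob_space P + Q: prob_space Q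
  for P :: "'w measure" and Q :: "'z measure" +
  fixes Z :: "nat \<Rightarrow> 'w \<Rightarrow> 'z"
  assumes Z_meas [measurable]: "\<And>j. Z j \<in> measurable P Q"
    and Z_indep: "P.indep_vars (\<lambda>_. Q) Z UNIV"
    and Z_distr: "\<And>j. distr P Q (Z j) = Q"
begin

lemma integrable_Z_iff:
  fixes f :: "'z \<Rightarrow> 'b::{banach, second_countable_topology}"
  assumes "f \<in> borel_measurable Q"
  shows "integrable P (\<lambda>\<omega>. f (Z j \<omega>)) \<longleftrightarrow> integrable Q f"
  using integrable_distr_eq[OF Z_meas assms, of j] by (simp add: Z_distr)

lemma integral_Z:
  fixes f :: "'z \<Rightarrow> 'b::{banach, second_countable_topology}"
  assumes "f \<in> borel_measurable Q"
  shows "(LINT \<omega>|P. f (Z j \<omega>)) = (LINT z|Q. f z)"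
  using integral_distr[OF Z_meas assms, of j] by (simp add: Z_distr)

text \<open>The mixed terms vanish: \<open>f (Z k \<omega>)\<close> is independent of the sum over
  the other indices and has mean zero.\<close>

lemma sum_square_integral:
  fixes f :: "'z \<Rightarrow> real"
  assumes f[measurable]: "f \<in> borel_measurable Q" and f2: "integrable Q (\<lambda>z. (f z)\<^sup>2)" and f0: "(LINT z|Q. f z) = 0"
    and "finite J"
  shows "integrable P (\<lambda>\<omega>. (\<Sum>j\<in>J. f (Z j \<omega>))\<^sup>2) \<and>
      (LINT \<omega>|P. (\<Sum>j\<in>J. f (Z j \<omega>))\<^sup>2) = card J * (LINT z|Q. (f z)\<^sup>2)"
  using \<open>finite J\<close>
proof (induction J rule: finite_induct)
  case (insert k J)
  have f1: "integrable Q f" using f f2 by (rule Q.square_integrable_imp_integrable)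
  have int1: "integrable P (\<lambda>\<omega>. f (Z k \<omega>))" for k using f1 by (simp add: integrable_Z_iff)
  have int2: "integrable P (\<lambda>\<omega>. (f (Z k \<omega>))\<^sup>2)" using f2 integrable_Z_iff[of "\<lambda>z. (f z)\<^sup>2" k] by simp
  have intS: "integrable P (\<lambda>\<omega>. \<Sum>j\<in>J. f (Z j \<omega>))" using int1 by simp
  have "P.indep_vars (\<lambda>_. borel) (\<lambda>i x. f (Z i x)) (insert k J)"
    using P.indep_vars_subset[OF P.indep_vars_compose2[OF Z_indep, of "\<lambda>_. f" "\<lambda>_. borel"]] by simp
  then have ind: "P.indep_var borel (\<lambda>\<omega>. f (Z k \<omega>)) borel (\<lambda>\<omega>. \<Sum>j\<in>J. f (Z j \<omega>))"
    by (rule P.indep_vars_sum[OF insert.hyps])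
  have intprod: "integrable P (\<lambda>\<omega>. f (Z k \<omega>) * (\<Sum>j\<in>J. f (Z j \<omega>)))"
    using P.indep_var_integrable[OF ind int1 intS] .
  have prod0: "(LINT \<omega>|P. f (Z k \<omega>) * (\<Sum>j\<in>J. f (Z j \<omega>))) = 0"
    using P.indep_var_lebesgue_integral[OF ind int1 intS] by (simp add: integral_Z f0)
  have eq: "(\<Sum>j\<in>insert k J. f (Z j \<omega>))\<^sup>2
      = (f (Z k \<omega>))\<^sup>2 + 2 * (f (Z k \<omega>) * (\<Sum>j\<in>J. f (Z j \<omega>))) + (\<Sum>j\<in>J. f (Z j \<omega>))\<^sup>2" for \<omega>
    using insert.hyps by (simp add: power2_sum)
  have "(LINT \<omega>|P. (f (Z k \<omega>))\<^sup>2) = (LINT z|Q. (f z)\<^sup>2)" by (rule integral_Z) simp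
  then show ?case
    unfolding eq using insert int2 intprod prod0 by (simp add: distrib_right)
qed simp

lemma vector_sum_square_nn_integral:
  fixes h :: "'z \<Rightarrow> 'b::euclidean_space"
  assumes h[measurable]: "h \<in> borel_measurable Q" and h2: "integrable Q (\<lambda>z. (norm (h z))\<^sup>2)" and h0: "(LINT z|Q. h z) = 0"
  shows "(\<integral>\<^sup>+\<omega>. ennreal ((norm (\<Sum>j\<in>{1..n}. h (Z j \<omega>)))\<^sup>2) \<partial>P) = ennreal (n * (LINT z|Q. (norm (h z))\<^sup>2))"
proof -
  have nsq: "(norm x)\<^sup>2 = (\<Sum>b\<in>Basis. (x \<bullet> b)\<^sup>2)" for x :: 'b
    unfolding power2_norm_eq_inner by (subst euclidean_inner) (simp add: power2_eq_square)
  have hint: "integrable Q h"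
    using Q.square_integrable_imp_integrable[of "\<lambda>z. norm (h z)"] h2 by (simp add: integrable_norm_iff)
  have b2: "integrable Q (\<lambda>z. (h z \<bullet> b)\<^sup>2)" if "b \<in> Basis" for b
  proof (rule Bochner_Integration.integrable_bound[OF h2])
    show "AE z in Q. norm ((h z \<bullet> b)\<^sup>2) \<le> norm ((norm (h z))\<^sup>2)"
      using Basis_le_norm[OF that] by (auto simp: power2_le_iff_abs_le)
  qed simp
  have b0: "(LINT z|Q. h z \<bullet> b) = 0" for b using hint h0 by simp
  have sq: "integrable P (\<lambda>\<omega>. ((\<Sum>j\<in>{1..n}. h (Z j \<omega>)) \<bullet> b)\<^sup>2)"
    "(LINT \<omega>|P. ((\<Sum>j\<in>{1..n}. h (Z j \<omega>)) \<bullet> b)\<^sup>2) = n * (LINT z|Q. (h z \<bullet> b)\<^sup>2)" if "b \<in> Basis" for b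
    using sum_square_integral[of "\<lambda>z. h z \<bullet> b" "{1..n}"] b2[OF that] b0 by (simp_all add: inner_sum_left)
  have int: "integrable P (\<lambda>\<omega>. (norm (\<Sum>j\<in>{1..n}. h (Z j \<omega>)))\<^sup>2)"
    unfolding nsq by (rule Bochner_Integration.integrable_sum) (rule sq)
  have "(LINT \<omega>|P. (norm (\<Sum>j\<in>{1..n}. h (Z j \<omega>)))\<^sup>2) = (\<Sum>b\<in>Basis. n * (LINT z|Q. (h z \<bullet> b)\<^sup>2))"
    unfolding nsq by (subst Bochner_Integration.integral_sum) (simp_all add: sq del: One_nat_def)
  also have "\<dots> = n * (LINT z|Q. (norm (h z))\<^sup>2)"
    unfolding nsq by (subst Bochner_Integration.integral_sum) (simp_all add: b2 sum_distrib_left)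
  finally show ?thesis by (simp add: nn_integral_eq_integral[OF int] del: One_nat_def)
qed

lemma scaled_sum_bdd_in_prob:
  fixes h :: "'z \<Rightarrow> 'b::euclidean_space"
  assumes h[measurable]: "h \<in> borel_measurable Q" and h2: "integrable Q (\<lambda>z. (norm (h z))\<^sup>2)" and h0: "(LINT z|Q. h z) = 0"
  shows "bdd_in_prob P (\<lambda>n \<omega>. norm ((1 / sqrt (real n)) *\<^sub>R (\<Sum>j\<in>{1..n}. h (Z j \<omega>))))"
proof (rule P.bdd_in_prob_le)
  let ?S = "\<lambda>n \<omega>. (1 / sqrt (real n)) *\<^sub>R (\<Sum>j\<in>{1..n}. h (Z j \<omega>))"
  have "bdd_in_prob P (\<lambda>n \<omega>. (norm (?S n \<omega>))\<^sup>2)"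
  proof (rule P.bdd_in_prob_L1[of _ "LINT z|Q. (norm (h z))\<^sup>2"])
    show "\<forall>\<^sub>F n in sequentially. (\<integral>\<^sup>+\<omega>. ennreal \<bar>(norm (?S n \<omega>))\<^sup>2\<bar> \<partial>P) \<le> ennreal (LINT z|Q. (norm (h z))\<^sup>2)"
    proof (rule eventually_sequentiallyI[of 1])
      fix n :: nat assume n: "1 \<le> n"
      have "(\<integral>\<^sup>+\<omega>. ennreal \<bar>(norm (?S n \<omega>))\<^sup>2\<bar> \<partial>P)
          = (\<integral>\<^sup>+\<omega>. ennreal (1 / n) * ennreal ((norm (\<Sum>j\<in>{1..n}. h (Z j \<omega>)))\<^sup>2) \<partial>P)"
        by (simp add: power_divide flip: ennreal_mult')
      also have "\<dots> = ennreal (1 / n) * ennreal (n * (LINT z|Q. (norm (h z))\<^sup>2))"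
        by (subst nn_integral_cmult) (simp_all del: One_nat_def add: vector_sum_square_nn_integral[OF assms])
      also have "\<dots> = ennreal (LINT z|Q. (norm (h z))\<^sup>2)"
        using n by (simp flip: ennreal_mult')
      finally show "(\<integral>\<^sup>+\<omega>. ennreal \<bar>(norm (?S n \<omega>))\<^sup>2\<bar> \<partial>P) \<le> ennreal (LINT z|Q. (norm (h z))\<^sup>2)" by simp
    qed
  qed simp_all
  then show "bdd_in_prob P (\<lambda>n \<omega>. (norm (?S n \<omega>))\<^sup>2 + 1)"
    by (rule P.bdd_in_prob_add[OF _ P.bdd_in_prob_const])
  \<comment> \<open>Passes from the square, whose expectation is the same for all
    \<open>n \<ge> 1\<close>, to the norm itself.\<close>
  have le: "\<bar>x\<bar> \<le> \<bar>x\<^sup>2 + 1\<bar>" for x :: real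
    using sum_squares_bound[of "\<bar>x\<bar>" 1] by simp
  show "\<bar>norm (?S n \<omega>)\<bar> \<le> \<bar>(norm (?S n \<omega>))\<^sup>2 + 1\<bar>" for n \<omega> by (rule le)
qed

text \<open>Truncation: \<open>f\<close> has only a first moment, so the variance estimate is made
  for a bounded \<open>g\<close> and the difference is controlled in L1. The application is to
  products of two linear functionals of \<open>v\<close>, where no more than a first moment is
  available.\<close>

lemma weak_law:
  fixes f :: "'z \<Rightarrow> real"
  assumes fint: "integrable Q f"
  shows "null_in_prob P (\<lambda>n \<omega>. avg n (\<lambda>j. f (Z j \<omega>)) - (LINT z|Q. f z))"
proof (rule P.null_in_prob_L1)
  have f[measurable]: "f \<in> borel_measurable Q" using fint by simp
  let ?D = "\<lambda>g n \<omega>. avg n (\<lambda>j. g (Z j \<omega>)) - (LINT z|Q. g z) :: real"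
  have bound: "(\<integral>\<^sup>+\<omega>. ennreal \<bar>?D f n \<omega>\<bar> \<partial>P) \<le> ennreal r" if r: "r > 0" and n: "n \<ge> 1"
    and g[measurable]: "g \<in> borel_measurable Q" and c: "\<And>z. \<bar>g z\<bar> \<le> c" and close: "(LINT z|Q. \<bar>f z - g z\<bar>) \<le> r / 4"
    and nr: "16 * (4 * c\<^sup>2) \<le> r\<^sup>2 * real n" for r g c n
  proof -
    define G where "G z = g z - (LINT z|Q. g z)" for z
    have gint: "integrable Q g" using c by (intro Q.integrable_const_bound[of _ c]) auto
    have mg: "\<bar>LINT z|Q. g z\<bar> \<le> c"
    proof -
      have "\<bar>LINT z|Q. g z\<bar> \<le> (LINT z|Q. \<bar>g z\<bar>)" by (rule integral_abs_bound)
      also have "\<dots> \<le> (LINT z|Q. c)" using c gint by (intro integral_mono) auto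
      finally show ?thesis by (simp add: Q.prob_space)
    qed
    have Gm[measurable]: "G \<in> borel_measurable Q" unfolding G_def by simp
    have Gc: "\<bar>G z\<bar> \<le> 2 * c" for z using c[of z] mg unfolding G_def by linarith
    have G2c: "(G z)\<^sup>2 \<le> 4 * c\<^sup>2" for z using power_mono[OF Gc[of z], of 2] by (simp add: power_mult_distrib)
    have G2: "integrable Q (\<lambda>z. (G z)\<^sup>2)"
      using G2c by (intro Q.integrable_const_bound[of _ "4 * c\<^sup>2"]) auto
    have G0: "(LINT z|Q. G z) = 0" unfolding G_def using gint by (simp add: Q.prob_space)
    have G2le: "(LINT z|Q. (G z)\<^sup>2) \<le> 4 * c\<^sup>2"
    proof -
      have "(LINT z|Q. (G z)\<^sup>2) \<le> (LINT z|Q. 4 * c\<^sup>2)" using G2 G2c by (intro integral_mono) auto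
      then show ?thesis by (simp add: Q.prob_space)
    qed
    note S = sum_square_integral[OF Gm G2 G0, of "{1..n}", simplified]
    define W where "W \<omega> = (\<Sum>j\<in>{1..n}. \<bar>f (Z j \<omega>) - g (Z j \<omega>)\<bar>)" for \<omega>
    have fgint: "integrable Q (\<lambda>z. \<bar>f z - g z\<bar>)" using fint gint by simp
    have Wterm: "integrable P (\<lambda>\<omega>. \<bar>f (Z j \<omega>) - g (Z j \<omega>)\<bar>)" for j
      using fgint integrable_Z_iff[of "\<lambda>z. \<bar>f z - g z\<bar>" j] by simp
    have Wint: "integrable P W" "(LINT \<omega>|P. W \<omega>) = n * (LINT z|Q. \<bar>f z - g z\<bar>)"
      unfolding W_def using Wterm integral_Z[of "\<lambda>z. \<bar>f z - g z\<bar>"] by simp_all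
    \<comment> \<open>The budget \<open>r\<close> has four equal shares. For the centred average
      \<open>y\<close> of \<open>g\<close>, the bound
      \<open>\<bar>y\<bar> \<le> r / 4 + (4 / r) * y\<^sup>2\<close> takes two of them; the L1
      distance of \<open>f\<close> and \<open>g\<close> takes one in the average and one between the
      means. Premise \<open>nr\<close> says that the expected quadratic term, at most
      \<open>(4 / r) * (4 * c\<^sup>2 / n)\<close>, fits into \<open>r / 4\<close>.\<close>
    define B where "B \<omega> = r / 4 + (4 / r) * ((1 / real n)\<^sup>2 * (\<Sum>j\<in>{1..n}. G (Z j \<omega>))\<^sup>2) + (1 / real n) * W \<omega> + r / 4" for \<omega>
    have le: "\<bar>?D f n \<omega>\<bar> \<le> B \<omega>" for \<omega>
    proof -
      define y where "y = (1 / real n) * (\<Sum>j\<in>{1..n}. G (Z j \<omega>))"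
      have "y = (1 / real n) * (\<Sum>j\<in>{1..n}. g (Z j \<omega>)) - (LINT z|Q. g z)"
        using n unfolding y_def G_def by (simp add: sum_subtractf right_diff_distrib)
      then have "?D f n \<omega> = y + (1 / real n) * (\<Sum>j\<in>{1..n}. f (Z j \<omega>) - g (Z j \<omega>)) - (LINT z|Q. f z - g z)"
        using fint gint by (simp add: sum_subtractf right_diff_distrib)
      moreover have "\<bar>LINT z|Q. f z - g z\<bar> \<le> r / 4" using integral_abs_bound[of Q "\<lambda>z. f z - g z"] close by linarith
      moreover have "\<bar>(1 / real n) * (\<Sum>j\<in>{1..n}. f (Z j \<omega>) - g (Z j \<omega>))\<bar> \<le> (1 / real n) * W \<omega>"
        unfolding abs_mult W_def by (intro mult_mono sum_abs) auto
      moreover have "\<bar>y\<bar> \<le> r / 4 + (4 / r) * y\<^sup>2"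
      proof -
        have "2 * (\<bar>y\<bar> * r) \<le> r\<^sup>2 / 4 + 4 * y\<^sup>2"
          using sum_squares_bound[of "r / 2" "2 * \<bar>y\<bar>"] by (simp add: power_mult_distrib power_divide mult_ac)
        moreover have "0 \<le> \<bar>y\<bar> * r" using r by simp
        ultimately have "\<bar>y\<bar> * r \<le> r\<^sup>2 / 4 + 4 * y\<^sup>2" by linarith
        then have "\<bar>y\<bar> \<le> (r\<^sup>2 / 4 + 4 * y\<^sup>2) / r" using r by (simp add: pos_le_divide_eq)
        then show ?thesis using r by (simp add: add_divide_distrib power2_eq_square)
      qed
      ultimately show ?thesis unfolding B_def y_def power_mult_distrib by linarith
    qed
    have Bint: "integrable P B" unfolding B_def using S Wint by simp
    have DB: "(\<integral>\<^sup>+\<omega>. ennreal \<bar>?D f n \<omega>\<bar> \<partial>P) \<le> (\<integral>\<^sup>+\<omega>. ennreal (B \<omega>) \<partial>P)"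
      by (intro nn_integral_mono ennreal_leI le)
    have BE: "(\<integral>\<^sup>+\<omega>. ennreal (B \<omega>) \<partial>P) = ennreal (LINT \<omega>|P. B \<omega>)"
      using le by (intro nn_integral_eq_integral Bint) (auto intro: order_trans[OF abs_ge_zero])
    have "(LINT \<omega>|P. B \<omega>) = r / 4 + (4 / r) * ((1 / real n)\<^sup>2 * (n * (LINT z|Q. (G z)\<^sup>2))) + (1 / real n) * (n * (LINT z|Q. \<bar>f z - g z\<bar>)) + r / 4"
      unfolding B_def using S Wint by (simp add: P.prob_space)
    also have "\<dots> \<le> r / 4 + r / 4 + r / 4 + r / 4"
    proof (intro add_mono order_refl)
      have "(4 / r) * ((1 / real n)\<^sup>2 * (n * (LINT z|Q. (G z)\<^sup>2))) = (4 / r) * ((LINT z|Q. (G z)\<^sup>2) / n)"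
        using n by (simp add: power2_eq_square)
      also have "\<dots> \<le> (4 / r) * (4 * c\<^sup>2 / n)" using r G2le by (intro mult_left_mono divide_right_mono) auto
      also have "\<dots> \<le> r / 4" using nr r n by (simp add: field_simps power2_eq_square)
      finally show "(4 / r) * ((1 / real n)\<^sup>2 * (n * (LINT z|Q. (G z)\<^sup>2))) \<le> r / 4" .
      show "(1 / real n) * (n * (LINT z|Q. \<bar>f z - g z\<bar>)) \<le> r / 4" using n close by simp
    qed
    finally have "(LINT \<omega>|P. B \<omega>) \<le> r" by simp
    with DB show ?thesis unfolding BE by (blast intro: order_trans ennreal_leI)
  qed
  have trunc: "\<exists>g c. g \<in> borel_measurable Q \<and> (\<forall>z. \<bar>g z\<bar> \<le> c) \<and> (LINT z|Q. \<bar>f z - g z\<bar>) \<le> e" if e: "e > 0" for e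
  proof -
    define g where "g k z = (if \<bar>f z\<bar> \<le> real k then f z else 0)" for k z
    have [measurable]: "g k \<in> borel_measurable Q" for k unfolding g_def by measurable
    have "(\<lambda>k. LINT z|Q. \<bar>f z - g k z\<bar>) \<longlonglongrightarrow> (LINT z|Q. 0)"
    proof (rule integral_dominated_convergence[where w="\<lambda>z. \<bar>f z\<bar>"])
      have "(\<lambda>k. \<bar>f z - g k z\<bar>) \<longlonglongrightarrow> 0" for z
      proof (rule tendsto_eventually)
        obtain K :: nat where "\<bar>f z\<bar> \<le> real K" using real_arch_simple by blast
        then show "\<forall>\<^sub>F k in sequentially. \<bar>f z - g k z\<bar> = 0"
          by (intro eventually_sequentiallyI[of K]) (auto simp: g_def)
      qed
      then show "AE z in Q. (\<lambda>k. \<bar>f z - g k z\<bar>) \<longlonglongrightarrow> 0" by simp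
      show "AE z in Q. norm \<bar>f z - g k z\<bar> \<le> \<bar>f z\<bar>" for k by (auto simp: g_def)
    qed (use fint in auto)
    then have "\<forall>\<^sub>F k in sequentially. (LINT z|Q. \<bar>f z - g k z\<bar>) < e" using e by (intro order_tendstoD) auto
    then obtain k where "(LINT z|Q. \<bar>f z - g k z\<bar>) < e" by (auto simp: eventually_sequentially)
    then show ?thesis by (intro exI[of _ "g k"] exI[of _ "real k"]) (auto simp: g_def)
  qed
  show "(\<lambda>n. \<integral>\<^sup>+\<omega>. ennreal \<bar>?D f n \<omega>\<bar> \<partial>P) \<longlonglongrightarrow> 0"
  proof (rule order_tendstoI)
    fix a :: ennreal assume "0 < a"
    then obtain r where r: "r > 0" "ennreal r < a"
      by (metis ennreal_less_zero_iff ennreal_less_iff dense ennreal_cases infinity_ennreal_def less_le_trans not_le top_greatest zero_le)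
    obtain g c where g: "g \<in> borel_measurable Q" "\<And>z. \<bar>g z\<bar> \<le> c" "(LINT z|Q. \<bar>f z - g z\<bar>) \<le> r / 4"
      using trunc[of "r / 4"] r by auto
    obtain N :: nat where N: "16 * (4 * c\<^sup>2) / r\<^sup>2 \<le> real N" using real_arch_simple by blast
    show "\<forall>\<^sub>F n in sequentially. (\<integral>\<^sup>+\<omega>. ennreal \<bar>?D f n \<omega>\<bar> \<partial>P) < a"
    proof (rule eventually_sequentiallyI[of "max 1 N"])
      fix n assume n: "max 1 N \<le> n"
      then have "16 * (4 * c\<^sup>2) / r\<^sup>2 \<le> real n" using N by simp
      then have "16 * (4 * c\<^sup>2) \<le> r\<^sup>2 * real n" using r by (simp add: divide_le_eq mult.commute)
      then show "(\<integral>\<^sup>+\<omega>. ennreal \<bar>?D f n \<omega>\<bar> \<partial>P) < a"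
        using bound[OF r(1) _ g] n r(2) by (auto intro: le_less_trans)
    qed
  qed simp
qed (use fint in simp)

lemma central_limit_char:
  fixes f :: "'z \<Rightarrow> real"
  assumes f[measurable]: "f \<in> borel_measurable Q" and f2: "integrable Q (\<lambda>z. (f z)\<^sup>2)" and f0: "(LINT z|Q. f z) = 0"
    and pos: "(LINT z|Q. (f z)\<^sup>2) > 0"
  shows "(\<lambda>n. LINT \<omega>|P. cis ((1 / sqrt (real n)) * (\<Sum>j\<in>{1..n}. f (Z j \<omega>)))) \<longlonglongrightarrow> complex_of_real (exp (- (LINT z|Q. (f z)\<^sup>2) / 2))"
proof -
  define \<sigma> where "\<sigma> = sqrt (LINT z|Q. (f z)\<^sup>2)"
  have \<sigma>: "\<sigma> > 0" "\<sigma>\<^sup>2 = (LINT z|Q. (f z)\<^sup>2)" using pos by (simp_all add: \<sigma>_def)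
  \<comment> \<open>The central limit theorem sums over the indices below \<open>n\<close>, while
    the sample starts at \<open>Z 1\<close>.\<close>
  define X where "X i \<omega> = f (Z (Suc i) \<omega>)" for i \<omega>
  have X2: "integrable P (\<lambda>x. (X n x)\<^sup>2)" for n
    using f2 integrable_Z_iff[of "\<lambda>z. (f z)\<^sup>2"] by (simp add: X_def)
  have X0: "P.expectation (X n) = 0" for n unfolding X_def by (simp add: integral_Z f0)
  have Xv: "P.variance (X n) = \<sigma>\<^sup>2" for n
    unfolding X0 \<sigma> using integral_Z[of "\<lambda>z. (f z)\<^sup>2"] by (simp add: X_def)
  have [measurable]: "X n \<in> borel_measurable P" for n unfolding X_def by simp
  have Xd: "distr P borel (X n) = distr Q borel f" for n
  proof -
    have "distr (distr P Q (Z (Suc n))) borel f = distr P borel (X n)"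
      by (subst distr_distr) (auto simp: X_def[abs_def] comp_def)
    then show ?thesis by (simp add: Z_distr)
  qed
  have Xi: "P.indep_vars (\<lambda>i. borel) X UNIV"
  proof -
    \<comment> \<open>A finite index set of the shifted sequence is replaced by its image under
      \<open>Suc\<close>, and the events are relabelled by \<open>k - 1\<close>.\<close>
    have "P.indep_vars (\<lambda>_. Q) (\<lambda>i. Z (Suc i)) UNIV"
      unfolding P.indep_vars_def2
    proof (intro conjI ballI P.indep_setsI)
      fix A J assume J: "J \<noteq> {}" "J \<subseteq> (UNIV :: nat set)" "finite J"
        and A: "\<forall>j\<in>J. A j \<in> {Z (Suc j) -` B \<inter> space P |B. B \<in> sets Q}"
      have "P.prob (\<Inter>k\<in>Suc ` J. A (k - 1)) = (\<Prod>k\<in>Suc ` J. P.prob (A (k - 1)))"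
        using Z_indep[unfolded P.indep_vars_def2] J A by (intro P.indep_setsD) auto
      then show "P.prob (\<Inter>j\<in>J. A j) = (\<Prod>j\<in>J. P.prob (A j))" by (simp add: prod.reindex)
    qed auto
    then show ?thesis unfolding X_def by (rule P.indep_vars_compose2) simp
  qed
  have "weak_conv_m (\<lambda>n. distr P borel (\<lambda>x. (\<Sum>i<n. X i x) / sqrt (n * \<sigma>\<^sup>2))) std_normal_distribution"
    by (rule P.central_limit_theorem_zero_mean[OF Xi X0 \<sigma>(1) X2 Xv Xd])
  \<comment> \<open>Evaluation at \<open>\<sigma>\<close> cancels the \<open>\<sigma>\<close> in the
    normalization and leaves the sum divided by \<open>sqrt n\<close>.\<close>
  then have "(\<lambda>n. char (distr P borel (\<lambda>x. (\<Sum>i<n. X i x) / sqrt (n * \<sigma>\<^sup>2))) \<sigma>) \<longlonglongrightarrow> char std_normal_distribution \<sigma>"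
    by (intro levy_continuity1) (auto intro!: P.real_distribution_distr simp: real_dist_normal_dist)
  also have "char std_normal_distribution \<sigma> = complex_of_real (exp (- (LINT z|Q. (f z)\<^sup>2) / 2))"
    by (simp add: char_std_normal_distribution \<sigma>)
  also have "(\<lambda>n. char (distr P borel (\<lambda>x. (\<Sum>i<n. X i x) / sqrt (n * \<sigma>\<^sup>2))) \<sigma>)
      = (\<lambda>n. LINT \<omega>|P. cis ((1 / sqrt (real n)) * (\<Sum>j\<in>{1..n}. f (Z j \<omega>))))"
  proof
    fix n
    have "char (distr P borel (\<lambda>x. (\<Sum>i<n. X i x) / sqrt (n * \<sigma>\<^sup>2))) \<sigma>
        = (LINT \<omega>|P. cis (\<sigma> * ((\<Sum>i<n. X i \<omega>) / sqrt (n * \<sigma>\<^sup>2))))"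
      unfolding char_def cis_conv_exp by (rule integral_distr) simp_all
    also have "\<dots> = (LINT \<omega>|P. cis ((1 / sqrt (real n)) * (\<Sum>j\<in>{1..n}. f (Z j \<omega>))))"
      using \<sigma>(1) by (simp add: real_sqrt_mult X_def sum.atLeast1_atMost_eq)
    finally show "char (distr P borel (\<lambda>x. (\<Sum>i<n. X i x) / sqrt (n * \<sigma>\<^sup>2))) \<sigma>
      = (LINT \<omega>|P. cis ((1 / sqrt (real n)) * (\<Sum>j\<in>{1..n}. f (Z j \<omega>))))" .
  qed
  finally show ?thesis .
qed

end

section \<open>The equation for the multiplier\<close>

text \<open>Without a zero, \<open>F\<close> rescaled to length \<open>r\<close> maps the ball into
  its sphere. A Brouwer fixed point \<open>x\<close> has norm \<open>r\<close> and satisfies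
  \<open>F x \<bullet> x = r * norm (F x)\<close>, the equality case of Cauchy-Schwarz that
  \<open>inward\<close> excludes. For \<open>r = 0\<close> that premise itself says
  \<open>F 0 = 0\<close>.\<close>

lemma outward_field_zero:
  fixes F :: "'v::euclidean_space \<Rightarrow> 'v"
  assumes r: "0 \<le> r" and cont: "continuous_on (cball 0 r) F"
    and inward: "\<And>x. norm x = r \<Longrightarrow> F x \<noteq> 0 \<Longrightarrow> F x \<bullet> x < r * norm (F x)"
  shows "\<exists>x\<in>cball 0 r. F x = 0"
proof (rule ccontr)
  assume neg: "\<not> ?thesis"
  let ?g = "\<lambda>x. (r / norm (F x)) *\<^sub>R F x"
  have nz: "F x \<noteq> 0" if "x \<in> cball 0 r" for x using neg that by auto
  have cg: "continuous_on (cball 0 r) ?g"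
    by (intro continuous_intros cont) (use nz in auto)
  have ng: "norm (?g x) = r" if "x \<in> cball 0 r" for x
    using nz[OF that] r by simp
  obtain x where x: "x \<in> cball 0 r" "?g x = x"
    by (rule brouwer[OF compact_cball convex_cball _ cg]) (use r ng in \<open>auto simp: Pi_iff\<close>)
  have "norm x = r" using ng[OF x(1)] x(2) by simp
  have "F x \<bullet> x = F x \<bullet> ?g x" using x(2) by simp
  also have "\<dots> = r * norm (F x)"
    using nz[OF x(1)] by (simp add: power2_norm_eq_inner[symmetric] power2_eq_square)
  finally show False using inward[OF \<open>norm x = r\<close> nz[OF x(1)]] by simp
qed

text \<open>Paired with \<open>y - x\<close>, the difference of the fields at \<open>x\<close> and
  \<open>y\<close> is a sum of nonnegative terms. If it is zero, every \<open>a j\<close> is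
  orthogonal to \<open>y - x\<close>, which \<open>quad\<close> permits only for
  \<open>x = y\<close>.\<close>

lemma weighted_root_unique:
  fixes a :: "'i \<Rightarrow> 'v::real_inner"
  assumes J: "finite J" and lam: "lam > 0" and c: "c > 0"
    and quad: "\<And>x. lam * (norm x)\<^sup>2 \<le> c * (\<Sum>j\<in>J. (a j \<bullet> x)\<^sup>2)"
    and x: "\<forall>j\<in>J. 1 + a j \<bullet> x > 0" "(\<Sum>j\<in>J. (1 / (1 + a j \<bullet> x)) *\<^sub>R a j) = 0"
    and y: "\<forall>j\<in>J. 1 + a j \<bullet> y > 0" "(\<Sum>j\<in>J. (1 / (1 + a j \<bullet> y)) *\<^sub>R a j) = 0"
  shows "x = y"
proof -
  have term_eq: "((1 / (1 + a j \<bullet> x)) *\<^sub>R a j) \<bullet> (y - x) - ((1 / (1 + a j \<bullet> y)) *\<^sub>R a j) \<bullet> (y - x)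
      = (a j \<bullet> (y - x))\<^sup>2 / ((1 + a j \<bullet> x) * (1 + a j \<bullet> y))" if "j \<in> J" for j
  proof -
    have "1 + a j \<bullet> x \<noteq> 0" "1 + a j \<bullet> y \<noteq> 0" using x(1) y(1) that by force+
    then show ?thesis
      by (simp add: inner_diff_right divide_simps) (simp add: algebra_simps power2_eq_square)
  qed
  have "(\<Sum>j\<in>J. (a j \<bullet> (y - x))\<^sup>2 / ((1 + a j \<bullet> x) * (1 + a j \<bullet> y)))
     = (\<Sum>j\<in>J. (1 / (1 + a j \<bullet> x)) *\<^sub>R a j) \<bullet> (y - x) - (\<Sum>j\<in>J. (1 / (1 + a j \<bullet> y)) *\<^sub>R a j) \<bullet> (y - x)"
    unfolding inner_sum_left sum_subtractf[symmetric] by (intro sum.cong refl) (simp only: term_eq)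
  also have "\<dots> = 0" using x(2) y(2) by simp
  finally have "\<forall>j\<in>J. (a j \<bullet> (y - x))\<^sup>2 / ((1 + a j \<bullet> x) * (1 + a j \<bullet> y)) = 0"
    by (subst (asm) sum_nonneg_eq_0_iff) (use J x(1) y(1) in \<open>auto intro!: divide_nonneg_pos simp: less_imp_le\<close>)
  then have "\<forall>j\<in>J. a j \<bullet> (y - x) = 0" using x(1) y(1) by force
  then have "lam * (norm (y - x))\<^sup>2 \<le> 0" using quad[of "y - x"] by simp
  then have "(norm (y - x))\<^sup>2 \<le> 0" using lam by (simp add: mult_le_0_iff)
  then show ?thesis by simp
qed

lemma weighted_root_exists:
  fixes a :: "'i \<Rightarrow> 'v::euclidean_space"
  assumes lam: "lam > 0" and c: "c > 0"
    and quad: "\<And>x. lam * (norm x)\<^sup>2 \<le> c * (\<Sum>j\<in>J. (a j \<bullet> x)\<^sup>2)"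
    and M: "\<And>j. j \<in> J \<Longrightarrow> norm (a j) \<le> M" "0 \<le> M"
    and small: "4 * M * norm (c *\<^sub>R (\<Sum>j\<in>J. a j)) \<le> lam"
  shows "\<exists>x. norm x \<le> 2 * norm (c *\<^sub>R (\<Sum>j\<in>J. a j)) / lam \<and> (\<forall>j\<in>J. 1 + a j \<bullet> x \<ge> 1 / 2) \<and>
      (\<Sum>j\<in>J. (1 / (1 + a j \<bullet> x)) *\<^sub>R a j) = 0"
proof -
  define ab where "ab = c *\<^sub>R (\<Sum>j\<in>J. a j)"
  \<comment> \<open>On the ball of this radius
    \<open>\<bar>a j \<bullet> x\<bar> \<le> M * r \<le> 1 / 2\<close>, which is where the
    \<open>4\<close> in \<open>small\<close> comes from. On its boundary the quadratic term
    \<open>2/3 * (lam * r\<^sup>2)\<close> equals \<open>4/3 * norm ab * r\<close> and outweighs the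
    linear term \<open>norm ab * r\<close>.\<close>
  define r where "r = 2 * norm ab / lam"
  have r: "r \<ge> 0" and lr: "lam * r = 2 * norm ab" using lam by (auto simp: r_def)
  have "lam * (M * r) = 2 * M * norm ab" using lr by (simp add: mult.left_commute)
  also have "\<dots> \<le> lam * (1/2)" using small unfolding ab_def[symmetric] by simp
  finally have Mr: "M * r \<le> 1 / 2" using lam by simp
  have small_inner: "\<bar>a j \<bullet> x\<bar> \<le> 1 / 2" if "j \<in> J" "norm x \<le> r" for j x
  proof -
    have "\<bar>a j \<bullet> x\<bar> \<le> norm (a j) * norm x" by (rule Cauchy_Schwarz_ineq2)
    also have "\<dots> \<le> M * r" using M that by (intro mult_mono) auto
    finally show ?thesis using Mr by simp
  qed
  have ge: "1 + a j \<bullet> x \<ge> 1 / 2" if "j \<in> J" "norm x \<le> r" for j x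
    using small_inner[OF that] by linarith
  define F where "F x = c *\<^sub>R (\<Sum>j\<in>J. (1 / (1 + a j \<bullet> x)) *\<^sub>R a j)" for x
  have cF: "continuous_on (cball 0 r) F" unfolding F_def
    by (intro continuous_intros ballI) (use ge in force)
  have "\<exists>x\<in>cball 0 r. F x = 0"
  proof (rule outward_field_zero[OF r cF])
    fix x assume nx: "norm x = r" and Fx: "F x \<noteq> 0"
    have "F x \<bullet> x = ab \<bullet> x - c * (\<Sum>j\<in>J. (a j \<bullet> x)\<^sup>2 / (1 + a j \<bullet> x))"
    proof -
      have "(1 / (1 + a j \<bullet> x)) * (a j \<bullet> x) = a j \<bullet> x - (a j \<bullet> x)\<^sup>2 / (1 + a j \<bullet> x)" if "j \<in> J" for j
        using ge[OF that, of x] nx by (simp add: field_simps power2_eq_square)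
      then have "(\<Sum>j\<in>J. (1 / (1 + a j \<bullet> x)) * (a j \<bullet> x)) = (\<Sum>j\<in>J. a j \<bullet> x) - (\<Sum>j\<in>J. (a j \<bullet> x)\<^sup>2 / (1 + a j \<bullet> x))"
        by (simp add: sum_subtractf)
      then show ?thesis unfolding F_def ab_def by (simp add: inner_sum_left right_diff_distrib)
    qed
    also have "\<dots> \<le> norm ab * r - 2/3 * (lam * r\<^sup>2)"
    proof -
      \<comment> \<open>\<open>2/3\<close> is the least value of \<open>1 / (1 + s)\<close> for
        \<open>\<bar>s\<bar> \<le> 1 / 2\<close>.\<close>
      have "(\<Sum>j\<in>J. 2/3 * (a j \<bullet> x)\<^sup>2) \<le> (\<Sum>j\<in>J. (a j \<bullet> x)\<^sup>2 / (1 + a j \<bullet> x))"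
      proof (rule sum_mono)
        fix j assume j: "j \<in> J"
        have "0 < 1 + a j \<bullet> x" "2 / 3 * (1 + a j \<bullet> x) \<le> 1" using small_inner[OF j, of x] nx by (auto simp: abs_le_iff)
        then show "2/3 * (a j \<bullet> x)\<^sup>2 \<le> (a j \<bullet> x)\<^sup>2 / (1 + a j \<bullet> x)"
          using mult_left_mono[of "2 / 3 * (1 + a j \<bullet> x)" 1 "(a j \<bullet> x)\<^sup>2"]
          by (simp add: le_divide_eq algebra_simps)
      qed
      then have "c * (2/3 * (\<Sum>j\<in>J. (a j \<bullet> x)\<^sup>2)) \<le> c * (\<Sum>j\<in>J. (a j \<bullet> x)\<^sup>2 / (1 + a j \<bullet> x))"
        using c by (intro mult_left_mono) (simp_all only: sum_distrib_left less_imp_le)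
      then have "2/3 * (c * (\<Sum>j\<in>J. (a j \<bullet> x)\<^sup>2)) \<le> c * (\<Sum>j\<in>J. (a j \<bullet> x)\<^sup>2 / (1 + a j \<bullet> x))"
        by (simp add: mult_ac)
      then have "2/3 * (lam * r\<^sup>2) \<le> c * (\<Sum>j\<in>J. (a j \<bullet> x)\<^sup>2 / (1 + a j \<bullet> x))"
        using quad[of x] nx by simp
      moreover have "ab \<bullet> x \<le> norm ab * r" using norm_cauchy_schwarz[of ab x] nx by simp
      ultimately show ?thesis by simp
    qed
    also have "\<dots> = - norm ab * r / 3"
      using lr by (simp add: power2_eq_square mult.assoc[symmetric])
    also have "\<dots> \<le> 0" using r by simp
    finally have le: "F x \<bullet> x \<le> 0" .
    show "F x \<bullet> x < r * norm (F x)"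
    \<comment> \<open>\<open>F x \<bullet> x \<le> 0\<close> gives the strict inequality only for
      \<open>r > 0\<close>. If \<open>r = 0\<close>, the mean \<open>ab\<close> vanishes, and so
      does \<open>F\<close> at the origin.\<close>
    proof (cases "r = 0")
      case True
      then have "ab = 0" using lr by simp
      moreover have "F x = ab" using nx True by (simp add: F_def ab_def)
      ultimately show ?thesis using Fx by simp
    next
      case False
      then have "r * norm (F x) > 0" using Fx r by simp
      then show ?thesis using le by simp
    qed
  qed
  then obtain x where "norm x \<le> r" "F x = 0" by auto
  then show ?thesis using ge c unfolding r_def F_def ab_def by (intro exI[of _ x]) auto
qed

section \<open>Second-moment matrices and the deterministic expansion\<close>

lemma outer_mult_vec: "outer x y *v z = (y \<bullet> z) *\<^sub>R x"
  by (simp add: vec_eq_iff outer_def matrix_vector_mult_def inner_vec_def sum_distrib_left mult_ac)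

lemma norm_outer: "norm (outer x y) = norm x * norm y"
proof -
  have "outer x y $ i = (x $ i) *\<^sub>R y" for i by (simp add: outer_def vec_eq_iff)
  then have "norm (outer x y) = L2_set (\<lambda>i. norm y * \<bar>x $ i\<bar>) UNIV" by (simp add: norm_vec_def[of "outer x y"] mult.commute)
  also have "\<dots> = norm y * norm x" by (simp add: L2_set_right_distrib norm_vec_def)
  finally show ?thesis by (simp add: mult.commute)
qed

lemma outer_diff_right: "outer x (y - z) = outer x y - outer x z"
  by (simp add: outer_def vec_eq_iff right_diff_distrib)

text \<open>The norm of a matrix is the Frobenius norm here, so this is Cauchy-Schwarz in every row.
  The operator norm of condition (ii) enters separately through \<open>onorm\<close>.\<close>

lemma norm_mult_vec_le: "norm (A *v x) \<le> norm A * norm x" for A :: "real^'n^'m"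
proof -
  have "norm (A *v x) = L2_set (\<lambda>i. \<bar>A $ i \<bullet> x\<bar>) UNIV"
    by (simp add: norm_vec_def[of "A *v x"] matrix_vector_mul_component)
  also have "\<dots> \<le> L2_set (\<lambda>i. norm x * norm (A $ i)) UNIV"
    by (intro L2_set_mono) (use Cauchy_Schwarz_ineq2 in \<open>auto simp: mult.commute[of "norm x"]\<close>)
  also have "\<dots> = norm A * norm x" by (subst mult.commute) (simp add: L2_set_right_distrib norm_vec_def[of A])
  finally show ?thesis .
qed

lemma onorm_mult_vec: "norm (A *v x) \<le> onorm (\<lambda>x. A *v x) * norm x" for A :: "real^'n^'m"
  by (rule onorm[OF matrix_vector_mul_bounded_linear])

lemma measurable_outer [measurable]:
  assumes [measurable]: "f \<in> borel_measurable M" "g \<in> borel_measurable M"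
  shows "(\<lambda>z. outer (f z) (g z)) \<in> borel_measurable M"
proof -
  have "continuous_on UNIV (\<lambda>p. outer (fst p) (snd p) :: real^'n^'m)"
    unfolding outer_def by (intro continuous_intros)
  then have "(\<lambda>p. outer (fst p) (snd p)) \<in> borel_measurable (borel \<Otimes>\<^sub>M borel)"
    unfolding borel_prod by (rule borel_measurable_continuous_onI)
  then have "(\<lambda>z. (\<lambda>p. outer (fst p) (snd p)) (f z, g z)) \<in> borel_measurable M" by measurable
  then show ?thesis by simp
qed

lemma integrable_mult_L2:
  fixes f g :: "'z \<Rightarrow> real"
  assumes [measurable]: "f \<in> borel_measurable M" "g \<in> borel_measurable M"
    and "integrable M (\<lambda>z. (f z)\<^sup>2)" "integrable M (\<lambda>z. (g z)\<^sup>2)"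
  shows "integrable M (\<lambda>z. f z * g z)"
proof (rule Bochner_Integration.integrable_bound)
  show "integrable M (\<lambda>z. (f z)\<^sup>2 + (g z)\<^sup>2)" using assms by simp
  have "\<bar>x * y\<bar> \<le> x\<^sup>2 + y\<^sup>2" for x y :: real
    using sum_squares_bound[of "\<bar>x\<bar>" "\<bar>y\<bar>"] abs_ge_zero[of "x * y"] unfolding power2_abs abs_mult by linarith
  then show "AE z in M. norm (f z * g z) \<le> norm ((f z)\<^sup>2 + (g z)\<^sup>2)" by simp
qed simp

lemma integrable_inner_L2:
  fixes f :: "'z \<Rightarrow> 'b::euclidean_space"
  assumes [measurable]: "f \<in> borel_measurable M" and f2: "integrable M (\<lambda>z. (norm (f z))\<^sup>2)"
  shows "integrable M (\<lambda>z. (f z \<bullet> x)\<^sup>2)"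
proof (rule Bochner_Integration.integrable_bound)
  show "integrable M (\<lambda>z. (norm x)\<^sup>2 * (norm (f z))\<^sup>2)" using f2 by simp
  show "AE z in M. norm ((f z \<bullet> x)\<^sup>2) \<le> norm ((norm x)\<^sup>2 * (norm (f z))\<^sup>2)"
    using Cauchy_Schwarz_ineq[of _ x] by (intro AE_I2) (simp add: power2_norm_eq_inner mult.commute[of "x \<bullet> x"])
qed simp

text \<open>The second claim holds because evaluation on two vectors is a bounded linear functional
  of the matrix. It reduces identities between moment matrices to scalar integrals.\<close>

lemma
  fixes f :: "'z \<Rightarrow> real^'m" and g :: "'z \<Rightarrow> real^'n"
  assumes [measurable]: "f \<in> borel_measurable M" "g \<in> borel_measurable M"
    and f2: "integrable M (\<lambda>z. (norm (f z))\<^sup>2)" and g2: "integrable M (\<lambda>z. (norm (g z))\<^sup>2)"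
  shows integrable_outer: "integrable M (\<lambda>z. outer (f z) (g z))"
    and integral_outer_inner: "((LINT z|M. outer (f z) (g z)) *v x) \<bullet> y = (LINT z|M. (f z \<bullet> y) * (g z \<bullet> x))"
proof -
  show int: "integrable M (\<lambda>z. outer (f z) (g z))"
    by (rule Bochner_Integration.integrable_bound[OF integrable_mult_L2[of "\<lambda>z. norm (f z)" M "\<lambda>z. norm (g z)"]])
       (use f2 g2 in \<open>auto simp: norm_outer\<close>)
  have "linear (\<lambda>A::real^'n^'m. (A *v x) \<bullet> y)"
    by (rule linearI) (simp_all add: matrix_vector_mult_add_rdistrib inner_add_left scaleR_matrix_vector_assoc[symmetric])
  then have "((LINT z|M. outer (f z) (g z)) *v x) \<bullet> y = (LINT z|M. (outer (f z) (g z) *v x) \<bullet> y)"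
    by (intro integral_bounded_linear[OF _ int, symmetric]) (simp add: linear_conv_bounded_linear)
  then show "((LINT z|M. outer (f z) (g z)) *v x) \<bullet> y = (LINT z|M. (f z \<bullet> y) * (g z \<bullet> x))"
    by (simp add: outer_mult_vec mult.commute)
qed

lemma matrix_eq_inner:
  fixes A B :: "real^'n^'m"
  assumes "\<And>x y. (A *v x) \<bullet> y = (B *v x) \<bullet> y"
  shows "A = B"
  using assms by (metis matrix_eq vector_eq_rdot)

text \<open>If the form vanishes at \<open>x\<close>, then \<open>h z \<bullet> x = 0\<close> almost
  everywhere and hence \<open>S *v x = 0\<close>, against invertibility. So for second-moment
  matrices nonsingular means positive definite; this is used for \<open>v\<close> and for the
  influence function.\<close>

lemma
  fixes h :: "'z \<Rightarrow> real^'n"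
  assumes h[measurable]: "h \<in> borel_measurable M" and h2: "integrable M (\<lambda>z. (norm (h z))\<^sup>2)"
    and S: "\<And>x y. (S *v x) \<bullet> y = (LINT z|M. (h z \<bullet> x) * (h z \<bullet> y))" and inv: "invertible S"
  shows second_moment_sym: "transpose S = S"
    and second_moment_posdef: "x \<noteq> 0 \<Longrightarrow> x \<bullet> (S *v x) > 0"
proof -
  have "(transpose S *v x) \<bullet> y = (S *v x) \<bullet> y" for x y
    by (metis (no_types, lifting) S Bochner_Integration.integral_cong dot_lmul_matrix inner_commute mult.commute transpose_matrix_vector)
  then show "transpose S = S" by (rule matrix_eq_inner)
  assume "x \<noteq> 0"
  have eq: "x \<bullet> (S *v x) = (LINT z|M. (h z \<bullet> x)\<^sup>2)" using S[of x x] by (simp add: inner_commute power2_eq_square)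
  have ge: "x \<bullet> (S *v x) \<ge> 0" unfolding eq by simp
  have "x \<bullet> (S *v x) \<noteq> 0"
  proof
    assume "x \<bullet> (S *v x) = 0"
    then have "AE z in M. (h z \<bullet> x)\<^sup>2 = 0"
      using integral_nonneg_eq_0_iff_AE[OF integrable_inner_L2[OF h h2, of x]] eq by simp
    then have "(S *v x) \<bullet> y = 0" for y
      unfolding S by (intro integral_eq_zero_AE) (auto elim: eventually_mono)
    then have "S *v x = 0" by (metis inner_eq_zero_iff)
    then show False using inv \<open>x \<noteq> 0\<close>
      by (metis invertible_def matrix_vector_mul_assoc matrix_vector_mul_lid matrix_vector_mult_0_right)
  qed
  with ge show "x \<bullet> (S *v x) > 0" by simp
qed

text \<open>The minimum of the form over the compact unit sphere is positive, and homogeneity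
  extends the bound to all vectors.\<close>

lemma posdef_lower_bound:
  fixes S :: "real^'n^'n"
  assumes pd: "\<And>x. x \<noteq> 0 \<Longrightarrow> x \<bullet> (S *v x) > 0"
  shows "\<exists>l>0. \<forall>x. l * (norm x)\<^sup>2 \<le> x \<bullet> (S *v x)"
proof -
  have cont: "continuous_on (sphere 0 1) (\<lambda>x. x \<bullet> (S *v x))"
    by (intro continuous_intros linear_continuous_on matrix_vector_mul_bounded_linear)
  have "sphere (0::real^'n) 1 \<noteq> {}" by simp
  then obtain e where e: "norm e = 1" "\<And>x. norm x = 1 \<Longrightarrow> e \<bullet> (S *v e) \<le> x \<bullet> (S *v x)"
    using continuous_attains_inf[OF compact_sphere _ cont] by auto
  show ?thesis
  proof (intro exI conjI allI)
    show "e \<bullet> (S *v e) > 0" using e(1) by (intro pd) auto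
    fix x
    show "e \<bullet> (S *v e) * (norm x)\<^sup>2 \<le> x \<bullet> (S *v x)"
    proof (cases "x = 0")
      case False
      then have "e \<bullet> (S *v e) \<le> ((1 / norm x) *\<^sub>R x) \<bullet> (S *v ((1 / norm x) *\<^sub>R x))"
        by (intro e(2)) simp
      also have "\<dots> = (x \<bullet> (S *v x)) / (norm x)\<^sup>2"
        by (simp add: matrix_vector_mult_scaleR power2_eq_square)
      finally show ?thesis using False by (simp add: le_divide_eq)
    qed simp
  qed
qed

section \<open>The expansion for finitely many vectors\<close>

lemma inverse_one_plus_expansion: "1 + s \<noteq> 0 \<Longrightarrow> 1 / (1 + s) = 1 - s + s\<^sup>2 / (1 + s)" for s :: real
  by (simp add: divide_simps) (simp add: algebra_simps power2_eq_square)

lemma avg_outer_mult_vec: "avg n (\<lambda>j. outer (y j) (a j)) *v x = avg n (\<lambda>j. (a j \<bullet> x) *\<^sub>R y j)"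
proof -
  have "(\<Sum>j\<in>J. outer (y j) (a j)) *v x = (\<Sum>j\<in>J. (a j \<bullet> x) *\<^sub>R y j)" if "finite J" for J
    using that by (induction J) (simp_all add: matrix_vector_mult_add_rdistrib outer_mult_vec)
  then show ?thesis by (simp add: scaleR_matrix_vector_assoc[symmetric])
qed

lemma norm_avg_le:
  assumes "\<And>j. j \<in> {1..n} \<Longrightarrow> norm (x j) \<le> b j"
  shows "norm (avg n x) \<le> avg n b"
proof -
  have "norm (\<Sum>j\<in>{1..n}. x j) \<le> (\<Sum>j\<in>{1..n}. b j)" by (rule sum_norm_le) (rule assms)
  then show ?thesis by (simp add: divide_right_mono)
qed

lemma avg_weighted_expansion:
  fixes y :: "nat \<Rightarrow> 'b::real_vector"
  assumes "\<And>j. j \<in> {1..n} \<Longrightarrow> 1 + s j \<noteq> 0"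
  shows "avg n (\<lambda>j. (1 / (1 + s j)) *\<^sub>R y j) = avg n y - avg n (\<lambda>j. s j *\<^sub>R y j) + avg n (\<lambda>j. ((s j)\<^sup>2 / (1 + s j)) *\<^sub>R y j)"
proof -
  have "(\<Sum>j\<in>{1..n}. (1 / (1 + s j)) *\<^sub>R y j) = (\<Sum>j\<in>{1..n}. y j - s j *\<^sub>R y j + ((s j)\<^sup>2 / (1 + s j)) *\<^sub>R y j)"
    by (intro sum.cong refl) (subst inverse_one_plus_expansion, use assms in \<open>auto simp: algebra_simps\<close>)
  then show ?thesis by (simp add: sum.distrib sum_subtractf scaleR_add_right scaleR_diff_right)
qed

text \<open>Here \<open>a j\<close> stands for the value of \<open>uhat\<close> at
  \<open>Z j\<close>, and \<open>b\<close> for the average of \<open>v\<close>. Each term of the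
  bound is small for one of three reasons: an empirical moment is close to its limit,
  \<open>avg n a\<close> is close to \<open>b\<close>, or there is a factor
  \<open>m * (norm z)\<^sup>2\<close>, which is o_p(n^(-1/2)) because \<open>m\<close> is
  o_p(n^(1/2)) and \<open>z\<close> is O_p(n^(-1/2)).\<close>

lemma el_expansion:
  fixes a :: "nat \<Rightarrow> real^'m" and y :: "nat \<Rightarrow> real^'r" and V :: "real^'m^'m" and C :: "real^'m^'r"
  assumes z: "\<And>j. j \<in> {1..n} \<Longrightarrow> 1 + a j \<bullet> z \<ge> 1 / 2" "avg n (\<lambda>j. (1 / (1 + a j \<bullet> z)) *\<^sub>R a j) = 0"
    and m: "\<And>j. j \<in> {1..n} \<Longrightarrow> norm (a j) \<le> m" and n: "n \<ge> 1" and V: "invertible V"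
  defines "D \<equiv> onorm (\<lambda>x. (avg n (\<lambda>j. outer (a j) (a j)) - V) *v x)"
    and "K \<equiv> onorm (\<lambda>x. V *v x)"
  shows "norm (avg n (\<lambda>j. (1 / (1 + a j \<bullet> z)) *\<^sub>R y j) - (avg n y - (C ** matrix_inv V) *v b))
    \<le> norm (avg n (\<lambda>j. outer (y j) (a j)) - C) * norm z
      + norm (C ** matrix_inv V) * (D * norm z + norm (avg n a - b) + 2 * m * ((D + K) * (norm z)\<^sup>2))
      + m * ((norm z)\<^sup>2 * (D + K + avg n (\<lambda>j. (norm (y j))\<^sup>2)))"
proof -
  define s where "s j = a j \<bullet> z" for j
  define Wh where "Wh = avg n (\<lambda>j. outer (a j) (a j))"
  define Ch where "Ch = avg n (\<lambda>j. outer (y j) (a j))"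
  define e where "e = avg n (\<lambda>j. ((s j)\<^sup>2 / (1 + s j)) *\<^sub>R a j)"
  define R where "R = avg n (\<lambda>j. ((s j)\<^sup>2 / (1 + s j)) *\<^sub>R y j)"
  have s: "1 + s j \<noteq> 0" if "j \<in> {1..n}" for j using z(1)[OF that] unfolding s_def by linarith
  have sq: "\<bar>(s j)\<^sup>2 / (1 + s j)\<bar> \<le> 2 * (s j)\<^sup>2" if "j \<in> {1..n}" for j
  proof -
    have h: "1 + s j \<ge> 1 / 2" using z(1)[OF that] unfolding s_def by linarith
    then have "(s j)\<^sup>2 * 1 \<le> (s j)\<^sup>2 * (2 * (1 + s j))" by (intro mult_left_mono) auto
    then show ?thesis using h by (simp add: divide_le_eq algebra_simps)
  qed
  have m0: "0 \<le> m" using m[of 1] n norm_ge_zero[of "a 1"] by (simp del: norm_ge_zero)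
  have avgs: "avg n (\<lambda>j. (s j)\<^sup>2) \<le> (D + K) * (norm z)\<^sup>2"
  proof -
    have "avg n (\<lambda>j. (s j)\<^sup>2) = z \<bullet> (Wh *v z)"
      by (simp add: Wh_def avg_outer_mult_vec inner_sum_right s_def power2_eq_square inner_commute del: One_nat_def)
    also have "\<dots> = z \<bullet> ((Wh - V) *v z) + z \<bullet> (V *v z)"
      by (simp add: matrix_vector_mult_diff_rdistrib inner_diff_right)
    also have "\<dots> \<le> norm z * (D * norm z) + norm z * (K * norm z)"
      unfolding D_def K_def Wh_def
      by (intro add_mono order_trans[OF norm_cauchy_schwarz] mult_left_mono onorm_mult_vec) auto
    also have "\<dots> = (D + K) * (norm z)\<^sup>2" by (simp add: power2_eq_square algebra_simps)
    finally show ?thesis .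
  qed
  have e_le: "norm e \<le> 2 * m * ((D + K) * (norm z)\<^sup>2)"
  proof -
    have "norm e \<le> avg n (\<lambda>j. (2 * m) * (s j)\<^sup>2)" unfolding e_def
    proof (rule norm_avg_le)
      fix j assume j: "j \<in> {1..n}"
      have "norm (((s j)\<^sup>2 / (1 + s j)) *\<^sub>R a j) \<le> (2 * (s j)\<^sup>2) * m"
        unfolding norm_scaleR by (intro mult_mono sq[OF j] m[OF j]) auto
      then show "norm (((s j)\<^sup>2 / (1 + s j)) *\<^sub>R a j) \<le> 2 * m * (s j)\<^sup>2" by (simp add: mult_ac)
    qed
    also have "\<dots> = 2 * m * avg n (\<lambda>j. (s j)\<^sup>2)" by (simp add: sum_distrib_left[symmetric])
    also have "\<dots> \<le> 2 * m * ((D + K) * (norm z)\<^sup>2)" using m0 avgs by (intro mult_left_mono) auto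
    finally show ?thesis .
  qed
  have R_le: "norm R \<le> m * ((norm z)\<^sup>2 * (D + K + avg n (\<lambda>j. (norm (y j))\<^sup>2)))"
  proof -
    have "norm R \<le> avg n (\<lambda>j. m * (s j)\<^sup>2 + m * (norm z)\<^sup>2 * (norm (y j))\<^sup>2)" unfolding R_def
    proof (rule norm_avg_le)
      fix j assume j: "j \<in> {1..n}"
      have "\<bar>s j\<bar> \<le> m * norm z" unfolding s_def
        by (rule order_trans[OF Cauchy_Schwarz_ineq2 mult_right_mono[OF m[OF j] norm_ge_zero]])
      have "norm (((s j)\<^sup>2 / (1 + s j)) *\<^sub>R y j) \<le> 2 * (s j)\<^sup>2 * norm (y j)"
        unfolding norm_scaleR by (intro mult_mono sq[OF j]) auto
      \<comment> \<open>One factor \<open>\<bar>s j\<bar>\<close> is bounded by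
        \<open>m * norm z\<close>; the other is paired with \<open>norm (y j)\<close> by the
        inequality of the means, which needs only second moments of \<open>y\<close>. Bounding both
        factors would leave \<open>m\<^sup>2 * (norm z)\<^sup>2\<close>, which is merely
        o_p(1).\<close>
      also have "\<dots> = \<bar>s j\<bar> * (2 * (\<bar>s j\<bar> * norm (y j)))" by (simp add: power2_eq_square)
      also have "\<dots> \<le> (m * norm z) * (2 * (\<bar>s j\<bar> * norm (y j)))"
        using \<open>\<bar>s j\<bar> \<le> m * norm z\<close> by (intro mult_right_mono) auto
      also have "\<dots> = m * (2 * \<bar>s j\<bar> * (norm z * norm (y j)))" by simp
      also have "\<dots> \<le> m * (\<bar>s j\<bar>\<^sup>2 + (norm z * norm (y j))\<^sup>2)"
        by (rule mult_left_mono[OF sum_squares_bound m0])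
      finally show "norm (((s j)\<^sup>2 / (1 + s j)) *\<^sub>R y j) \<le> m * (s j)\<^sup>2 + m * (norm z)\<^sup>2 * (norm (y j))\<^sup>2"
        by (simp add: power_mult_distrib distrib_left mult_ac)
    qed
    also have "\<dots> = m * avg n (\<lambda>j. (s j)\<^sup>2) + m * ((norm z)\<^sup>2 * avg n (\<lambda>j. (norm (y j))\<^sup>2))"
      by (simp add: sum.distrib sum_distrib_left[symmetric] add_divide_distrib)
    also have "\<dots> \<le> m * ((D + K) * (norm z)\<^sup>2) + m * ((norm z)\<^sup>2 * avg n (\<lambda>j. (norm (y j))\<^sup>2))"
      using m0 avgs by (intro add_right_mono mult_left_mono) auto
    finally show ?thesis by (simp add: algebra_simps)
  qed
  have "avg n (\<lambda>j. s j *\<^sub>R a j) = Wh *v z" "avg n (\<lambda>j. s j *\<^sub>R y j) = Ch *v z"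
    unfolding Wh_def Ch_def avg_outer_mult_vec by (simp_all add: s_def)
  note ws = this
  have z2: "avg n (\<lambda>j. (1 / (1 + s j)) *\<^sub>R a j) = 0" using z(2) by (simp only: s_def)
  \<comment> \<open>The equation for \<open>z\<close> to first order: \<open>Wh *v z\<close> is
    \<open>avg n a\<close> up to the quadratic error \<open>e\<close>.\<close>
  have fe: "0 = avg n a - Wh *v z + e"
    using avg_weighted_expansion[of n s a, OF s] unfolding z2 ws e_def .
  have fy: "avg n (\<lambda>j. (1 / (1 + s j)) *\<^sub>R y j) = avg n y - Ch *v z + R"
    using avg_weighted_expansion[of n s y, OF s] unfolding ws R_def .
  have CV: "(C ** matrix_inv V) *v (V *v z) = C *v z"
    using V by (simp add: matrix_vector_mul_assoc matrix_inv_left flip: matrix_mul_assoc)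
  have "V *v z - b = - ((Wh - V) *v z) + (avg n a - b) + e"
    using fe by (simp add: matrix_vector_mult_diff_rdistrib algebra_simps)
  then have "C *v z - (C ** matrix_inv V) *v b = (C ** matrix_inv V) *v (- ((Wh - V) *v z) + (avg n a - b) + e)"
    using CV by (metis matrix_vector_mult_diff_distrib)
  then have eq: "avg n (\<lambda>j. (1 / (1 + s j)) *\<^sub>R y j) - (avg n y - (C ** matrix_inv V) *v b)
      = - ((Ch - C) *v z) - (C ** matrix_inv V) *v (- ((Wh - V) *v z) + (avg n a - b) + e) + R"
    unfolding fy by (simp add: matrix_vector_mult_diff_rdistrib algebra_simps)
  have tri: "norm (- p + q + r) \<le> norm p + norm q + norm r" for p q r :: "real^'k"
    using norm_triangle_ineq[of "- p + q" r] norm_triangle_ineq[of "- p" q] by simp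
  have tri': "norm (- p - q + r) \<le> norm p + norm q + norm r" for p q r :: "real^'k"
    using tri[of p "- q" r] by simp
  let ?x = "- ((Wh - V) *v z) + (avg n a - b) + e"
  have "norm ?x \<le> D * norm z + norm (avg n a - b) + 2 * m * ((D + K) * (norm z)\<^sup>2)"
    using onorm_mult_vec[of "Wh - V" z] e_le tri[of "(Wh - V) *v z" "avg n a - b" e] unfolding D_def Wh_def by linarith
  then have x: "norm ((C ** matrix_inv V) *v ?x)
      \<le> norm (C ** matrix_inv V) * (D * norm z + norm (avg n a - b) + 2 * m * ((D + K) * (norm z)\<^sup>2))"
    by (intro order_trans[OF norm_mult_vec_le] mult_left_mono) auto
  show ?thesis
    unfolding eq[unfolded s_def] Ch_def[symmetric]
    by (rule order_trans[OF tri'], intro add_mono norm_mult_vec_le x R_le)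
qed

section \<open>The empirical likelihood estimator\<close>

lemma nn_integral_avg:
  fixes X :: "nat \<Rightarrow> 'w \<Rightarrow> real"
  assumes [measurable]: "\<And>j. X j \<in> borel_measurable M" and nn: "\<And>j \<omega>. X j \<omega> \<ge> 0"
  shows "(\<integral>\<^sup>+\<omega>. ennreal \<bar>avg n (\<lambda>j. X j \<omega>)\<bar> \<partial>M) = ennreal (1 / real n) * (\<Sum>j\<in>{1..n}. \<integral>\<^sup>+\<omega>. ennreal (X j \<omega>) \<partial>M)"
proof -
  have "ennreal \<bar>avg n (\<lambda>j. X j \<omega>)\<bar> = ennreal (1 / real n) * (\<Sum>j\<in>{1..n}. ennreal (X j \<omega>))" for \<omega>
  proof -
    have "\<bar>avg n (\<lambda>j. X j \<omega>)\<bar> = 1 / real n * (\<Sum>j\<in>{1..n}. X j \<omega>)"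
      using nn by (simp add: sum_nonneg)
    then show ?thesis using nn by (simp only: ennreal_mult' sum_ennreal divide_nonneg_nonneg zero_le_one of_nat_0_le_iff)
  qed
  then show ?thesis by (simp add: nn_integral_cmult nn_integral_sum)
qed

lemma ennreal_pos_obtain_real:
  assumes "(0::ennreal) < a"
  obtains r where "r > 0" "ennreal r < a"
proof -
  obtain b where "0 < b" "b < a" using dense[OF assms] by blast
  then show ?thesis using that[of "enn2real b"]
    by (metis ennreal_enn2real enn2real_positive_iff less_top top.extremum order.strict_trans2)
qed

lemma (in prob_space) null_in_prob_tendsto:
  assumes "c \<longlonglongrightarrow> 0" shows "null_in_prob M (\<lambda>n _. c n)"
  unfolding op_small_iff
proof (intro allI impI)
  fix e \<delta> :: real assume "e > 0" "\<delta> > 0"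
  have "\<forall>\<^sub>F n in sequentially. dist (c n) 0 < e" using assms \<open>e > 0\<close> by (rule tendstoD)
  then show "with_prob M \<delta> (\<lambda>n \<omega>. norm (c n) \<le> e * 1)" unfolding with_prob_def
    by (rule eventually_mono) (use \<open>\<delta> > 0\<close> in \<open>auto intro!: bexI[of _ "space M"] simp: prob_space\<close>)
qed

locale el_setting = iid_sample P Q Z
  for P :: "'w measure" and Q :: "'z measure" and Z :: "nat \<Rightarrow> 'w \<Rightarrow> 'z" +
  fixes \<psi> :: "'z \<Rightarrow> real^'r" and v :: "'z \<Rightarrow> real^'m" and uhat :: "nat \<Rightarrow> 'w \<Rightarrow> 'z \<Rightarrow> real^'m"
    and W :: "real^'m^'m"
  assumes \<psi>_meas [measurable]: "\<psi> \<in> borel_measurable Q"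
    and \<psi>_L2: "integrable Q (\<lambda>z. norm (\<psi> z) ^ 2)"
    and uhat_meas [measurable]: "\<And>n j. (\<lambda>\<omega>. uhat n \<omega> (Z j \<omega>)) \<in> borel_measurable P"
    and uhat_max: "op_small P (\<lambda>n \<omega>. Max ((\<lambda>j. norm (uhat n \<omega> (Z j \<omega>))) ` {1..n})) (\<lambda>n. sqrt (real n))"
    and uhat_second_moment: "null_in_prob P
          (\<lambda>n \<omega>. onorm (\<lambda>x. (avg n (\<lambda>j. outer (uhat n \<omega> (Z j \<omega>)) (uhat n \<omega> (Z j \<omega>))) - W) *v x))"
    and \<psi>_uhat_moment: "null_in_prob P
          (\<lambda>n \<omega>. avg n (\<lambda>j. outer (\<psi> (Z j \<omega>)) (uhat n \<omega> (Z j \<omega>))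
              - integral\<^sup>L P (\<lambda>\<omega>'. outer (\<psi> (Z j \<omega>')) (uhat n \<omega>' (Z j \<omega>')))))"
    and v_meas [measurable]: "v \<in> borel_measurable Q"
    and v_L2: "integrable Q (\<lambda>z. norm (v z) ^ 2)"
    and v_mean: "integral\<^sup>L Q v = 0"
    and v_nonsing: "invertible (integral\<^sup>L Q (\<lambda>z. outer (v z) (v z)))"
    and uhat_v_L2: "(\<lambda>n. ennreal (1 / real n) *
          (\<Sum>j\<in>{1..n}. \<integral>\<^sup>+\<omega>. ennreal (norm (uhat n \<omega> (Z j \<omega>) - v (Z j \<omega>)) ^ 2) \<partial>P)) \<longlonglongrightarrow> 0"
    and uhat_v_mean: "op_small P
          (\<lambda>n \<omega>. avg n (\<lambda>j. uhat n \<omega> (Z j \<omega>)) - avg n (\<lambda>j. v (Z j \<omega>))) (\<lambda>n. 1 / sqrt (real n))"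
begin

section \<open>Empirical moments of the estimated functions\<close>

abbreviation (input) U :: "nat \<Rightarrow> 'w \<Rightarrow> nat \<Rightarrow> real^'m" where "U n \<omega> j \<equiv> uhat n \<omega> (Z j \<omega>)"

definition V :: "real^'m^'m" where "V = integral\<^sup>L Q (\<lambda>z. outer (v z) (v z))"
definition C :: "real^'m^'r" where "C = integral\<^sup>L Q (\<lambda>z. outer (\<psi> z) (v z))"
definition \<phi> :: "'z \<Rightarrow> real^'r" where "\<phi> z = (C ** matrix_inv V) *v v z"

lemma V_inner: "(V *v x) \<bullet> y = (LINT z|Q. (v z \<bullet> x) * (v z \<bullet> y))"
  unfolding V_def by (subst integral_outer_inner) (use v_L2 in \<open>simp_all add: mult.commute\<close>)

text \<open>The weighted inequality of the means takes the place of Cauchy-Schwarz and needs no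
  finiteness: the integrals in (iv) may be infinite for small \<open>n\<close>. The case
  \<open>g = v\<close> serves the second moments, the case \<open>g = \<psi>\<close> the mixed
  ones.\<close>

lemma cross_moment:
  fixes g :: "'z \<Rightarrow> real^'k"
  assumes [measurable]: "g \<in> borel_measurable Q" and g2: "integrable Q (\<lambda>z. (norm (g z))\<^sup>2)"
  shows "(\<lambda>n. ennreal (1 / real n) *
      (\<Sum>j\<in>{1..n}. \<integral>\<^sup>+\<omega>. ennreal (norm (g (Z j \<omega>)) * norm (U n \<omega> j - v (Z j \<omega>))) \<partial>P)) \<longlonglongrightarrow> 0"
proof (rule order_tendstoI)
  let ?b = "\<lambda>n. ennreal (1 / real n) * (\<Sum>j\<in>{1..n}. \<integral>\<^sup>+\<omega>. ennreal (norm (U n \<omega> j - v (Z j \<omega>)) ^ 2) \<partial>P)"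
  fix a :: ennreal assume "0 < a"
  then obtain r where r: "r > 0" "ennreal r < a" by (rule ennreal_pos_obtain_real)
  define G where "G = (LINT z|Q. (norm (g z))\<^sup>2)"
  have G: "G \<ge> 0" by (simp add: G_def)
  \<comment> \<open>Makes \<open>\<eta> * G \<le> r / 2\<close>, with \<open>G + 1\<close> to allow
    \<open>G = 0\<close>. The other half of \<open>r\<close> is reached once the average in (iv) is
    below \<open>\<eta> * r / 2\<close>.\<close>
  define \<eta> where "\<eta> = r / (2 * (G + 1))"
  have \<eta>: "\<eta> > 0" "\<eta> * G \<le> r / 2" using r G by (simp_all add: \<eta>_def field_simps)
  have Gint: "(\<integral>\<^sup>+\<omega>. ennreal ((norm (g (Z j \<omega>)))\<^sup>2) \<partial>P) = ennreal G" for j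
    using g2 integrable_Z_iff[of "\<lambda>z. (norm (g z))\<^sup>2" j] integral_Z[of "\<lambda>z. (norm (g z))\<^sup>2" j]
    by (subst nn_integral_eq_integral) (simp_all add: G_def)
  have "\<forall>\<^sub>F n in sequentially. ?b n < ennreal (\<eta> * r / 2)"
    using uhat_v_L2 \<eta> r by (intro order_tendstoD) auto
  then show "\<forall>\<^sub>F n in sequentially. ennreal (1 / real n) *
      (\<Sum>j\<in>{1..n}. \<integral>\<^sup>+\<omega>. ennreal (norm (g (Z j \<omega>)) * norm (U n \<omega> j - v (Z j \<omega>))) \<partial>P) < a"
    using eventually_ge_at_top[of 1]
  proof eventually_elim
    case (elim n)
    have t: "(\<integral>\<^sup>+\<omega>. ennreal (norm (g (Z j \<omega>)) * norm (U n \<omega> j - v (Z j \<omega>))) \<partial>P)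
        \<le> ennreal (\<eta> * G) + ennreal (1 / \<eta>) * (\<integral>\<^sup>+\<omega>. ennreal (norm (U n \<omega> j - v (Z j \<omega>)) ^ 2) \<partial>P)" for j
    proof -
      have le: "x * y \<le> \<eta> * x\<^sup>2 + (1 / \<eta>) * y\<^sup>2" if "x \<ge> 0" "y \<ge> 0" for x y :: real
      proof -
        have "2 * (x * y) = 2 * (sqrt \<eta> * x) * (y / sqrt \<eta>)" using \<eta>(1) by simp
        also have "\<dots> \<le> (sqrt \<eta> * x)\<^sup>2 + (y / sqrt \<eta>)\<^sup>2" by (rule sum_squares_bound)
        also have "\<dots> = \<eta> * x\<^sup>2 + (1 / \<eta>) * y\<^sup>2" using \<eta>(1) by (simp add: power_mult_distrib power_divide)
        finally show ?thesis using that by (smt (verit) mult_nonneg_nonneg)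
      qed
      have "(\<integral>\<^sup>+\<omega>. ennreal (norm (g (Z j \<omega>)) * norm (U n \<omega> j - v (Z j \<omega>))) \<partial>P)
          \<le> (\<integral>\<^sup>+\<omega>. ennreal \<eta> * ennreal ((norm (g (Z j \<omega>)))\<^sup>2) + ennreal (1 / \<eta>) * ennreal (norm (U n \<omega> j - v (Z j \<omega>)) ^ 2) \<partial>P)"
        using le \<eta>(1) by (intro nn_integral_mono) (simp flip: ennreal_mult' ennreal_plus)
      also have "\<dots> = ennreal (\<eta> * G) + ennreal (1 / \<eta>) * (\<integral>\<^sup>+\<omega>. ennreal (norm (U n \<omega> j - v (Z j \<omega>)) ^ 2) \<partial>P)"
        using \<eta>(1) by (simp add: nn_integral_add nn_integral_cmult Gint ennreal_mult')
      finally show ?thesis .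
    qed
    have "ennreal (1 / real n) * (\<Sum>j\<in>{1..n}. \<integral>\<^sup>+\<omega>. ennreal (norm (g (Z j \<omega>)) * norm (U n \<omega> j - v (Z j \<omega>))) \<partial>P)
        \<le> ennreal (1 / real n) * (\<Sum>j\<in>{1..n}. ennreal (\<eta> * G) + ennreal (1 / \<eta>) * (\<integral>\<^sup>+\<omega>. ennreal (norm (U n \<omega> j - v (Z j \<omega>)) ^ 2) \<partial>P))"
      by (intro mult_left_mono sum_mono t) simp
    also have "\<dots> = ennreal (1 / real n) * (of_nat n * ennreal (\<eta> * G)) + ennreal (1 / \<eta>) * ?b n"
      by (simp add: sum.distrib sum_distrib_left[symmetric] distrib_left mult.left_commute)
    also have "ennreal (1 / real n) * (of_nat n * ennreal (\<eta> * G)) = ennreal (\<eta> * G)"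
      using elim(2) by (simp add: ennreal_of_nat_eq_real_of_nat mult.assoc[symmetric] flip: ennreal_mult')
    also have "ennreal (\<eta> * G) + ennreal (1 / \<eta>) * ?b n \<le> ennreal (r / 2) + ennreal (1 / \<eta>) * ennreal (\<eta> * r / 2)"
      using elim(1) \<eta> by (intro add_mono mult_left_mono ennreal_leI) auto
    also have "\<dots> = ennreal r" using \<eta>(1) r by (simp flip: ennreal_mult' ennreal_plus)
    finally show ?case using r(2) by (rule le_less_trans)
  qed
qed simp

lemma uhat_v_null: "null_in_prob P (\<lambda>n \<omega>. avg n (\<lambda>j. (norm (U n \<omega> j - v (Z j \<omega>)))\<^sup>2))"
proof (rule P.null_in_prob_L1)
  have "(\<lambda>n. \<integral>\<^sup>+\<omega>. ennreal \<bar>avg n (\<lambda>j. (norm (U n \<omega> j - v (Z j \<omega>)))\<^sup>2)\<bar> \<partial>P)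
      = (\<lambda>n. ennreal (1 / real n) * (\<Sum>j\<in>{1..n}. \<integral>\<^sup>+\<omega>. ennreal (norm (U n \<omega> j - v (Z j \<omega>)) ^ 2) \<partial>P))"
    by (rule ext, rule nn_integral_avg) simp_all
  with uhat_v_L2 show "(\<lambda>n. \<integral>\<^sup>+\<omega>. ennreal \<bar>avg n (\<lambda>j. (norm (U n \<omega> j - v (Z j \<omega>)))\<^sup>2)\<bar> \<partial>P) \<longlonglongrightarrow> 0"
    by (simp only:)
qed simp

lemma v_uhat_cross_null: "null_in_prob P (\<lambda>n \<omega>. avg n (\<lambda>j. norm (v (Z j \<omega>)) * norm (U n \<omega> j - v (Z j \<omega>))))"
proof (rule P.null_in_prob_L1)
  have "(\<lambda>n. \<integral>\<^sup>+\<omega>. ennreal \<bar>avg n (\<lambda>j. norm (v (Z j \<omega>)) * norm (U n \<omega> j - v (Z j \<omega>)))\<bar> \<partial>P)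
      = (\<lambda>n. ennreal (1 / real n) * (\<Sum>j\<in>{1..n}. \<integral>\<^sup>+\<omega>. ennreal (norm (v (Z j \<omega>)) * norm (U n \<omega> j - v (Z j \<omega>))) \<partial>P))"
    by (rule ext, rule nn_integral_avg) simp_all
  with cross_moment[OF v_meas v_L2]
  show "(\<lambda>n. \<integral>\<^sup>+\<omega>. ennreal \<bar>avg n (\<lambda>j. norm (v (Z j \<omega>)) * norm (U n \<omega> j - v (Z j \<omega>)))\<bar> \<partial>P) \<longlonglongrightarrow> 0"
    by (simp only:)
qed simp

lemma uhat_v_bilinear_null:
  "null_in_prob P (\<lambda>n \<omega>. avg n (\<lambda>j. (U n \<omega> j \<bullet> x) * (U n \<omega> j \<bullet> y)) - avg n (\<lambda>j. (v (Z j \<omega>) \<bullet> x) * (v (Z j \<omega>) \<bullet> y)))"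
proof (rule P.null_in_prob_le)
  let ?d = "\<lambda>n \<omega> j. norm (U n \<omega> j - v (Z j \<omega>))"
  let ?Y = "\<lambda>n \<omega>. (avg n (\<lambda>j. (?d n \<omega> j)\<^sup>2) + avg n (\<lambda>j. norm (v (Z j \<omega>)) * ?d n \<omega> j) * 2) * (norm x * norm y)"
  show "null_in_prob P ?Y"
    by (intro P.null_in_prob_mult P.null_in_prob_add uhat_v_null v_uhat_cross_null P.bdd_in_prob_const)
  fix n :: nat and \<omega> assume "n \<ge> 1"
  \<comment> \<open>With \<open>p = (p - q) + q\<close> every term of the difference keeps a factor
    \<open>p - q\<close>: the square is covered by \<open>uhat_v_null\<close>, the two mixed terms
    by \<open>v_uhat_cross_null\<close>.\<close>
  have le: "\<bar>(p \<bullet> x) * (p \<bullet> y) - (q \<bullet> x) * (q \<bullet> y)\<bar> \<le> ((norm (p - q))\<^sup>2 + (norm q * norm (p - q)) * 2) * (norm x * norm y)" for p q :: "real^'m"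
  proof -
    have "(p \<bullet> x) * (p \<bullet> y) - (q \<bullet> x) * (q \<bullet> y) = ((p - q) \<bullet> x) * ((p - q) \<bullet> y) + ((p - q) \<bullet> x) * (q \<bullet> y) + (q \<bullet> x) * ((p - q) \<bullet> y)"
      by (simp add: inner_diff_left algebra_simps)
    also have "\<bar>\<dots>\<bar> \<le> \<bar>(p - q) \<bullet> x\<bar> * \<bar>(p - q) \<bullet> y\<bar> + \<bar>(p - q) \<bullet> x\<bar> * \<bar>q \<bullet> y\<bar> + \<bar>q \<bullet> x\<bar> * \<bar>(p - q) \<bullet> y\<bar>"
      unfolding abs_mult[symmetric] by linarith
    also have "\<dots> \<le> (norm (p - q) * norm x) * (norm (p - q) * norm y) + (norm (p - q) * norm x) * (norm q * norm y) + (norm q * norm x) * (norm (p - q) * norm y)"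
      by (intro add_mono mult_mono Cauchy_Schwarz_ineq2) auto
    also have "\<dots> = ((norm (p - q))\<^sup>2 + (norm q * norm (p - q)) * 2) * (norm x * norm y)"
      by (simp add: power2_eq_square algebra_simps)
    finally show ?thesis .
  qed
  have "norm (avg n (\<lambda>j. (U n \<omega> j \<bullet> x) * (U n \<omega> j \<bullet> y)) - avg n (\<lambda>j. (v (Z j \<omega>) \<bullet> x) * (v (Z j \<omega>) \<bullet> y)))
      = norm (avg n (\<lambda>j. (U n \<omega> j \<bullet> x) * (U n \<omega> j \<bullet> y) - (v (Z j \<omega>) \<bullet> x) * (v (Z j \<omega>) \<bullet> y)))"
    by (simp only: sum_subtractf scaleR_diff_right)
  also have "\<dots> \<le> avg n (\<lambda>j. ((?d n \<omega> j)\<^sup>2 + (norm (v (Z j \<omega>)) * ?d n \<omega> j) * 2) * (norm x * norm y))"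
    unfolding real_norm_def[symmetric] by (rule norm_avg_le) (simp only: real_norm_def le)
  also have "\<dots> = ?Y n \<omega>"
  proof -
    have "avg n (\<lambda>j. (A j + B j * 2) * k) = (avg n A + avg n B * 2) * k" for A B and k :: real
      by (simp add: sum.distrib sum_distrib_right[symmetric] add_divide_distrib distrib_right)
    then show ?thesis .
  qed
  also have "\<dots> \<le> norm (?Y n \<omega>)" unfolding real_norm_def by (rule abs_ge_self)
  finally show "norm (avg n (\<lambda>j. (U n \<omega> j \<bullet> x) * (U n \<omega> j \<bullet> y)) - avg n (\<lambda>j. (v (Z j \<omega>) \<bullet> x) * (v (Z j \<omega>) \<bullet> y))) \<le> norm (?Y n \<omega>)" .
qed

text \<open>The multiplier equation brings in the limit \<open>W\<close> of (ii), whereas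
  \<open>\<phi>\<close> is built from \<open>V\<close>. Both give limits in probability of the same
  empirical bilinear forms, and a constant that is o_p(1) is zero.\<close>

lemma W_eq_V: "W = V"
proof (rule matrix_eq_inner)
  fix x y
  let ?Wh = "\<lambda>n \<omega>. avg n (\<lambda>j. outer (U n \<omega> j) (U n \<omega> j))"
  let ?au = "\<lambda>n \<omega>. avg n (\<lambda>j. (U n \<omega> j \<bullet> x) * (U n \<omega> j \<bullet> y))"
  let ?av = "\<lambda>n \<omega>. avg n (\<lambda>j. (v (Z j \<omega>) \<bullet> x) * (v (Z j \<omega>) \<bullet> y))"
  have au: "(?Wh n \<omega> *v x) \<bullet> y = ?au n \<omega>" for n \<omega>
    by (simp only: avg_outer_mult_vec inner_sum_left inner_scaleR_left real_scaleR_def)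
  have "null_in_prob P (\<lambda>n \<omega>. onorm (\<lambda>x. (?Wh n \<omega> - W) *v x) * (norm x * norm y))"
    by (intro P.null_in_prob_mult uhat_second_moment P.bdd_in_prob_const)
  then have 1: "null_in_prob P (\<lambda>n \<omega>. (W *v x) \<bullet> y - ?au n \<omega>)"
  proof (rule P.null_in_prob_le)
    fix n :: nat and \<omega>
    have "norm ((W *v x) \<bullet> y - ?au n \<omega>) = \<bar>((?Wh n \<omega> - W) *v x) \<bullet> y\<bar>"
      unfolding au[symmetric] by (simp only: matrix_vector_mult_diff_rdistrib inner_diff_left real_norm_def abs_minus_commute)
    also have "\<dots> \<le> norm ((?Wh n \<omega> - W) *v x) * norm y" by (rule Cauchy_Schwarz_ineq2)
    also have "\<dots> \<le> (onorm (\<lambda>x. (?Wh n \<omega> - W) *v x) * norm x) * norm y"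
      by (intro mult_right_mono onorm_mult_vec) simp
    also have "\<dots> \<le> norm (onorm (\<lambda>x. (?Wh n \<omega> - W) *v x) * (norm x * norm y))" by (simp only: mult.assoc real_norm_def abs_ge_self)
    finally show "norm ((W *v x) \<bullet> y - ?au n \<omega>) \<le> norm (onorm (\<lambda>x. (?Wh n \<omega> - W) *v x) * (norm x * norm y))" .
  qed
  have 2: "null_in_prob P (\<lambda>n \<omega>. ?au n \<omega> - ?av n \<omega>)" by (rule uhat_v_bilinear_null)
  have "integrable Q (\<lambda>z. (v z \<bullet> x) * (v z \<bullet> y))"
    by (intro integrable_mult_L2 integrable_inner_L2 v_L2) measurable
  from weak_law[OF this]
  have 3: "null_in_prob P (\<lambda>n \<omega>. ?av n \<omega> - (V *v x) \<bullet> y)" unfolding V_inner .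
  have "null_in_prob P (\<lambda>n \<omega>. ((W *v x) \<bullet> y - ?au n \<omega>) + ((?au n \<omega> - ?av n \<omega>) + (?av n \<omega> - (V *v x) \<bullet> y)))"
    by (intro P.null_in_prob_add 1 2 3)
  then have "null_in_prob P (\<lambda>n \<omega>. (W *v x) \<bullet> y - (V *v x) \<bullet> y)" by (simp only: diff_add_cancel add_diff_eq)
  then show "(W *v x) \<bullet> y = (V *v x) \<bullet> y" using P.null_in_prob_const by fastforce
qed

text \<open>Condition (iii) centres at expectations that involve \<open>uhat\<close>. Their average
  tends to \<open>C\<close>, since \<open>\<psi>\<close> times \<open>uhat - v\<close> is small in
  L1 by \<open>cross_moment\<close>.\<close>

lemma psi_uhat_null: "null_in_prob P (\<lambda>n \<omega>. avg n (\<lambda>j. outer (\<psi> (Z j \<omega>)) (U n \<omega> j)) - C)"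
proof -
  let ?E = "\<lambda>n j. integral\<^sup>L P (\<lambda>\<omega>. outer (\<psi> (Z j \<omega>)) (U n \<omega> j))"
  let ?b = "\<lambda>n. ennreal (1 / real n) * (\<Sum>j\<in>{1..n}. \<integral>\<^sup>+\<omega>. ennreal (norm (U n \<omega> j - v (Z j \<omega>)) ^ 2) \<partial>P)"
  let ?c = "\<lambda>n. ennreal (1 / real n) * (\<Sum>j\<in>{1..n}. \<integral>\<^sup>+\<omega>. ennreal (norm (\<psi> (Z j \<omega>)) * norm (U n \<omega> j - v (Z j \<omega>))) \<partial>P)"
  have "\<forall>\<^sub>F n in sequentially. ?b n < 1" using uhat_v_L2 by (intro order_tendstoD) auto
  then have "\<forall>\<^sub>F n in sequentially. ennreal (norm (avg n (?E n) - C)) \<le> ?c n"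
    using eventually_ge_at_top[of 1]
  proof eventually_elim
    case (elim n)
    \<comment> \<open>An average below \<open>1\<close> has finite terms. So \<open>uhat - v\<close>
      is square integrable for this \<open>n\<close> and the expectation splits; the Bochner
      integral of a non-integrable function would be \<open>0\<close> by default.\<close>
    have fin: "(\<integral>\<^sup>+\<omega>. ennreal (norm (U n \<omega> j - v (Z j \<omega>)) ^ 2) \<partial>P) < \<infinity>" if j: "j \<in> {1..n}" for j
    proof (rule ccontr)
      assume "\<not> ?thesis"
      then have S: "(\<Sum>j\<in>{1..n}. \<integral>\<^sup>+\<omega>. ennreal (norm (U n \<omega> j - v (Z j \<omega>)) ^ 2) \<partial>P) = \<infinity>"
        using j by (auto simp: not_less top_unique)
      have "?b n = \<infinity>" unfolding S using elim(2) by (simp add: ennreal_mult_top)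
      then show False using elim(1) by simp
    qed
    have term_le: "ennreal (norm (?E n j - C)) \<le> (\<integral>\<^sup>+\<omega>. ennreal (norm (\<psi> (Z j \<omega>)) * norm (U n \<omega> j - v (Z j \<omega>))) \<partial>P)"
      if j: "j \<in> {1..n}" for j
    proof -
      have p2: "integrable P (\<lambda>\<omega>. (norm (\<psi> (Z j \<omega>)))\<^sup>2)" using \<psi>_L2 integrable_Z_iff[of "\<lambda>z. (norm (\<psi> z))\<^sup>2" j] by simp
      have d2: "integrable P (\<lambda>\<omega>. (norm (U n \<omega> j - v (Z j \<omega>)))\<^sup>2)" using fin[OF j] by (intro integrableI_nonneg) auto
      have i1: "integrable P (\<lambda>\<omega>. outer (\<psi> (Z j \<omega>)) (U n \<omega> j - v (Z j \<omega>)))"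
        by (rule integrable_outer[OF _ _ p2 d2]) measurable
      have i0: "integrable Q (\<lambda>z. outer (\<psi> z) (v z))" by (rule integrable_outer[OF _ _ \<psi>_L2 v_L2]) measurable
      then have i2: "integrable P (\<lambda>\<omega>. outer (\<psi> (Z j \<omega>)) (v (Z j \<omega>)))" by (subst integrable_Z_iff) auto
      have e2: "(LINT \<omega>|P. outer (\<psi> (Z j \<omega>)) (v (Z j \<omega>))) = C"
        unfolding C_def by (rule integral_Z) measurable
      have "?E n j = (LINT \<omega>|P. outer (\<psi> (Z j \<omega>)) (U n \<omega> j - v (Z j \<omega>)) + outer (\<psi> (Z j \<omega>)) (v (Z j \<omega>)))"
        by (simp add: outer_diff_right)
      also have "\<dots> = (LINT \<omega>|P. outer (\<psi> (Z j \<omega>)) (U n \<omega> j - v (Z j \<omega>))) + C"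
        using i1 i2 e2 by simp
      finally have "norm (?E n j - C) = norm (LINT \<omega>|P. outer (\<psi> (Z j \<omega>)) (U n \<omega> j - v (Z j \<omega>)))" by simp
      then show ?thesis using integral_norm_bound_ennreal[OF i1] by (simp add: norm_outer)
    qed
    have "avg n (?E n) - C = avg n (\<lambda>j. ?E n j - C)"
      using elim(2) by (simp add: sum_subtractf scaleR_diff_right sum_constant_scaleR del: sum_constant)
    also have "norm \<dots> \<le> avg n (\<lambda>j. norm (?E n j - C))" by (rule norm_avg_le) simp
    finally have "ennreal (norm (avg n (?E n) - C)) \<le> ennreal (1 / real n * (\<Sum>j\<in>{1..n}. norm (?E n j - C)))"
      by (intro ennreal_leI) simp
    also have "\<dots> = ennreal (1 / real n) * (\<Sum>j\<in>{1..n}. ennreal (norm (?E n j - C)))"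
      by (subst ennreal_mult') simp_all
    also have "\<dots> \<le> ?c n" by (intro mult_left_mono sum_mono term_le) auto
    finally show ?case .
  qed
  then have "(\<lambda>n. ennreal (norm (avg n (?E n) - C))) \<longlonglongrightarrow> 0"
    by (rule tendsto_sandwich[OF _ _ tendsto_const cross_moment[OF \<psi>_meas \<psi>_L2], rotated]) simp
  then have "(\<lambda>n. norm (avg n (?E n) - C)) \<longlonglongrightarrow> 0"
    using tendsto_ennreal_iff[of "\<lambda>n. norm (avg n (?E n) - C)" sequentially 0] by simp
  then have "(\<lambda>n. avg n (?E n) - C) \<longlonglongrightarrow> 0" by (rule tendsto_norm_zero_cancel)
  from P.null_in_prob_add[OF \<psi>_uhat_moment P.null_in_prob_tendsto[OF this]]
  show ?thesis by (simp add: sum_subtractf scaleR_diff_right)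
qed


section \<open>Existence, uniqueness and size of the multiplier\<close>

abbreviation (input) mx :: "nat \<Rightarrow> 'w \<Rightarrow> real" where "mx n \<omega> \<equiv> Max ((\<lambda>j. norm (U n \<omega> j)) ` {1..n})"
abbreviation (input) dW :: "nat \<Rightarrow> 'w \<Rightarrow> real" where
  "dW n \<omega> \<equiv> onorm (\<lambda>x. (avg n (\<lambda>j. outer (U n \<omega> j) (U n \<omega> j)) - V) *v x)"

definition good :: "nat \<Rightarrow> 'w \<Rightarrow> real^'m \<Rightarrow> bool" where
  "good n \<omega> z \<longleftrightarrow> (\<forall>j\<in>{1..n}. 1 + U n \<omega> j \<bullet> z > 0) \<and> avg n (\<lambda>j. (1 / (1 + U n \<omega> j \<bullet> z)) *\<^sub>R U n \<omega> j) = 0"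

text \<open>\<open>mu\<close>, \<open>alpha\<close> and \<open>rho\<close> are scaled to be o_p(1),
  O_p(1) and o_p(1). For \<open>n \<ge> 1\<close> the powers of \<open>n\<close> cancel in
  \<open>mu n \<omega> * alpha n \<omega>\<close>, the largest norm times the norm of the
  mean.\<close>

definition mu :: "nat \<Rightarrow> 'w \<Rightarrow> real" where "mu n \<omega> = mx n \<omega> / sqrt n"
definition alpha :: "nat \<Rightarrow> 'w \<Rightarrow> real" where "alpha n \<omega> = sqrt n * norm (avg n (U n \<omega>))"
definition rho :: "nat \<Rightarrow> 'w \<Rightarrow> real" where
  "rho n \<omega> = sqrt n * norm (avg n (U n \<omega>) - avg n (\<lambda>j. v (Z j \<omega>)))"

lemma mu_null: "null_in_prob P mu"
proof -
  have "null_in_prob P (\<lambda>n \<omega>. norm (mx n \<omega>) / sqrt n)"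
    using uhat_max by (subst (asm) P.op_small_scale) auto
  then show ?thesis by (rule P.null_in_prob_le) (simp add: mu_def)
qed

lemma rho_null: "null_in_prob P rho"
proof -
  have "null_in_prob P (\<lambda>n \<omega>. norm (avg n (U n \<omega>) - avg n (\<lambda>j. v (Z j \<omega>))) / (1 / sqrt n))"
    using uhat_v_mean by (subst (asm) P.op_small_scale) auto
  then show ?thesis by (rule P.null_in_prob_le) (simp add: rho_def mult.commute)
qed

lemma dW_null: "null_in_prob P dW"
  using uhat_second_moment unfolding W_eq_V .

text \<open>By (v) the mean of \<open>uhat\<close> may be replaced by that of \<open>v\<close>, and
  the scaled sum of \<open>v\<close> has bounded second moment.\<close>

lemma alpha_bdd: "bdd_in_prob P alpha"
proof (rule P.bdd_in_prob_le)
  show "bdd_in_prob P (\<lambda>n \<omega>. rho n \<omega> + norm ((1 / sqrt n) *\<^sub>R (\<Sum>j\<in>{1..n}. v (Z j \<omega>))))"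
    by (intro P.bdd_in_prob_add P.null_imp_bdd_in_prob rho_null scaled_sum_bdd_in_prob v_meas v_L2 v_mean)
  fix n :: nat and \<omega> assume n: "n \<ge> 1"
  have sv: "sqrt n * norm (avg n (\<lambda>j. v (Z j \<omega>))) = norm ((1 / sqrt n) *\<^sub>R (\<Sum>j\<in>{1..n}. v (Z j \<omega>)))"
  proof -
    have "sqrt n / n = 1 / sqrt n" using n by (simp add: real_div_sqrt divide_simps)
    then show ?thesis by (simp add: divide_inverse)
  qed
  have "norm (avg n (U n \<omega>)) \<le> norm (avg n (U n \<omega>) - avg n (\<lambda>j. v (Z j \<omega>))) + norm (avg n (\<lambda>j. v (Z j \<omega>)))"
    by (metis norm_triangle_sub add.commute)
  then have "alpha n \<omega> \<le> rho n \<omega> + sqrt n * norm (avg n (\<lambda>j. v (Z j \<omega>)))"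
    unfolding alpha_def rho_def distrib_left[symmetric] by (rule mult_left_mono) simp
  moreover have "alpha n \<omega> \<ge> 0" by (simp add: alpha_def)
  ultimately show "\<bar>alpha n \<omega>\<bar> \<le> \<bar>rho n \<omega> + norm ((1 / sqrt n) *\<^sub>R (\<Sum>j\<in>{1..n}. v (Z j \<omega>)))\<bar>"
    unfolding sv by linarith
qed

lemma V_posdef: "x \<noteq> 0 \<Longrightarrow> x \<bullet> (V *v x) > 0"
  by (rule second_moment_posdef[OF v_meas v_L2 V_inner]) (use v_nonsing in \<open>simp_all add: V_def\<close>)

text \<open>Half of a lower bound for the form of \<open>V\<close>: an empirical matrix within
  operator distance \<open>lam\<close> of \<open>V\<close> then still has the lower bound
  \<open>lam\<close>.\<close>

definition lam :: real where "lam = (SOME l. l > 0 \<and> (\<forall>x. l * (norm x)\<^sup>2 \<le> x \<bullet> (V *v x))) / 2"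

lemma lam: "lam > 0" "2 * lam * (norm x)\<^sup>2 \<le> x \<bullet> (V *v x)"
proof -
  have "\<exists>l. l > 0 \<and> (\<forall>x. l * (norm x)\<^sup>2 \<le> x \<bullet> (V *v x))"
    using posdef_lower_bound[of V] V_posdef by blast
  from someI_ex[OF this] show "lam > 0" "2 * lam * (norm x)\<^sup>2 \<le> x \<bullet> (V *v x)"
    by (auto simp: lam_def)
qed

text \<open>The first inequality supplies the premise \<open>quad\<close> of
  \<open>weighted_root_exists\<close>, the second is its premise \<open>small\<close>.\<close>

definition well_behaved :: "nat \<Rightarrow> 'w \<Rightarrow> bool" where
  "well_behaved n \<omega> \<longleftrightarrow> dW n \<omega> \<le> lam \<and> mu n \<omega> * alpha n \<omega> \<le> lam / 4"

lemma wptto_well_behaved: "wptto P well_behaved"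
proof -
  have "wptto P (\<lambda>n \<omega>. norm (dW n \<omega>) \<le> lam \<and> norm (mu n \<omega> * alpha n \<omega>) \<le> lam / 4)"
    using lam(1) by (intro P.wptto_conj P.null_in_probD P.null_in_prob_mult dW_null mu_null alpha_bdd) auto
  then show ?thesis
    by (rule wptto_mono) (auto simp: well_behaved_def abs_le_iff intro!: always_eventually)
qed

text \<open>The bounds in the second claim are proved for the constructed root, and uniqueness
  transfers them to every \<open>z\<close> with \<open>good n \<omega> z\<close>. At
  \<open>n = 0\<close> every vector is good, hence \<open>n \<ge> 1\<close>.\<close>

lemma well_behaved_root:
  assumes n: "n \<ge> 1" and wb: "well_behaved n \<omega>"
  shows "\<exists>!z. good n \<omega> z"
    and "good n \<omega> z \<Longrightarrow> norm z \<le> 2 / lam * norm (avg n (U n \<omega>)) \<and> (\<forall>j\<in>{1..n}. 1 + U n \<omega> j \<bullet> z \<ge> 1 / 2)"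
proof -
  have n0: "1 / real n > 0" using n by simp
  have fin: "finite {1..n}" by simp
  have M: "norm (U n \<omega> j) \<le> mx n \<omega>" if "j \<in> {1..n}" for j using that by (intro Max_ge) auto
  have M0: "0 \<le> mx n \<omega>" by (rule order_trans[OF norm_ge_zero M[of 1]]) (use n in simp)
  have quad: "lam * (norm x)\<^sup>2 \<le> (1 / real n) * (\<Sum>j\<in>{1..n}. (U n \<omega> j \<bullet> x)\<^sup>2)" for x
  proof -
    let ?Wh = "avg n (\<lambda>j. outer (U n \<omega> j) (U n \<omega> j))"
    have "x \<bullet> ((?Wh - V) *v x) \<ge> - (norm x * norm ((?Wh - V) *v x))"
      using Cauchy_Schwarz_ineq2[of x "(?Wh - V) *v x"] by linarith
    moreover have "norm x * norm ((?Wh - V) *v x) \<le> norm x * (dW n \<omega> * norm x)"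
      by (intro mult_left_mono onorm_mult_vec) simp
    moreover have "norm x * (dW n \<omega> * norm x) \<le> lam * (norm x)\<^sup>2"
      using wb mult_right_mono[of "dW n \<omega>" lam "(norm x)\<^sup>2"] by (simp add: well_behaved_def power2_eq_square mult_ac)
    moreover have "x \<bullet> (?Wh *v x) = x \<bullet> ((?Wh - V) *v x) + x \<bullet> (V *v x)"
      by (simp add: matrix_vector_mult_diff_rdistrib inner_diff_right)
    moreover have "x \<bullet> (?Wh *v x) = (1 / real n) * (\<Sum>j\<in>{1..n}. (U n \<omega> j \<bullet> x)\<^sup>2)"
      by (simp add: avg_outer_mult_vec inner_sum_right power2_eq_square inner_commute del: One_nat_def)
    ultimately show ?thesis using lam(2)[of x] by linarith
  qed
  have ma: "mu n \<omega> * alpha n \<omega> = mx n \<omega> * norm (avg n (U n \<omega>))" using n by (simp add: mu_def alpha_def)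
  have small: "4 * mx n \<omega> * norm (avg n (U n \<omega>)) \<le> lam" using wb unfolding well_behaved_def ma by linarith
  obtain x where x: "norm x \<le> 2 * norm (avg n (U n \<omega>)) / lam" "\<forall>j\<in>{1..n}. 1 + U n \<omega> j \<bullet> x \<ge> 1 / 2"
      "(\<Sum>j\<in>{1..n}. (1 / (1 + U n \<omega> j \<bullet> x)) *\<^sub>R U n \<omega> j) = 0"
    using weighted_root_exists[OF lam(1) n0 quad M M0 small] by blast
  have gx: "good n \<omega> x" unfolding good_def using x by force
  have uniq: "z = x" if "good n \<omega> z" for z
  proof (rule weighted_root_unique[OF fin lam(1) n0 quad])
    show "(\<Sum>j\<in>{1..n}. (1 / (1 + U n \<omega> j \<bullet> z)) *\<^sub>R U n \<omega> j) = 0" "\<forall>j\<in>{1..n}. 1 + U n \<omega> j \<bullet> z > 0"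
      using that n0 unfolding good_def by auto
    show "(\<Sum>j\<in>{1..n}. (1 / (1 + U n \<omega> j \<bullet> x)) *\<^sub>R U n \<omega> j) = 0" by fact
    show "\<forall>j\<in>{1..n}. 1 + U n \<omega> j \<bullet> x > 0" using gx unfolding good_def by blast
  qed
  show "\<exists>!z. good n \<omega> z" using gx uniq by blast
  assume "good n \<omega> z"
  then have "z = x" by (rule uniq)
  then show "norm z \<le> 2 / lam * norm (avg n (U n \<omega>)) \<and> (\<forall>j\<in>{1..n}. 1 + U n \<omega> j \<bullet> z \<ge> 1 / 2)"
    using x by (simp add: mult.commute[of lam])
qed

lemma wptto_unique_root: "wptto P (\<lambda>n \<omega>. \<exists>!z. good n \<omega> z)"
  by (rule wptto_mono[OF wptto_well_behaved])
     (auto intro!: eventually_sequentiallyI[of 1] well_behaved_root(1))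


section \<open>The remainder of the linearization\<close>

lemma psi_square_bdd: "bdd_in_prob P (\<lambda>n \<omega>. avg n (\<lambda>j. (norm (\<psi> (Z j \<omega>)))\<^sup>2))"
proof (rule P.bdd_in_prob_L1)
  let ?G = "LINT z|Q. (norm (\<psi> z))\<^sup>2"
  have G: "(\<integral>\<^sup>+\<omega>. ennreal ((norm (\<psi> (Z j \<omega>)))\<^sup>2) \<partial>P) = ennreal ?G" for j
    using \<psi>_L2 integrable_Z_iff[of "\<lambda>z. (norm (\<psi> z))\<^sup>2" j] integral_Z[of "\<lambda>z. (norm (\<psi> z))\<^sup>2" j]
    by (subst nn_integral_eq_integral) simp_all
  show "\<forall>\<^sub>F n in sequentially. (\<integral>\<^sup>+\<omega>. ennreal \<bar>avg n (\<lambda>j. (norm (\<psi> (Z j \<omega>)))\<^sup>2)\<bar> \<partial>P) \<le> ennreal ?G"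
  proof (rule eventually_sequentiallyI[of 1])
    fix n :: nat assume "1 \<le> n"
    have "(\<integral>\<^sup>+\<omega>. ennreal \<bar>avg n (\<lambda>j. (norm (\<psi> (Z j \<omega>)))\<^sup>2)\<bar> \<partial>P) = ennreal (1 / real n) * (\<Sum>j\<in>{1..n}. \<integral>\<^sup>+\<omega>. ennreal ((norm (\<psi> (Z j \<omega>)))\<^sup>2) \<partial>P)"
      by (rule nn_integral_avg) simp_all
    also have "\<dots> = ennreal (1 / real n) * (\<Sum>j\<in>{1..n}. ennreal ?G)" by (simp only: G)
    also have "\<dots> = ennreal ?G"
      using \<open>1 \<le> n\<close> by (simp add: ennreal_of_nat_eq_real_of_nat mult.assoc[symmetric] flip: ennreal_mult')
    finally show "(\<integral>\<^sup>+\<omega>. ennreal \<bar>avg n (\<lambda>j. (norm (\<psi> (Z j \<omega>)))\<^sup>2)\<bar> \<partial>P) \<le> ennreal ?G" by simp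
  qed
qed simp_all

text \<open>This is \<open>sqrt n\<close> times the bound of \<open>el_expansion\<close>, with
  \<open>t\<close> as the bound for \<open>sqrt n * norm z\<close>. In every product the factor that
  is o_p(1) stands first and the bounded ones follow, the form in which
  \<open>null_in_prob_mult\<close> applies.\<close>

definition remainder_bound :: "nat \<Rightarrow> 'w \<Rightarrow> real" where
  "remainder_bound n \<omega> =
    (let t = alpha n \<omega> * (2 / lam); K = onorm (\<lambda>x. V *v x) in
      norm (avg n (\<lambda>j. outer (\<psi> (Z j \<omega>)) (U n \<omega> j)) - C) * t
      + (dW n \<omega> * t + rho n \<omega> + mu n \<omega> * ((dW n \<omega> + K) * (t * t)) * 2) * norm (C ** matrix_inv V)
      + mu n \<omega> * ((t * t) * (dW n \<omega> + K + avg n (\<lambda>j. (norm (\<psi> (Z j \<omega>)))\<^sup>2))))"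

lemma remainder_bound_null: "null_in_prob P remainder_bound"
proof -
  have 1: "null_in_prob P (\<lambda>n \<omega>. norm (avg n (\<lambda>j. outer (\<psi> (Z j \<omega>)) (U n \<omega> j)) - C))"
    using psi_uhat_null by (rule P.null_in_prob_le) simp
  note bdd = P.null_imp_bdd_in_prob[OF dW_null] alpha_bdd psi_square_bdd P.bdd_in_prob_const P.bdd_in_prob_add P.bdd_in_prob_mult
  show ?thesis
    unfolding remainder_bound_def Let_def
    by (intro P.null_in_prob_add P.null_in_prob_mult[OF _ P.bdd_in_prob_const] P.null_in_prob_mult 1 dW_null mu_null rho_null bdd)
qed

lemma avg_phi: "avg n (\<lambda>j. \<phi> (Z j \<omega>)) = (C ** matrix_inv V) *v avg n (\<lambda>j. v (Z j \<omega>))"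
  unfolding \<phi>_def by (simp only: linear_sum[OF matrix_vector_mul_linear] matrix_vector_mult_scaleR)

lemma well_behaved_expansion:
  assumes n: "n \<ge> 1" and wb: "well_behaved n \<omega>" and z: "good n \<omega> z"
  shows "sqrt n * norm (avg n (\<lambda>j. (1 / (1 + U n \<omega> j \<bullet> z)) *\<^sub>R \<psi> (Z j \<omega>))
      - (avg n (\<lambda>j. \<psi> (Z j \<omega>)) - avg n (\<lambda>j. \<phi> (Z j \<omega>)))) \<le> remainder_bound n \<omega>"
proof -
  note root = well_behaved_root(2)[OF n wb z]
  have M: "norm (U n \<omega> j) \<le> mx n \<omega>" if "j \<in> {1..n}" for j using that by (intro Max_ge) auto
  define K where "K = onorm (\<lambda>x. V *v x)"
  define q where "q = avg n (\<lambda>j. (norm (\<psi> (Z j \<omega>)))\<^sup>2)"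
  define c where "c = norm (avg n (\<lambda>j. outer (\<psi> (Z j \<omega>)) (U n \<omega> j)) - C)"
  define b where "b = norm (C ** matrix_inv V)"
  define t where "t = alpha n \<omega> * (2 / lam)"
  define s where "s = sqrt n"
  define D where "D = dW n \<omega>"
  define m where "m = mu n \<omega>"
  have s: "s > 0" "s * s = n" using n by (simp_all add: s_def)
  have mx: "mx n \<omega> = m * s" using s(1) by (simp add: m_def mu_def s_def)
  have m0: "m \<ge> 0"
    unfolding m_def mu_def by (rule divide_nonneg_nonneg, rule order_trans[OF norm_ge_zero M[of 1]]) (use n in simp_all)
  have D0: "D \<ge> 0" unfolding D_def by (rule onorm_pos_le[OF matrix_vector_mul_bounded_linear])
  have K0: "K \<ge> 0" unfolding K_def by (rule onorm_pos_le[OF matrix_vector_mul_bounded_linear])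
  have q0: "q \<ge> 0" unfolding q_def by (simp add: sum_nonneg)
  have sz: "s * norm z \<le> t" "0 \<le> s * norm z"
    using mult_left_mono[OF conjunct1[OF root], of s] s(1) by (simp_all add: t_def alpha_def s_def mult_ac)
  have sz2: "(s * norm z) * (s * norm z) \<le> t * t" using sz by (intro mult_mono) auto
  have "norm (avg n (\<lambda>j. (1 / (1 + U n \<omega> j \<bullet> z)) *\<^sub>R \<psi> (Z j \<omega>)) - (avg n (\<lambda>j. \<psi> (Z j \<omega>)) - avg n (\<lambda>j. \<phi> (Z j \<omega>))))
    \<le> c * norm z + b * (D * norm z + norm (avg n (U n \<omega>) - avg n (\<lambda>j. v (Z j \<omega>))) + 2 * (m * s) * ((D + K) * (norm z)\<^sup>2))
      + (m * s) * ((norm z)\<^sup>2 * (D + K + q))"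
    unfolding avg_phi c_def b_def D_def K_def q_def mx[symmetric]
    using root z n v_nonsing M by (intro el_expansion) (auto simp: good_def V_def)
  then have "s * norm (avg n (\<lambda>j. (1 / (1 + U n \<omega> j \<bullet> z)) *\<^sub>R \<psi> (Z j \<omega>)) - (avg n (\<lambda>j. \<psi> (Z j \<omega>)) - avg n (\<lambda>j. \<phi> (Z j \<omega>))))
    \<le> s * (c * norm z + b * (D * norm z + norm (avg n (U n \<omega>) - avg n (\<lambda>j. v (Z j \<omega>))) + 2 * (m * s) * ((D + K) * (norm z)\<^sup>2))
      + (m * s) * ((norm z)\<^sup>2 * (D + K + q)))"
    using s(1) by (intro mult_left_mono) auto
  \<comment> \<open>As \<open>mx n \<omega> = m * s\<close>, the outer factor \<open>s\<close> and
    the one from the maximum combine with \<open>(norm z)\<^sup>2\<close> to the square of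
    \<open>s * norm z\<close>, and no power of \<open>n\<close> remains.\<close>
  also have "\<dots> = c * (s * norm z) + (D * (s * norm z) + rho n \<omega> + m * ((D + K) * ((s * norm z) * (s * norm z))) * 2) * b
      + m * (((s * norm z) * (s * norm z)) * (D + K + q))"
    unfolding rho_def s_def[symmetric] by (simp add: power2_eq_square algebra_simps)
  also have "\<dots> \<le> c * t + (D * t + rho n \<omega> + m * ((D + K) * (t * t)) * 2) * b + m * ((t * t) * (D + K + q))"
    using sz sz2 D0 K0 q0 m0 by (intro add_mono mult_right_mono mult_left_mono order_refl) (auto simp: c_def b_def)
  finally show ?thesis
    unfolding remainder_bound_def Let_def c_def b_def D_def K_def q_def t_def m_def s_def .
qed

text \<open>\<open>zhat\<close> is any selection that takes the root where it is unique. Its values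
  elsewhere are arbitrary, so the remainder bound is used only on
  \<open>well_behaved\<close>.\<close>

lemma estimator_expansion:
  assumes "\<forall>n. \<forall>\<omega>\<in>space P. (\<exists>!z. good n \<omega> z) \<longrightarrow> good n \<omega> (zhat n \<omega>)"
  shows "op_small P (\<lambda>n \<omega>. avg n (\<lambda>j. (1 / (1 + U n \<omega> j \<bullet> zhat n \<omega>)) *\<^sub>R \<psi> (Z j \<omega>))
      - (avg n (\<lambda>j. \<psi> (Z j \<omega>)) - avg n (\<lambda>j. \<phi> (Z j \<omega>)))) (\<lambda>n. 1 / sqrt (real n))"
proof (subst P.op_small_scale)
  let ?X = "\<lambda>n \<omega>. avg n (\<lambda>j. (1 / (1 + U n \<omega> j \<bullet> zhat n \<omega>)) *\<^sub>R \<psi> (Z j \<omega>))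
      - (avg n (\<lambda>j. \<psi> (Z j \<omega>)) - avg n (\<lambda>j. \<phi> (Z j \<omega>)))"
  show "null_in_prob P (\<lambda>n \<omega>. norm (?X n \<omega>) / (1 / sqrt (real n)))"
  proof (rule P.null_in_prob_dominated[OF wptto_well_behaved remainder_bound_null])
    show "\<forall>\<^sub>F n in sequentially. \<forall>\<omega>\<in>space P. well_behaved n \<omega> \<longrightarrow> norm (norm (?X n \<omega>) / (1 / sqrt (real n))) \<le> norm (remainder_bound n \<omega>)"
    proof (intro eventually_sequentiallyI[of 1] ballI impI)
      fix n \<omega> assume n: "1 \<le> n" and w: "\<omega> \<in> space P" and wb: "well_behaved n \<omega>"
      then have "good n \<omega> (zhat n \<omega>)" using assms well_behaved_root(1)[OF n wb] by blast
      from well_behaved_expansion[OF n wb this]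
      have le: "sqrt n * norm (?X n \<omega>) \<le> remainder_bound n \<omega>" .
      have "norm (norm (?X n \<omega>) / (1 / sqrt (real n))) = sqrt n * norm (?X n \<omega>)" by simp
      also note le
      also have "remainder_bound n \<omega> \<le> norm (remainder_bound n \<omega>)" by simp
      finally show "norm (norm (?X n \<omega>) / (1 / sqrt (real n))) \<le> norm (remainder_bound n \<omega>)" .
    qed
  qed
qed simp


end

section \<open>The limit distribution\<close>

context el_setting begin

definition influence :: "'z \<Rightarrow> real^'r" where "influence z = \<psi> z - integral\<^sup>L Q \<psi> - \<phi> z"

lemma phi_meas [measurable]: "\<phi> \<in> borel_measurable Q"
proof -
  have "(*v) (C ** matrix_inv V) \<in> borel_measurable borel"
    by (intro borel_measurable_continuous_onI linear_continuous_on matrix_vector_mul_bounded_linear)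
  then show ?thesis unfolding \<phi>_def by (rule measurable_compose[OF v_meas])
qed

lemma influence_meas [measurable]: "influence \<in> borel_measurable Q"
  unfolding influence_def by measurable

lemma phi_L2: "integrable Q (\<lambda>z. (norm (\<phi> z))\<^sup>2)"
proof (rule Bochner_Integration.integrable_bound)
  show "integrable Q (\<lambda>z. (norm (C ** matrix_inv V))\<^sup>2 * (norm (v z))\<^sup>2)" using v_L2 by simp
  show "AE z in Q. norm ((norm (\<phi> z))\<^sup>2) \<le> norm ((norm (C ** matrix_inv V))\<^sup>2 * (norm (v z))\<^sup>2)"
    using norm_mult_vec_le[of "C ** matrix_inv V"]
    by (intro AE_I2) (simp add: \<phi>_def power_mult_distrib[symmetric] power_mono)
qed simp

lemma integrable_of_L2:
  fixes f :: "'z \<Rightarrow> real^'k"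
  assumes "f \<in> borel_measurable Q" "integrable Q (\<lambda>z. (norm (f z))\<^sup>2)"
  shows "integrable Q f"
  using Q.square_integrable_imp_integrable[of "\<lambda>z. norm (f z)"] assms by (simp add: integrable_norm_iff)

lemma phi_mean: "integral\<^sup>L Q \<phi> = 0"
  unfolding \<phi>_def[abs_def]
  using integral_bounded_linear[OF matrix_vector_mul_bounded_linear integrable_of_L2[OF v_meas v_L2], of "C ** matrix_inv V"]
  by (simp add: v_mean)

lemma L2_diff:
  fixes f g :: "'z \<Rightarrow> real^'k"
  assumes [measurable]: "f \<in> borel_measurable Q" "g \<in> borel_measurable Q"
    and "integrable Q (\<lambda>z. (norm (f z))\<^sup>2)" "integrable Q (\<lambda>z. (norm (g z))\<^sup>2)"
  shows "integrable Q (\<lambda>z. (norm (f z - g z))\<^sup>2)"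
proof (rule Bochner_Integration.integrable_bound)
  show "integrable Q (\<lambda>z. 2 * (norm (f z))\<^sup>2 + 2 * (norm (g z))\<^sup>2)" using assms by simp
  have "(norm (x - y))\<^sup>2 \<le> 2 * (norm x)\<^sup>2 + 2 * (norm y)\<^sup>2" for x y :: "real^'k"
    using power_mono[OF norm_triangle_ineq4[of x y], of 2] sum_squares_bound[of "norm x" "norm y"]
    by (simp add: power2_sum)
  then show "AE z in Q. norm ((norm (f z - g z))\<^sup>2) \<le> norm (2 * (norm (f z))\<^sup>2 + 2 * (norm (g z))\<^sup>2)" by simp
qed simp

lemma centered_psi_L2: "integrable Q (\<lambda>z. (norm (\<psi> z - integral\<^sup>L Q \<psi>))\<^sup>2)"
  by (rule L2_diff[OF _ _ \<psi>_L2]) simp_all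

lemma influence_L2: "integrable Q (\<lambda>z. (norm (influence z))\<^sup>2)"
  unfolding influence_def by (rule L2_diff[OF _ _ centered_psi_L2 phi_L2]) simp_all

lemma influence_mean: "integral\<^sup>L Q influence = 0"
  unfolding influence_def[abs_def]
  using integrable_of_L2[OF \<psi>_meas \<psi>_L2] integrable_of_L2[OF phi_meas phi_L2] by (simp add: phi_mean Q.prob_space)

lemma covmat_inner:
  fixes f :: "'z \<Rightarrow> real^'k"
  assumes [measurable]: "f \<in> borel_measurable Q" and f2: "integrable Q (\<lambda>z. (norm (f z - integral\<^sup>L Q f))\<^sup>2)"
  shows "(covmat Q f *v x) \<bullet> y = (LINT z|Q. ((f z - integral\<^sup>L Q f) \<bullet> y) * ((f z - integral\<^sup>L Q f) \<bullet> x))"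
  unfolding covmat_def by (rule integral_outer_inner) (use f2 in simp_all)

text \<open>The projection property: the residual of \<open>\<psi>\<close> is orthogonal to the span
  of \<open>v\<close>, in which the components of \<open>\<phi>\<close> lie. It comes down to
  \<open>B ** V = C\<close>; centring \<open>\<psi>\<close> does not change the integral, as
  \<open>v\<close> has mean zero.\<close>

lemma phi_orthogonal:
  "(LINT z|Q. ((\<psi> z - integral\<^sup>L Q \<psi>) \<bullet> x) * (\<phi> z \<bullet> y)) = (LINT z|Q. (\<phi> z \<bullet> x) * (\<phi> z \<bullet> y))"
proof -
  define B where "B = C ** matrix_inv V"
  have phi: "\<phi> z \<bullet> w = v z \<bullet> (transpose B *v w)" for z w
    unfolding \<phi>_def B_def[symmetric] by (metis inner_commute inner_matrix_mult_right)
  have BV: "B ** V = C"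
    using v_nonsing unfolding B_def by (simp add: V_def matrix_inv_left flip: matrix_mul_assoc)
  let ?b = "transpose B *v y"
  have i1: "integrable Q (\<lambda>z. (\<psi> z \<bullet> x) * (v z \<bullet> ?b))"
    by (intro integrable_mult_L2 integrable_inner_L2 \<psi>_L2 v_L2) measurable
  have i2: "integrable Q (\<lambda>z. (integral\<^sup>L Q \<psi> \<bullet> x) * (v z \<bullet> ?b))"
    using integrable_of_L2[OF v_meas v_L2] by simp
  have "(LINT z|Q. ((\<psi> z - integral\<^sup>L Q \<psi>) \<bullet> x) * (\<phi> z \<bullet> y))
      = (LINT z|Q. (\<psi> z \<bullet> x) * (v z \<bullet> ?b) - (integral\<^sup>L Q \<psi> \<bullet> x) * (v z \<bullet> ?b))"
    by (simp add: phi inner_diff_left left_diff_distrib)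
  also have "\<dots> = (LINT z|Q. (\<psi> z \<bullet> x) * (v z \<bullet> ?b))"
    unfolding Bochner_Integration.integral_diff[OF i1 i2] using integrable_of_L2[OF v_meas v_L2] by (simp add: v_mean)
  also have "\<dots> = (C *v ?b) \<bullet> x"
    unfolding C_def by (rule integral_outer_inner[symmetric]) (use \<psi>_L2 v_L2 in simp_all)
  also have "\<dots> = (V *v ?b) \<bullet> (transpose B *v x)"
    unfolding BV[symmetric] by (metis inner_commute inner_matrix_mult_right matrix_vector_mul_assoc)
  also have "\<dots> = (LINT z|Q. (\<phi> z \<bullet> x) * (\<phi> z \<bullet> y))"
    unfolding V_inner phi by (simp add: mult.commute)
  finally show ?thesis .
qed

text \<open>By \<open>phi_orthogonal\<close> each of the two mixed terms equals the term in
  \<open>\<phi>\<close> alone, so that two subtractions and one addition leave a single subtraction.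
  The limit covariance is thus a second-moment matrix, and nonsingularity makes it positive
  definite.\<close>

lemma Sigma_inner: "((covmat Q \<psi> - covmat Q \<phi>) *v x) \<bullet> y = (LINT z|Q. (influence z \<bullet> x) * (influence z \<bullet> y))"
proof -
  let ?p = "\<lambda>z. \<psi> z - integral\<^sup>L Q \<psi>"
  have int: "integrable Q (\<lambda>z. (?p z \<bullet> x) * (?p z \<bullet> y))" "integrable Q (\<lambda>z. (?p z \<bullet> a) * (\<phi> z \<bullet> b))"
    "integrable Q (\<lambda>z. (\<phi> z \<bullet> a) * (\<phi> z \<bullet> b))" for a b
    by (intro integrable_mult_L2 integrable_inner_L2 centered_psi_L2 phi_L2; measurable)+
  have "(LINT z|Q. (influence z \<bullet> x) * (influence z \<bullet> y))
      = (LINT z|Q. (?p z \<bullet> x) * (?p z \<bullet> y) - (?p z \<bullet> x) * (\<phi> z \<bullet> y) - (?p z \<bullet> y) * (\<phi> z \<bullet> x) + (\<phi> z \<bullet> x) * (\<phi> z \<bullet> y))"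
    by (rule Bochner_Integration.integral_cong[OF refl]) (simp add: influence_def inner_diff_left algebra_simps)
  also have "\<dots> = (LINT z|Q. (?p z \<bullet> x) * (?p z \<bullet> y)) - (LINT z|Q. (?p z \<bullet> x) * (\<phi> z \<bullet> y))
      - (LINT z|Q. (?p z \<bullet> y) * (\<phi> z \<bullet> x)) + (LINT z|Q. (\<phi> z \<bullet> x) * (\<phi> z \<bullet> y))"
    using int by simp
  also have "\<dots> = (LINT z|Q. (?p z \<bullet> x) * (?p z \<bullet> y)) - (LINT z|Q. (\<phi> z \<bullet> y) * (\<phi> z \<bullet> x))"
    unfolding phi_orthogonal by (simp add: mult.commute)
  also have "\<dots> = ((covmat Q \<psi> - covmat Q \<phi>) *v x) \<bullet> y"
    using covmat_inner[OF \<psi>_meas centered_psi_L2] covmat_inner[OF phi_meas, of x y] phi_L2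
    by (simp add: matrix_vector_mult_diff_rdistrib inner_diff_left phi_mean mult.commute)
  finally show ?thesis by simp
qed

text \<open>The expansion makes the scaled error of \<open>T n\<close> agree up to o_p(1) with a
  normalized sum of \<open>influence\<close>. Such a sum has bounded second moment, which gives
  tightness, and its projections obey the one-dimensional limit theorem.\<close>

lemma estimator_conv_distr:
  fixes T :: "nat \<Rightarrow> 'w \<Rightarrow> real^'r"
  assumes inv: "invertible (covmat Q \<psi> - covmat Q \<phi>)" and T[measurable]: "\<And>n. T n \<in> borel_measurable P"
    and exp: "op_small P (\<lambda>n \<omega>. T n \<omega> - (avg n (\<lambda>j. \<psi> (Z j \<omega>)) - avg n (\<lambda>j. \<phi> (Z j \<omega>)))) (\<lambda>n. 1 / sqrt (real n))"
  shows "conv_distr P (\<lambda>n \<omega>. sqrt (real n) *\<^sub>R (T n \<omega> - integral\<^sup>L Q \<psi>)) (mvnormal (covmat Q \<psi> - covmat Q \<phi>))"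
proof -
  define S where "S = covmat Q \<psi> - covmat Q \<phi>"
  have Sh: "(S *v x) \<bullet> y = (LINT z|Q. (influence z \<bullet> x) * (influence z \<bullet> y))" for x y unfolding S_def by (rule Sigma_inner)
  have sym: "transpose S = S" and pd: "\<And>x. x \<noteq> 0 \<Longrightarrow> x \<bullet> (S *v x) > 0"
    by (rule second_moment_sym[OF influence_meas influence_L2 Sh], use inv in \<open>simp add: S_def\<close>)
       (rule second_moment_posdef[OF influence_meas influence_L2 Sh], use inv in \<open>simp_all add: S_def\<close>)
  have char_S: "(LINT x|mvnormal S. cis (t \<bullet> x)) = complex_of_real (exp (- (t \<bullet> (S *v t)) / 2))" for t
    by (rule char_mvnormal[OF sym]) (rule pd)
  have prob_S: "prob_space (mvnormal S)" by (rule prob_space_mvnormal[OF sym]) (rule pd)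
  define X where "X n \<omega> = sqrt (real n) *\<^sub>R (T n \<omega> - integral\<^sup>L Q \<psi>)" for n \<omega>
  define Y where "Y n \<omega> = (1 / sqrt (real n)) *\<^sub>R (\<Sum>j\<in>{1..n}. influence (Z j \<omega>))" for n \<omega>
  have [measurable]: "X n \<in> borel_measurable P" "Y n \<in> borel_measurable P" for n
    unfolding X_def[abs_def] Y_def[abs_def] by measurable
  have null: "null_in_prob P (\<lambda>n \<omega>. X n \<omega> - Y n \<omega>)"
  proof -
    let ?R = "\<lambda>n \<omega>. T n \<omega> - (avg n (\<lambda>j. \<psi> (Z j \<omega>)) - avg n (\<lambda>j. \<phi> (Z j \<omega>)))"
    have "null_in_prob P (\<lambda>n \<omega>. norm (?R n \<omega>) / (1 / sqrt (real n)))"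
      using exp by (subst (asm) P.op_small_scale) auto
    then show ?thesis
    proof (rule P.null_in_prob_le)
      fix n :: nat and \<omega> assume n: "n \<ge> 1"
      have avgh: "avg n (\<lambda>j. influence (Z j \<omega>)) = avg n (\<lambda>j. \<psi> (Z j \<omega>)) - integral\<^sup>L Q \<psi> - avg n (\<lambda>j. \<phi> (Z j \<omega>))"
        using n by (simp add: influence_def sum_subtractf scaleR_diff_right sum_constant_scaleR del: sum_constant)
      have Y: "sqrt n *\<^sub>R avg n (\<lambda>j. influence (Z j \<omega>)) = Y n \<omega>"
      proof -
        have "sqrt n * (1 / n) = 1 / sqrt n" using n by (simp add: real_div_sqrt divide_simps)
        then show ?thesis by (simp only: Y_def scaleR_scaleR)
      qed
      have alg: "c *\<^sub>R (p - a) - c *\<^sub>R (q - a - b) = c *\<^sub>R (p - (q - b))" for c and p q a b :: "real^'r"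
        by (simp add: algebra_simps)
      have "X n \<omega> - Y n \<omega> = sqrt n *\<^sub>R ?R n \<omega>"
        unfolding X_def Y[symmetric] avgh by (rule alg)
      then show "norm (X n \<omega> - Y n \<omega>) \<le> norm (norm (?R n \<omega>) / (1 / sqrt (real n)))" by (simp add: mult.commute)
    qed
  qed
  have "bdd_in_prob P (\<lambda>n \<omega>. norm (X n \<omega>))"
  proof (rule P.bdd_in_prob_le)
    have "null_in_prob P (\<lambda>n \<omega>. norm (X n \<omega> - Y n \<omega>))" using null by (rule P.null_in_prob_le) simp
    then show "bdd_in_prob P (\<lambda>n \<omega>. norm (X n \<omega> - Y n \<omega>) + norm (Y n \<omega>))"
      unfolding Y_def by (intro P.bdd_in_prob_add P.null_imp_bdd_in_prob scaled_sum_bdd_in_prob influence_meas influence_L2 influence_mean)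
    show "\<bar>norm (X n \<omega>)\<bar> \<le> \<bar>norm (X n \<omega> - Y n \<omega>) + norm (Y n \<omega>)\<bar>" for n \<omega>
      using norm_triangle_sub[of "X n \<omega>" "Y n \<omega>"] by simp
  qed
  moreover have "(\<lambda>n. LINT \<omega>|P. cis (t \<bullet> X n \<omega>)) \<longlonglongrightarrow> (LINT x|mvnormal S. cis (t \<bullet> x))" for t
  proof (rule P.char_diff_tendsto[OF _ _ null])
    show "(\<lambda>n. LINT \<omega>|P. cis (t \<bullet> Y n \<omega>)) \<longlonglongrightarrow> (LINT x|mvnormal S. cis (t \<bullet> x))"
    \<comment> \<open>The central limit theorem asks for a positive variance, which fails for
      \<open>t = 0\<close> alone because \<open>S\<close> is positive definite.\<close>
    proof (cases "t = 0")
      case True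
      then show ?thesis unfolding char_S by (simp add: P.prob_space)
    next
      case False
      have var: "(LINT z|Q. (influence z \<bullet> t)\<^sup>2) = t \<bullet> (S *v t)"
        using Sh[of t t] by (simp add: inner_commute power2_eq_square)
      have "(\<lambda>n. LINT \<omega>|P. cis ((1 / sqrt (real n)) * (\<Sum>j\<in>{1..n}. influence (Z j \<omega>) \<bullet> t)))
          \<longlonglongrightarrow> complex_of_real (exp (- (LINT z|Q. (influence z \<bullet> t)\<^sup>2) / 2))"
      proof (rule central_limit_char)
        show "integrable Q (\<lambda>z. (influence z \<bullet> t)\<^sup>2)" by (rule integrable_inner_L2[OF influence_meas influence_L2])
        show "(LINT z|Q. influence z \<bullet> t) = 0" using integrable_of_L2[OF influence_meas influence_L2] by (simp add: influence_mean)
        show "(LINT z|Q. (influence z \<bullet> t)\<^sup>2) > 0" unfolding var by (rule pd[OF False])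
      qed simp
      moreover have "(1 / sqrt (real n)) * (\<Sum>j\<in>{1..n}. influence (Z j \<omega>) \<bullet> t) = t \<bullet> Y n \<omega>" for n \<omega>
        by (simp add: Y_def inner_sum_right inner_commute[of t])
      ultimately show ?thesis unfolding char_S var by (simp only:)
    qed
  qed measurable
  ultimately have "conv_distr P X (mvnormal S)"
    using P.tight_of_bdd_in_prob[of X] prob_S
    by (intro conv_distr_char P.prob_space_axioms) (simp_all add: mvnormal_def)
  then show ?thesis unfolding X_def[abs_def] S_def .
qed

end

theorem theorem2:
  fixes P :: "'w measure" and Q :: "'z measure"
    and Z :: "nat \<Rightarrow> 'w \<Rightarrow> 'z"
    and \<psi> :: "'z \<Rightarrow> real^'r"
    and u v :: "'z \<Rightarrow> real^'m"
    and uhat :: "nat \<Rightarrow> 'w \<Rightarrow> 'z \<Rightarrow> real^'m"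
  assumes P: "prob_space P" and Qp: "prob_space Q"
    and Zmeas: "\<And>j. Z j \<in> measurable P Q"
    and Zindep: "prob_space.indep_vars P (\<lambda>_. Q) Z UNIV"
    and Zdistr: "\<And>j. distr P Q (Z j) = Q"
    and \<psi>meas: "\<psi> \<in> borel_measurable Q"
    and \<psi>L2: "integrable Q (\<lambda>z. norm (\<psi> z) ^ 2)"
    and umeas: "u \<in> borel_measurable Q"
    and uL2: "integrable Q (\<lambda>z. norm (u z) ^ 2)"
    and umean: "integral\<^sup>L Q u = 0"
    and Wnonsing: "invertible (integral\<^sup>L Q (\<lambda>z. outer (u z) (u z)))"
    and uhatmeas: "\<And>n j. (\<lambda>\<omega>. uhat n \<omega> (Z j \<omega>)) \<in> borel_measurable P"
    and cond_i: "op_small P (\<lambda>n \<omega>. Max ((\<lambda>j. norm (uhat n \<omega> (Z j \<omega>))) ` {1..n}))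
                   (\<lambda>n. sqrt (real n))"
    and cond_ii: "op_small P
          (\<lambda>n \<omega>. onorm (\<lambda>x. ((1 / real n) *\<^sub>R (\<Sum>j\<in>{1..n}. outer (uhat n \<omega> (Z j \<omega>)) (uhat n \<omega> (Z j \<omega>)))
                              - integral\<^sup>L Q (\<lambda>z. outer (u z) (u z))) *v x))
          (\<lambda>_. 1)"
    and cond_iii: "op_small P
          (\<lambda>n \<omega>. (1 / real n) *\<^sub>R (\<Sum>j\<in>{1..n}.
              outer (\<psi> (Z j \<omega>)) (uhat n \<omega> (Z j \<omega>))
              - integral\<^sup>L P (\<lambda>\<omega>'. outer (\<psi> (Z j \<omega>')) (uhat n \<omega>' (Z j \<omega>')))))
          (\<lambda>_. 1)"
    and vmeas: "v \<in> borel_measurable Q"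
    and vL2: "integrable Q (\<lambda>z. norm (v z) ^ 2)"
    and vmean: "integral\<^sup>L Q v = 0"
    and vnonsing: "invertible (integral\<^sup>L Q (\<lambda>z. outer (v z) (v z)))"
    and cond_iv: "(\<lambda>n. ennreal (1 / real n) *
          (\<Sum>j\<in>{1..n}. \<integral>\<^sup>+\<omega>. ennreal (norm (uhat n \<omega> (Z j \<omega>) - v (Z j \<omega>)) ^ 2) \<partial>P))
          \<longlonglongrightarrow> 0"
    and cond_v: "op_small P
          (\<lambda>n \<omega>. (1 / real n) *\<^sub>R (\<Sum>j\<in>{1..n}. uhat n \<omega> (Z j \<omega>))
                 - (1 / real n) *\<^sub>R (\<Sum>j\<in>{1..n}. v (Z j \<omega>)))
          (\<lambda>n. 1 / sqrt (real n))"
  shows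
    "let good = (\<lambda>n \<omega> \<zeta>. (\<forall>j\<in>{1..n}. 1 + uhat n \<omega> (Z j \<omega>) \<bullet> \<zeta> > 0) \<and>
                   (1 / real n) *\<^sub>R (\<Sum>j\<in>{1..n}. (1 / (1 + uhat n \<omega> (Z j \<omega>) \<bullet> \<zeta>)) *\<^sub>R uhat n \<omega> (Z j \<omega>)) = 0);
         \<theta> = integral\<^sup>L Q \<psi>;
         \<phi> = (\<lambda>z. (integral\<^sup>L Q (\<lambda>z. outer (\<psi> z) (v z))
                    ** matrix_inv (integral\<^sup>L Q (\<lambda>z. outer (v z) (v z)))) *v v z);
         \<Sigma> = covmat Q \<psi> - covmat Q \<phi>
     in wptto P (\<lambda>n \<omega>. \<exists>!\<zeta>. good n \<omega> \<zeta>) \<and>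
        (\<forall>\<zeta>hat :: nat \<Rightarrow> 'w \<Rightarrow> real^'m.
           (\<forall>n. \<forall>\<omega>\<in>space P. (\<exists>!\<zeta>. good n \<omega> \<zeta>) \<longrightarrow> good n \<omega> (\<zeta>hat n \<omega>)) \<longrightarrow>
           (let \<theta>hat = (\<lambda>n \<omega>. (1 / real n) *\<^sub>R
                  (\<Sum>j\<in>{1..n}. (1 / (1 + uhat n \<omega> (Z j \<omega>) \<bullet> \<zeta>hat n \<omega>)) *\<^sub>R \<psi> (Z j \<omega>)))
            in op_small P
                 (\<lambda>n \<omega>. \<theta>hat n \<omega> - ((1 / real n) *\<^sub>R (\<Sum>j\<in>{1..n}. \<psi> (Z j \<omega>))
                                   - (1 / real n) *\<^sub>R (\<Sum>j\<in>{1..n}. \<phi> (Z j \<omega>))))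
                 (\<lambda>n. 1 / sqrt (real n)) \<and>
               (invertible \<Sigma> \<and> (\<forall>n. \<theta>hat n \<in> borel_measurable P) \<longrightarrow>
                  conv_distr P (\<lambda>n \<omega>. sqrt (real n) *\<^sub>R (\<theta>hat n \<omega> - \<theta>)) (mvnormal \<Sigma>))))"
proof -
  interpret el_setting P Q Z \<psi> v uhat "integral\<^sup>L Q (\<lambda>z. outer (u z) (u z))"
    by (intro el_setting.intro iid_sample.intro iid_sample_axioms.intro el_setting_axioms.intro) (fact assms)+
  \<comment> \<open>Two forms of one equation: \<open>\<phi>\<close> occurs as a function in the
    covariance and, beta-reduced, applied to \<open>Z j \<omega>\<close> in the average.\<close>
  have phi: "(\<lambda>z. (integral\<^sup>L Q (\<lambda>z. outer (\<psi> z) (v z)) ** matrix_inv (integral\<^sup>L Q (\<lambda>z. outer (v z) (v z)))) *v v z) = \<phi>"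
    by (rule ext) (simp only: \<phi>_def C_def V_def)
  have phi': "(integral\<^sup>L Q (\<lambda>z. outer (\<psi> z) (v z)) ** matrix_inv (integral\<^sup>L Q (\<lambda>z. outer (v z) (v z)))) *v v z = \<phi> z" for z
    by (simp only: \<phi>_def C_def V_def)
  show ?thesis
    unfolding Let_def phi phi' good_def[symmetric]
  proof (intro conjI allI impI)
    show "wptto P (\<lambda>n \<omega>. \<exists>!\<zeta>. good n \<omega> \<zeta>)" by (rule wptto_unique_root)
  next
    fix \<zeta>hat assume "\<forall>n. \<forall>\<omega>\<in>space P. (\<exists>!\<zeta>. good n \<omega> \<zeta>) \<longrightarrow> good n \<omega> (\<zeta>hat n \<omega>)"
    note expansion = estimator_expansion[OF this]
    show "op_small P (\<lambda>n \<omega>. avg n (\<lambda>j. (1 / (1 + U n \<omega> j \<bullet> \<zeta>hat n \<omega>)) *\<^sub>R \<psi> (Z j \<omega>))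
        - (avg n (\<lambda>j. \<psi> (Z j \<omega>)) - avg n (\<lambda>j. \<phi> (Z j \<omega>)))) (\<lambda>n. 1 / sqrt (real n))"
      by (rule expansion)
    assume a: "invertible (covmat Q \<psi> - covmat Q \<phi>) \<and>
      (\<forall>n. (\<lambda>\<omega>. avg n (\<lambda>j. (1 / (1 + U n \<omega> j \<bullet> \<zeta>hat n \<omega>)) *\<^sub>R \<psi> (Z j \<omega>))) \<in> borel_measurable P)"
    show "conv_distr P (\<lambda>n \<omega>. sqrt (real n) *\<^sub>R (avg n (\<lambda>j. (1 / (1 + U n \<omega> j \<bullet> \<zeta>hat n \<omega>)) *\<^sub>R \<psi> (Z j \<omega>))
        - integral\<^sup>L Q \<psi>)) (mvnormal (covmat Q \<psi> - covmat Q \<phi>))"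
      by (rule estimator_conv_distr[OF conjunct1[OF a] conjunct2[OF a, rule_format] expansion])
  qed
qed

end
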